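(* Suppose that: (a) $E\|F(x,\xi)\|^2<\infty$ for all $x\in O$; (b) for a.e. $\omega\in\Omega$ the map $x\mapsto F(x,\xi(\omega))$ is continuously differentiable on $O$, and $E\|d_xF(x,\xi)\|^2<\infty$ for all $x\in O$; (c) there is a square integrable random variable $C$ such that $\|F(x,\xi(\omega))-F(x',\xi(\omega))\|+\|d_xF(x,\xi(\omega))-d_xF(x',\xi(\omega))\|\le C(\omega)\|x-x'\|$ for all $x,x'\in O$ and a.e. $\omega\in\Omega$. Suppose further that $x_0\in S\cap O$ solves $0\in f_0(x_0)+N_S(x_0)$ and that, with $z_0=x_0-f_0(x_0)$, $L=df_0(x_0)$, $K=T_S(x_0)\cap\{z_0-x_0\}^\perp$, the map $L_K:\mathbb{R}^q\to\mathbb{R}^q$, $L_K(h)=L(\Pi_K(h))+h-\Pi_K(h)$, is a homeomorphism from $\mathbb{R}^q$ to $\mathbb{R}^q$. Let $z_n$ be the solutions of the sample average normal map equations $(f_n)_S(z)=0$ near $z_0$ and $x_n=\Pi_S(z_n)$ (as fixed in the context). Let $\Sigma_0$ be the covariance matrix of $F(x_0,\xi)$, assumed nonsingular, let $\Sigma_n$ be the sample covariance matrix of $\{F(x_n,\xi^i)\}_{i=1}^n$, and let $\alpha\in[0,1]$. Then for almost every $\omega\in\Omega$ there exists an integer $N_\omega$ such that $\Sigma_n$ is nonsingular for $n\ge N_\omega$. Moreover, $$-\sqrt{n}\,\Sigma_n^{-1/2}[d(f_n)_S(z_n)(z_0-z_n)]\Rightarrow\mathcal{N}(0,I_q)$$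 (weak convergence), and the probability for $z_0$ to belong to the set $$\left\{z\in\mathbb{R}^q\ \middle|\ n\big[d(f_n)_S(z_n)(z-z_n)\big]^T\Sigma_n^{-1}\big[d(f_n)_S(z_n)(z-z_n)\big]\le\chi^2_q(\alpha)\right\}$$ converges to $1-\alpha$ as $n\to\infty$.
   Context: Setting. $(\Omega,\mathcal{F},P)$ is a probability space; $\xi$ is a random vector on $\Omega$ supported on a closed set $\Xi\subset\mathbb{R}^d$; $O\subset\mathbb{R}^q$ is open; $F:O\times\Xi\to\mathbb{R}^q$ is measurable and $f_0(x)=E[F(x,\xi)]$ is well defined for each $x\in O$; $d_xF$ is the partial derivative in $x$ (a $q\times q$ matrix). $S\subset\mathbb{R}^q$ is a polyhedral convex set. $\xi^1,\xi^2,\dots$ are i.i.d. with the distribution of $\xi$, and $f_n(x)=f_n(x,\omega)=n^{-1}\sum_{i=1}^nF(x,\xi^i(\omega))$. Under (a)-(c), $f_0$ is continuously differentiable on $O$. Convex notions. $N_S(x)=\{v:\langle v,s-x\rangle\le0\ \forall s\in S\}$; $T_S(x)=\{v:\exists t>0,\ x+tv\in S\}$ for $x\in S$; $\Pi_C$ is the Euclidean projection onto a closed convex set $C$. B-derivative. A locally Lipschitz function $g$ is B-differentiable at $x$ if there is a positively homogeneous function $G=dg(x)$ with $g(x+v)=g(x)+G(v)+o(v)$; then $dg(x)(h)$ is the directional derivative of $g$ at $x$ along $h$. $\Pi_S$ is piecewise affine and hence B-differentiable everywhere. Normal maps. For a function $g$ on $O$ with values in $\mathbb{R}^q$, $g_S(z)=g(\Pi_S(z))+z-\Pi_S(z)$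 for $z\in\Pi_S^{-1}(O)$. For $g$ differentiable at $\Pi_S(z)$, $dg_S(z)(h)=dg(\Pi_S(z))(d\Pi_S(z)(h))+h-d\Pi_S(z)(h)$. One has $\Pi_S(z_0)=x_0$, $(f_0)_S(z_0)=0$ and $d(f_0)_S(z_0)=L_K$. SAA solutions. It is a known result that, under the hypotheses of the claim, there are neighborhoods $X_0$ of $x_0$ in $O$ and $Z$ of $z_0$ such that for a.e. $\omega$ there is an integer $N_\omega$ such that for each $n\ge N_\omega$ the equation $(f_n)_S(z)=0$ has a unique solution $z_n$ in $Z$, and $x_n=\Pi_S(z_n)$ is the unique solution in $X_0$ of $0\in f_n(x)+N_S(x)$; moreover $z_n\to z_0$ and $x_n\to x_0$ almost surely, $\sqrt n(z_n-z_0)\Rightarrow (L_K)^{-1}(Y_0)$ and $\sqrt n L_K(z_n-z_0)\Rightarrow Y_0$, with $Y_0$ normal with mean $0$ and covariance matrix $\Sigma_0$. Such neighborhoods are fixed; $z_n$ denotes this solution (for $n<N_\omega$, any measurable choice in $\Pi_S^{-1}(O)$), and $x_n=\Pi_S(z_n)$. $\chi^2_l$ is a $\chi^2$ random variable with $l$ degrees of freedom and $\chi^2_l(\alpha)$ is the number with $P(\chi^2_l>\chi^2_l(\alpha))=\alpha$ (read as $+\infty$ for $\alpha=0$ and $0$ for $\alpha=1$). $\mathcal{N}(0,\Sigma)$ is a normal random vector with mean zero and covariance matrix $\Sigma$. *)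

theory Defs
  imports "HOL-Probability.Probability"
begin

section \<open>Convex-analytic notions\<close>

text \<open>The projection onto a closed convex set is the library's \<^const>\<open>closest_point\<close>.
  As usual, the normal cone is empty at points outside \<open>S\<close>, so that a solution of
  \<open>0 \<in> g x + N\<^sub>S(x)\<close> always lies in \<open>S\<close>.\<close>

definition normal_cone :: "'a::real_inner set \<Rightarrow> 'a \<Rightarrow> 'a set" where
  "normal_cone S x = {v. x \<in> S \<and> (\<forall>s\<in>S. v \<bullet> (s - x) \<le> 0)}"

text \<open>This set of feasible directions is the tangent cone because it is only used for
  polyhedral \<open>S\<close> (in general one would have to take the closure).\<close>

definition tangent_cone :: "'a::real_vector set \<Rightarrow> 'a \<Rightarrow> 'a set" where
  "tangent_cone S x = {v. \<exists>t>0. x + t *\<^sub>R v \<in> S}"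

definition solves_gen_eq :: "('a::real_inner \<Rightarrow> 'a) \<Rightarrow> 'a set \<Rightarrow> 'a \<Rightarrow> bool" where
  "solves_gen_eq g S x \<longleftrightarrow> 0 \<in> (\<lambda>v. g x + v) ` normal_cone S x"

section \<open>Derivatives and normal maps\<close>

definition C1_on :: "(real^'n) set \<Rightarrow> (real^'n \<Rightarrow> real^'m) \<Rightarrow> bool" where
  "C1_on U g \<longleftrightarrow> (\<forall>x\<in>U. g differentiable (at x)) \<and>
                continuous_on U (\<lambda>x. jacobian g (at x))"

definition has_B_derivative ::
    "('a::real_normed_vector \<Rightarrow> 'b::real_normed_vector) \<Rightarrow> ('a \<Rightarrow> 'b) \<Rightarrow> 'a \<Rightarrow> bool" where
  "has_B_derivative g G x \<longleftrightarrow>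
     (\<exists>e>0. \<exists>c. c-lipschitz_on (ball x e) g) \<and>
     (\<forall>t\<ge>0. \<forall>v. G (t *\<^sub>R v) = t *\<^sub>R G v) \<and>
     ((\<lambda>v. norm (g (x + v) - g x - G v) / norm v) \<longlongrightarrow> 0) (at 0)"

definition B_derivative ::
    "('a::real_normed_vector \<Rightarrow> 'b::real_normed_vector) \<Rightarrow> 'a \<Rightarrow> 'a \<Rightarrow> 'b" where
  "B_derivative g x = (THE G. has_B_derivative g G x)"

definition normal_map :: "('a::euclidean_space \<Rightarrow> 'a) \<Rightarrow> 'a set \<Rightarrow> 'a \<Rightarrow> 'a" where
  "normal_map g S z = g (closest_point S z) + z - closest_point S z"

definition normal_map_deriv ::
    "('a::euclidean_space \<Rightarrow> 'a) \<Rightarrow> 'a set \<Rightarrow> 'a \<Rightarrow> 'a \<Rightarrow> 'a" where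
  "normal_map_deriv g S z h =
     frechet_derivative g (at (closest_point S z)) (B_derivative (closest_point S) z h)
     + h - B_derivative (closest_point S) z h"

section \<open>Matrices\<close>

definition psd_sqrt :: "real^'n^'n \<Rightarrow> real^'n^'n" where
  "psd_sqrt A = (THE B. transpose B = B \<and> (\<forall>x. 0 \<le> x \<bullet> (B *v x)) \<and> B ** B = A)"

definition inv_sqrt :: "real^'n^'n \<Rightarrow> real^'n^'n" where
  "inv_sqrt A = matrix_inv (psd_sqrt A)"

section \<open>Probability\<close>

definition covariance_matrix :: "'w measure \<Rightarrow> ('w \<Rightarrow> real^'n) \<Rightarrow> real^'n^'n" where
  "covariance_matrix M Y =
     (\<chi> i j. LINT \<omega>|M. (Y \<omega> $ i - (LINT \<omega>'|M. Y \<omega>' $ i)) * (Y \<omega> $ j - (LINT \<omega>'|M. Y \<omega>' $ j)))"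

text \<open>Unbiased sample covariance matrix of \<open>y 1, \<dots>, y n\<close>.\<close>

definition sample_mean :: "nat \<Rightarrow> (nat \<Rightarrow> real^'n) \<Rightarrow> real^'n" where
  "sample_mean n y = (1 / real n) *\<^sub>R (\<Sum>k=1..n. y k)"

definition sample_covariance_matrix :: "nat \<Rightarrow> (nat \<Rightarrow> real^'n) \<Rightarrow> real^'n^'n" where
  "sample_covariance_matrix n y =
     (\<chi> i j. (\<Sum>k=1..n. (y k - sample_mean n y) $ i * (y k - sample_mean n y) $ j)
             / (real n - 1))"

definition std_normal_vec :: "(real^'n) measure" where
  "std_normal_vec = density lborel (\<lambda>x. ennreal (\<Prod>i\<in>UNIV. std_normal_density (x $ i)))"

definition chi_square :: "nat \<Rightarrow> real measure" where
  "chi_square l = distr (\<Pi>\<^sub>M i\<in>{..<l}. std_normal_distribution) borel (\<lambda>x. \<Sum>i<l. (x i)\<^sup>2)"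

definition chi_square_quantile :: "nat \<Rightarrow> real \<Rightarrow> ereal" where
  "chi_square_quantile l \<alpha> =
     (if \<alpha> = 0 then \<infinity> else if \<alpha> = 1 then 0
      else ereal (THE c. measure (chi_square l) {c<..} = \<alpha>))"

definition converges_in_distribution ::
    "'w measure \<Rightarrow> (nat \<Rightarrow> 'w \<Rightarrow> 'a::euclidean_space) \<Rightarrow> 'a measure \<Rightarrow> bool" where
  "converges_in_distribution M Y \<nu> \<longleftrightarrow>
     (\<forall>n. Y n \<in> borel_measurable M) \<and>
     (\<forall>g :: 'a \<Rightarrow> real. continuous_on UNIV g \<and> bounded (range g) \<longrightarrow>
        (\<lambda>n. LINT \<omega>|M. g (Y n \<omega>)) \<longlonglongrightarrow> (LINT y|\<nu>. g y))"

section \<open>The confidence region\<close>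

definition confidence_region ::
    "nat \<Rightarrow> (real^'q \<Rightarrow> real^'q) \<Rightarrow> (real^'q) set \<Rightarrow> real^'q \<Rightarrow> real^'q^'q \<Rightarrow> real \<Rightarrow> (real^'q) set"
  where
  "confidence_region n g S zn A \<alpha> =
     {z. ereal (real n * (normal_map_deriv g S zn (z - zn) \<bullet>
                          (matrix_inv A *v normal_map_deriv g S zn (z - zn))))
         \<le> chi_square_quantile CARD('q) \<alpha>}"

text \<open>
  Conventions for statements about a probability space \<open>M\<close> and sample functions \<open>F x (\<xi> \<omega>)\<close>.

  \<^item> A quantity that is only defined for almost every \<open>\<omega>\<close> (for instance a derivative of a sample
    average) has an arbitrary value on the exceptional null set. Its law is therefore taken in
    \<open>completion M\<close>; for quantities measurable with respect to \<open>M\<close> this changes nothing. Likewise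
    \<open>E \<parallel>Y\<parallel>\<^sup>2 < \<infinity>\<close> is stated with the nonnegative integral.

  \<^item> ``For a.e. \<open>\<omega>\<close> the function \<open>x \<mapsto> F x (\<xi> \<omega>)\<close> is continuously differentiable'' is a condition on
    the law of \<open>\<xi>\<close>, shared by all copies of \<open>\<xi>\<close>, and is stated as \<open>AE s in distr M borel \<xi>\<close>.
    For Borel measurable \<open>F\<close> the set of such \<open>s\<close> is coanalytic, hence universally measurable, so
    this is the same as the condition on almost every \<open>\<omega>\<close>.

  \<^item> Matrices carry the Frobenius norm, which is the library norm of \<open>real^'q^'q\<close>.
\<close>

end

theory Submission
  imports Defs "HOL-Real_Asymp.Real_Asymp"
begin

text \<open>
  Near \<open>z0\<close> the projection satisfies \<open>\<Pi>\<^sub>S (z0 + h) = x0 + \<Pi>\<^sub>K h\<close> exactly, because \<open>S\<close> is polyhedral. Hence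
  \<open>(f\<^sub>n)\<^sub>S (z0 + h) = d\<^sub>n + LK h + r\<^sub>n h\<close> with \<open>d\<^sub>n = f\<^sub>n x0 - f0 x0\<close> and, by the strong law of large numbers for
  the values, the derivatives and the Lipschitz constants at \<open>x0\<close>, a remainder \<open>r\<^sub>n h = o(\<bar>h\<bar>)\<close> uniformly in
  large \<open>n\<close>. Brouwer's theorem applied to \<open>h \<mapsto> LK\<inverse> (- d\<^sub>n - r\<^sub>n h)\<close> produces a zero near \<open>z0\<close>, which must
  be \<open>z\<^sub>n\<close>; so \<open>z\<^sub>n \<longlonglongrightarrow> z0\<close> with \<open>\<bar>z\<^sub>n - z0\<bar> = O(\<bar>d\<^sub>n\<bar>)\<close>. As \<open>\<Pi>\<^sub>S\<close> is affine along the segment from \<open>z\<^sub>n\<close> to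
  \<open>z0\<close>, it follows that \<open>d(f\<^sub>n)\<^sub>S(z\<^sub>n)(z0 - z\<^sub>n) = d\<^sub>n + o(\<bar>d\<^sub>n\<bar>)\<close> almost surely. The multivariate central
  limit theorem for \<open>d\<^sub>n\<close>, consistency of \<open>\<Sigma>\<^sub>n\<close>, and Slutsky's theorem then give both limits.
\<close>

section \<open>Projections onto polyhedra\<close>

text \<open>The B-derivative of \<open>closest_point S\<close> is not continuous in its base point,
  so \<open>normal_map_deriv (fs n \<omega>) S (z n \<omega>)\<close> need not approach the
  derivative at \<open>z0\<close>, however close \<open>z n \<omega>\<close> comes; only the
  particular direction \<open>z0 - z n \<omega>\<close> can be evaluated. The analysis of the
  solutions is therefore carried out along one fixed sample path, with every error measured relative
  to the size of \<open>d_n\<close>. After multiplication by \<open>sqrt n\<close> the error is a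
  vanishing factor times a normalised i.i.d. sum with bounded second moment; this relative form of
  Slutsky's theorem makes no moment demands on the statistic that contains the random inverse
  matrix. A second obstacle is that the conditions on \<open>F\<close> hold for almost every sample
  point only, while the statistic differentiates \<open>F\<close> at a random point. The proof uses
  Borel versions of \<open>F\<close> and of its Jacobian that vanish off a good set of sample
  points, and carries measurability over to the completion.\<close>

lemma closest_point_eqI:
  fixes S :: "'a::euclidean_space set"
  assumes "convex S" "closed S" "p \<in> S" "\<And>s. s \<in> S \<Longrightarrow> (a - p) \<bullet> (s - p) \<le> 0"
  shows "closest_point S a = p"
proof -
  have "dist a p \<le> dist a s" if "s \<in> S" for s
  proof -
    have "(norm (a - s))\<^sup>2 = (norm (a - p))\<^sup>2 - 2 * ((a - p) \<bullet> (s - p)) + (norm (s - p))\<^sup>2"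
      by (simp add: power2_norm_eq_inner algebra_simps inner_commute)
    then have "(norm (a - p))\<^sup>2 \<le> (norm (a - s))\<^sup>2"
      using assms(4)[OF that] zero_le_power2[of "norm (s - p)"] by linarith
    then show ?thesis
      unfolding dist_norm by (rule power2_le_imp_le) simp
  qed
  then show ?thesis
    using closest_point_unique[OF assms(1-3), of a] by auto
qed

lemma tangent_cone_scaleR:
  assumes "x \<in> S" "v \<in> tangent_cone S x" "c \<ge> 0"
  shows "c *\<^sub>R v \<in> tangent_cone S x"
proof (cases "c = 0")
  case True
  then show ?thesis
    using assms(1) by (auto simp: tangent_cone_def intro!: exI[of _ 1])
next
  case False
  from assms obtain t where "t > 0" "x + t *\<^sub>R v \<in> S"
    by (auto simp: tangent_cone_def)
  with False assms(3) show ?thesis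
    by (auto simp: tangent_cone_def intro!: exI[of _ "t / c"])
qed

lemma convex_tangent_cone:
  assumes "convex S" "x \<in> S"
  shows "convex (tangent_cone S x)"
proof (rule convexI)
  fix v w :: 'a and a b :: real
  assume "v \<in> tangent_cone S x" "w \<in> tangent_cone S x" and ab: "0 \<le> a" "0 \<le> b" "a + b = 1"
  then obtain s t where st: "s > 0" "x + s *\<^sub>R v \<in> S" "t > 0" "x + t *\<^sub>R w \<in> S"
    by (auto simp: tangent_cone_def)
  have scale: "x + r *\<^sub>R u \<in> S" if "x + q *\<^sub>R u \<in> S" "0 \<le> r" "r \<le> q" "q > 0" for q r u
  proof -
    have "(1 - r / q) *\<^sub>R x + (r / q) *\<^sub>R (x + q *\<^sub>R u) \<in> S"
      using that assms by (intro convexD) auto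
    with that(4) show ?thesis
      by (simp add: algebra_simps)
  qed
  let ?m = "min s t"
  have "a *\<^sub>R (x + ?m *\<^sub>R v) + b *\<^sub>R (x + ?m *\<^sub>R w) \<in> S"
    using st ab assms(1) scale[OF st(2), of ?m] scale[OF st(4), of ?m] by (intro convexD) auto
  also have "a *\<^sub>R (x + ?m *\<^sub>R v) + b *\<^sub>R (x + ?m *\<^sub>R w) = (a + b) *\<^sub>R x + ?m *\<^sub>R (a *\<^sub>R v + b *\<^sub>R w)"
    by (simp add: algebra_simps)
  finally show "a *\<^sub>R v + b *\<^sub>R w \<in> tangent_cone S x"
    using st ab by (auto simp: tangent_cone_def intro!: exI[of _ ?m])
qed

text \<open>Among the finitely many half-spaces cutting out \<open>S\<close>, those active at
  \<open>x\<close> impose a homogeneous condition, which a feasible direction satisfies at every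
  length, and the others leave positive slack. Hence one radius serves all directions, which fails
  for general convex sets.\<close>

lemma tangent_cone_locally_feasible:
  fixes S :: "'a::euclidean_space set"
  assumes "polyhedron S" "x \<in> S"
  obtains e where "e > 0" "\<And>v. v \<in> tangent_cone S x \<Longrightarrow> norm v \<le> e \<Longrightarrow> x + v \<in> S"
proof -
  from assms(1) obtain H where H: "finite H" "S = \<Inter>H" "\<forall>h\<in>H. \<exists>a b. a \<noteq> 0 \<and> h = {x. a \<bullet> x \<le> b}"
    unfolding polyhedron_def by auto
  have "\<forall>h\<in>H. \<exists>e>0. \<forall>v t. t > 0 \<longrightarrow> x + t *\<^sub>R v \<in> h \<longrightarrow> norm v \<le> e \<longrightarrow> x + v \<in> h"
  proof
    fix h assume "h \<in> H"
    with H obtain a b where h: "a \<noteq> 0" "h = {x. a \<bullet> x \<le> b}" by blast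
    have "a \<bullet> x \<le> b" using \<open>h \<in> H\<close> H(2) h(2) assms(2) by auto
    show "\<exists>e>0. \<forall>v t. t > 0 \<longrightarrow> x + t *\<^sub>R v \<in> h \<longrightarrow> norm v \<le> e \<longrightarrow> x + v \<in> h"
    proof (cases "a \<bullet> x = b")
      case True
      then have "x + v \<in> h" if "t > 0" "x + t *\<^sub>R v \<in> h" for v t
        using that h by (auto simp: inner_add_right mult_le_0_iff)
      then show ?thesis by (auto intro!: exI[of _ 1])
    next
      case False
      with \<open>a \<bullet> x \<le> b\<close> have pos: "0 < (b - a \<bullet> x) / norm a" using h by auto
      have "x + v \<in> h" if "norm v \<le> (b - a \<bullet> x) / norm a" for v
      proof -
        have "a \<bullet> v \<le> norm a * norm v" by (rule norm_cauchy_schwarz)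
        also have "\<dots> \<le> b - a \<bullet> x" using that h by (simp add: field_simps)
        finally show ?thesis using h by (simp add: inner_add_right)
      qed
      with pos show ?thesis by blast
    qed
  qed
  from bchoice[OF this] obtain e where e: "\<forall>h\<in>H. e h > 0 \<and>
      (\<forall>v t. t > 0 \<longrightarrow> x + t *\<^sub>R v \<in> h \<longrightarrow> norm v \<le> e h \<longrightarrow> x + v \<in> h)" ..
  show thesis
  proof
    show "Min (insert 1 (e ` H)) > 0" using e H(1) by auto
    show "x + v \<in> S" if v: "v \<in> tangent_cone S x" "norm v \<le> Min (insert 1 (e ` H))" for v
    proof -
      obtain t where "t > 0" "x + t *\<^sub>R v \<in> S"
        using v by (auto simp: tangent_cone_def)
      moreover have "norm v \<le> e h" if "h \<in> H" for h
        using v(2) H(1) that by auto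
      ultimately show ?thesis using e H(2) by blast
    qed
  qed
qed

text \<open>One common factor shrinks a convergent sequence of feasible directions into the radius
  where \<open>x + v\<close> lies in \<open>S\<close>; closedness of \<open>S\<close> then passes to
  the limit.\<close>

lemma closed_tangent_cone:
  fixes S :: "'a::euclidean_space set"
  assumes "polyhedron S" "x \<in> S"
  shows "closed (tangent_cone S x)"
proof -
  obtain e where e: "e > 0" "\<And>v. v \<in> tangent_cone S x \<Longrightarrow> norm v \<le> e \<Longrightarrow> x + v \<in> S"
    using tangent_cone_locally_feasible[OF assms] by blast
  show ?thesis
    unfolding closed_sequential_limits
  proof (intro allI impI, elim conjE)
    fix v l assume v: "\<forall>n. v n \<in> tangent_cone S x" and lim: "v \<longlonglongrightarrow> l"
    define c where "c = e / (1 + norm l)"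
    have c: "c > 0" "c * norm l < e"
      using e(1) by (simp_all add: c_def divide_simps add_pos_nonneg)
    have "(\<lambda>n. norm (c *\<^sub>R v n)) \<longlonglongrightarrow> norm (c *\<^sub>R l)"
      by (intro tendsto_intros lim)
    then have "\<forall>\<^sub>F n in sequentially. norm (c *\<^sub>R v n) < e"
      using c by (intro order_tendstoD) auto
    then have "\<forall>\<^sub>F n in sequentially. x + c *\<^sub>R v n \<in> S"
      by eventually_elim (rule e(2), use v c tangent_cone_scaleR[OF assms(2)] in auto)
    moreover have "(\<lambda>n. x + c *\<^sub>R v n) \<longlonglongrightarrow> x + c *\<^sub>R l"
      by (intro tendsto_intros lim)
    ultimately have "x + c *\<^sub>R l \<in> S"
      by (intro Lim_in_closed_set[OF polyhedron_imp_closed[OF assms(1)] _ trivial_limit_sequentially])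
    with c show "l \<in> tangent_cone S x"
      by (auto simp: tangent_cone_def)
  qed
qed

text \<open>Cutting \<open>S\<close> with a box around \<open>x\<close> gives a polytope, the convex
  hull of finitely many points. A linear inequality based at \<open>x\<close> over the possibly
  unbounded \<open>S\<close> then needs to be tested at these points only.\<close>

lemma polyhedron_local_vertices:
  fixes S :: "'a::euclidean_space set"
  assumes "polyhedron S" "x \<in> S"
  obtains V where "finite V" "V \<subseteq> S"
    "\<And>s. s \<in> S \<Longrightarrow> \<exists>c>0. x + c *\<^sub>R (s - x) \<in> convex hull V"
proof -
  have "polytope (S \<inter> cbox (x - One) (x + One))"
    using assms(1) polytope_Int_polyhedron[OF polytope_interval] by (metis Int_commute)
  then obtain V where V: "finite V" "S \<inter> cbox (x - One) (x + One) = convex hull V"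
    unfolding polytope_def by blast
  show thesis
  proof
    show "finite V" by fact
    show "V \<subseteq> S" using hull_subset[of V convex] V(2) by auto
    fix s assume s: "s \<in> S"
    \<comment> \<open>This factor makes the displacement \<open>?c *\<^sub>R (s - x)\<close> shorter
      than 1, so the point stays in the unit box.\<close>
    let ?c = "1 / (1 + norm (s - x))"
    have c: "?c > 0" "?c \<le> 1" by (auto simp: add_pos_nonneg)
    have "(1 - ?c) *\<^sub>R x + ?c *\<^sub>R s \<in> S"
      using c s assms by (intro convexD polyhedron_imp_convex) auto
    moreover have "(1 - ?c) *\<^sub>R x + ?c *\<^sub>R s = x + ?c *\<^sub>R (s - x)"
      by (simp add: algebra_simps)
    moreover have "x + ?c *\<^sub>R (s - x) \<in> cbox (x - One) (x + One)"
    proof -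
      have "\<bar>(?c *\<^sub>R (s - x)) \<bullet> i\<bar> \<le> 1" if "i \<in> Basis" for i
      proof -
        have "\<bar>(?c *\<^sub>R (s - x)) \<bullet> i\<bar> \<le> norm (?c *\<^sub>R (s - x))"
          by (rule Basis_le_norm) fact
        also have "\<dots> \<le> 1" by (simp add: divide_simps add_pos_nonneg)
        finally show ?thesis .
      qed
      moreover have "One \<bullet> i = 1" if "i \<in> Basis" for i :: 'a
        using that by (simp add: inner_sum_left inner_Basis)
      ultimately show ?thesis
        unfolding mem_box inner_add_left inner_diff_left[of x]
        by (smt (verit))
    qed
    ultimately show "\<exists>c>0. x + c *\<^sub>R (s - x) \<in> convex hull V"
      using c V(2) by (intro exI[of _ ?c]) auto
  qed
qed

section \<open>The critical cone and the local formula for the projection\<close>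

text \<open>The base point \<open>z\<close> is arbitrary rather than the solution point of the
  theorem: the locale is also instantiated at nearby points, whose B-derivatives belong to different
  critical cones.\<close>

locale critical_cone =
  fixes S :: "'a::euclidean_space set" and z x :: 'a and K :: "'a set"
  assumes polyhedron: "polyhedron S" and nonempty: "S \<noteq> {}"
    and x_def: "x = closest_point S z"
    and K_def: "K = tangent_cone S x \<inter> {v. v \<bullet> (z - x) = 0}"
begin

lemma x_in: "x \<in> S"
  unfolding x_def using polyhedron nonempty by (simp add: closest_point_in_set polyhedron_imp_closed)

lemma normal: "s \<in> S \<Longrightarrow> (z - x) \<bullet> (s - x) \<le> 0"
  unfolding x_def using polyhedron
  by (intro closest_point_dot polyhedron_imp_convex polyhedron_imp_closed)

lemma zero_in_K: "0 \<in> K"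
  using x_in by (auto simp: K_def tangent_cone_def intro!: exI[of _ 1])

lemma closed_K: "closed K"
proof -
  have "closed {v. (z - x) \<bullet> v = 0}" by (rule closed_hyperplane)
  then show ?thesis
    unfolding K_def using polyhedron x_in by (intro closed_Int closed_tangent_cone) (auto simp: inner_commute)
qed

lemma convex_K: "convex K"
proof -
  have "convex {v. (z - x) \<bullet> v = 0}" by (rule convex_hyperplane)
  then show ?thesis
    unfolding K_def using x_in polyhedron_imp_convex[OF polyhedron]
    by (intro convex_Int convex_tangent_cone) (auto simp: inner_commute)
qed

lemma scaleR_K: "v \<in> K \<Longrightarrow> c \<ge> 0 \<Longrightarrow> c *\<^sub>R v \<in> K"
  unfolding K_def using tangent_cone_scaleR[OF x_in] by auto

lemma closest_K_in: "closest_point K v \<in> K"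
  using closed_K zero_in_K by (intro closest_point_in_set) auto

text \<open>A convex cone is closed under addition, so the variational inequality of the projection
  may be tested at the projection plus \<open>k\<close>. With the orthogonality below this is
  Moreau's decomposition of \<open>v\<close>.\<close>

lemma closest_K_polar:
  assumes "k \<in> K" shows "(v - closest_point K v) \<bullet> k \<le> 0"
proof -
  have "2 *\<^sub>R ((1/2) *\<^sub>R closest_point K v + (1/2) *\<^sub>R k) \<in> K"
    using closest_K_in assms convex_K by (intro scaleR_K convexD) auto
  then have "closest_point K v + k \<in> K"
    by (simp add: scaleR_add_right)
  from closest_point_dot[OF convex_K closed_K this, of v] show ?thesis
    by simp
qed

lemma closest_K_orthogonal: "(v - closest_point K v) \<bullet> closest_point K v = 0"
  using closest_K_polar[OF closest_K_in[of v], of v]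
    closest_point_dot[OF convex_K closed_K zero_in_K, of v]
  by simp

lemma closest_K_scaleR:
  assumes "t \<ge> 0" shows "closest_point K (t *\<^sub>R v) = t *\<^sub>R closest_point K v"
proof (rule closest_point_eqI[OF convex_K closed_K])
  show "t *\<^sub>R closest_point K v \<in> K" by (intro scaleR_K closest_K_in assms)
  fix s assume "s \<in> K"
  have "(t *\<^sub>R v - t *\<^sub>R closest_point K v) \<bullet> (s - t *\<^sub>R closest_point K v)
      = t * ((v - closest_point K v) \<bullet> s) - t * t * ((v - closest_point K v) \<bullet> closest_point K v)"
    by (simp add: algebra_simps)
  also have "\<dots> \<le> 0"
    unfolding closest_K_orthogonal
    using mult_nonneg_nonpos[OF assms closest_K_polar[OF \<open>s \<in> K\<close>, of v]] by simp
  finally show "(t *\<^sub>R v - t *\<^sub>R closest_point K v) \<bullet> (s - t *\<^sub>R closest_point K v) \<le> 0" .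
qed

lemma closest_K_0: "closest_point K 0 = 0"
  by (rule closest_point_self[OF zero_in_K])

lemma norm_closest_K: "norm (closest_point K v) \<le> norm v"
proof -
  have "K \<noteq> {}" using zero_in_K by blast
  from closest_point_lipschitz[OF convex_K closed_K this, of v 0] show ?thesis
    by (simp only: closest_K_0 dist_norm diff_zero)
qed

lemma norm_diff_closest_K: "norm (v - closest_point K v) \<le> norm v"
  using closest_point_le[OF closed_K zero_in_K, of v] by (simp add: dist_norm)

text \<open>A small element of the polar cone of \<open>K\<close> perturbs the normal vector \<open>z - x\<close> to another normal
  vector: it suffices to test the finitely many vertices of \<open>S\<close> near \<open>x\<close>, and those not in the
  hyperplane orthogonal to \<open>z - x\<close> leave some slack.\<close>

lemma normal_perturbation:
  obtains e where "e > 0"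
    "\<And>u s. norm u \<le> e \<Longrightarrow> (\<And>k. k \<in> K \<Longrightarrow> u \<bullet> k \<le> 0) \<Longrightarrow> s \<in> S \<Longrightarrow> (z - x + u) \<bullet> (s - x) \<le> 0"
proof -
  obtain V where V: "finite V" "V \<subseteq> S" "\<And>s. s \<in> S \<Longrightarrow> \<exists>c>0. x + c *\<^sub>R (s - x) \<in> convex hull V"
    using polyhedron_local_vertices[OF polyhedron x_in] by blast
  have "\<exists>e>0. \<forall>u. norm u \<le> e \<longrightarrow> (\<forall>k\<in>K. u \<bullet> k \<le> 0) \<longrightarrow> (z - x + u) \<bullet> (p - x) \<le> 0" if "p \<in> V" for p
  proof (cases "(z - x) \<bullet> (p - x) = 0")
    case True
    have "p - x \<in> K"
      unfolding K_def tangent_cone_def using True that V(2) by (auto simp: inner_commute intro!: exI[of _ 1])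
    with True show ?thesis
      by (auto simp: inner_add_left intro!: exI[of _ 1])
  next
    case False
    then have neg: "(z - x) \<bullet> (p - x) < 0" using normal[of p] that V(2) by fastforce
    then have nz: "norm (p - x) > 0" by auto
    have "(z - x + u) \<bullet> (p - x) \<le> 0" if "norm u \<le> - ((z - x) \<bullet> (p - x)) / norm (p - x)" for u
    proof -
      have "u \<bullet> (p - x) \<le> norm u * norm (p - x)" by (rule norm_cauchy_schwarz)
      also have "\<dots> \<le> - ((z - x) \<bullet> (p - x))" using that nz by (simp add: field_simps)
      finally show ?thesis by (simp add: inner_add_left)
    qed
    then show ?thesis using neg nz by (intro exI[of _ "- ((z - x) \<bullet> (p - x)) / norm (p - x)"]) (auto simp: divide_neg_pos)
  qed
  then have "\<forall>p\<in>V. \<exists>e>0. \<forall>u. norm u \<le> e \<longrightarrow> (\<forall>k\<in>K. u \<bullet> k \<le> 0) \<longrightarrow> (z - x + u) \<bullet> (p - x) \<le> 0" by blast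
  from bchoice[OF this] obtain e where e: "\<forall>p\<in>V. e p > 0 \<and>
      (\<forall>u. norm u \<le> e p \<longrightarrow> (\<forall>k\<in>K. u \<bullet> k \<le> 0) \<longrightarrow> (z - x + u) \<bullet> (p - x) \<le> 0)" ..
  show thesis
  proof
    show "Min (insert 1 (e ` V)) > 0" using e V(1) by auto
    fix u s assume u: "norm u \<le> Min (insert 1 (e ` V))" "\<And>k. k \<in> K \<Longrightarrow> u \<bullet> k \<le> 0" and s: "s \<in> S"
    let ?H = "{p. (z - x + u) \<bullet> p \<le> (z - x + u) \<bullet> x}"
    have "V \<subseteq> ?H"
      using e u V(1) by (auto simp: inner_diff_right)
    then have "convex hull V \<subseteq> ?H"
      by (simp add: convex_halfspace_le hull_minimal)
    with V(3)[OF s] obtain c where "c > 0" "x + c *\<^sub>R (s - x) \<in> ?H" by blast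
    then show "(z - x + u) \<bullet> (s - x) \<le> 0"
      by (auto simp: inner_add_right mult_le_0_iff)
  qed
qed

text \<open>Moreau's decomposition of \<open>v\<close> verifies the variational inequality at
  \<open>x + w\<close>: \<open>w\<close> is a small feasible direction orthogonal to
  \<open>z - x\<close>, and \<open>v - w\<close> is a small polar vector, so
  \<open>z - x + (v - w)\<close> is still normal at \<open>x\<close>; the cross terms vanish by
  orthogonality.\<close>

lemma closest_point_local:
  obtains e where "e > 0" "\<And>v. norm v \<le> e \<Longrightarrow> closest_point S (z + v) = x + closest_point K v"
proof -
  obtain e1 where e1: "e1 > 0"
    "\<And>u s. norm u \<le> e1 \<Longrightarrow> (\<And>k. k \<in> K \<Longrightarrow> u \<bullet> k \<le> 0) \<Longrightarrow> s \<in> S \<Longrightarrow> (z - x + u) \<bullet> (s - x) \<le> 0"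
    using normal_perturbation by blast
  obtain e2 where e2: "e2 > 0" "\<And>v. v \<in> tangent_cone S x \<Longrightarrow> norm v \<le> e2 \<Longrightarrow> x + v \<in> S"
    using tangent_cone_locally_feasible[OF polyhedron x_in] by blast
  show thesis
  proof
    show "min e1 e2 > 0" using e1 e2 by auto
    fix v :: 'a assume v: "norm v \<le> min e1 e2"
    define w where "w = closest_point K v"
    have w: "w \<in> tangent_cone S x" "(z - x) \<bullet> w = 0" "norm w \<le> e2" "norm (v - w) \<le> e1"
      using closest_K_in[of v] norm_closest_K[of v] norm_diff_closest_K[of v] v
      by (auto simp: w_def K_def inner_commute)
    show "closest_point S (z + v) = x + closest_point K v"
      unfolding w_def[symmetric]
    proof (rule closest_point_eqI)
      show "convex S" "closed S" using polyhedron by (auto intro: polyhedron_imp_convex polyhedron_imp_closed)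
      show "x + w \<in> S" using w e2 by blast
      fix s assume s: "s \<in> S"
      have "(z + v - (x + w)) \<bullet> (s - (x + w))
          = (z - x + (v - w)) \<bullet> (s - x) - (z - x) \<bullet> w - (v - w) \<bullet> w"
        by (simp add: algebra_simps)
      also have "\<dots> = (z - x + (v - w)) \<bullet> (s - x)"
        using w(2) closest_K_orthogonal[of v] by (simp add: w_def)
      also have "\<dots> \<le> 0"
        using closest_K_polar[of _ v] w(4) s by (intro e1) (auto simp: w_def)
      finally show "(z + v - (x + w)) \<bullet> (s - (x + w)) \<le> 0" .
    qed
  qed
qed

text \<open>The error term is not merely of small order: it vanishes identically near the
  origin.\<close>

lemma has_B_derivative_closest_point:
  "has_B_derivative (closest_point S) (closest_point K) z"
proof -
  obtain e where e: "e > 0" "\<And>v. norm v \<le> e \<Longrightarrow> closest_point S (z + v) = x + closest_point K v"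
    using closest_point_local by blast
  have "1-lipschitz_on (ball z 1) (closest_point S)"
    using closest_point_lipschitz[OF polyhedron_imp_convex[OF polyhedron]
        polyhedron_imp_closed[OF polyhedron] nonempty]
    by (intro lipschitz_onI) auto
  moreover have "((\<lambda>v. norm (closest_point S (z + v) - closest_point S z - closest_point K v) / norm v) \<longlongrightarrow> 0) (at 0)"
  proof (rule tendsto_eventually)
    show "\<forall>\<^sub>F v in at 0. norm (closest_point S (z + v) - closest_point S z - closest_point K v) / norm v = 0"
      unfolding eventually_at using e by (intro exI[of _ e]) (auto simp: x_def)
  qed
  ultimately show ?thesis
    unfolding has_B_derivative_def using closest_K_scaleR by (auto intro: exI[of _ 1] zero_less_one)
qed

end

section \<open>Directional derivatives as limits of difference quotients\<close>

text \<open>Sampling the quotient at steps \<open>1 / Suc k\<close> serves three ends: uniqueness of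
  B-derivatives, their evaluation along a segment on which the function is affine, and measurability
  of derivatives as pointwise limits of measurable functions.\<close>

lemma directional_derivative_LIMSEQ:
  assumes lim: "((\<lambda>v. norm (g (x + v) - g x - G v) / norm v) \<longlongrightarrow> 0) (at 0)"
    and hom: "\<And>t v. t \<ge> 0 \<Longrightarrow> G (t *\<^sub>R v) = t *\<^sub>R G v"
  shows "(\<lambda>k. real (Suc k) *\<^sub>R (g (x + (1 / real (Suc k)) *\<^sub>R h) - g x)) \<longlonglongrightarrow> G h"
proof (cases "h = 0")
  case True
  with hom[of 0 h] show ?thesis by simp
next
  case False
  have "(\<lambda>k. (1 / real (Suc k)) *\<^sub>R h) \<longlonglongrightarrow> 0 *\<^sub>R h"
    using LIMSEQ_Suc[OF lim_1_over_n] by (intro tendsto_intros) auto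
  then have "filterlim (\<lambda>k. (1 / real (Suc k)) *\<^sub>R h) (at 0) sequentially"
    using False by (simp add: filterlim_at)
  from filterlim_compose[OF lim this]
  have "(\<lambda>k. norm (g (x + (1 / real (Suc k)) *\<^sub>R h) - g x - G ((1 / real (Suc k)) *\<^sub>R h))
      / norm ((1 / real (Suc k)) *\<^sub>R h) * norm h) \<longlonglongrightarrow> 0 * norm h"
    by (intro tendsto_intros)
  also have "(\<lambda>k. norm (g (x + (1 / real (Suc k)) *\<^sub>R h) - g x - G ((1 / real (Suc k)) *\<^sub>R h))
      / norm ((1 / real (Suc k)) *\<^sub>R h) * norm h) =
     (\<lambda>k. norm (real (Suc k) *\<^sub>R (g (x + (1 / real (Suc k)) *\<^sub>R h) - g x) - G h))"
  proof
    fix k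
    have "real (Suc k) *\<^sub>R (g (x + (1 / real (Suc k)) *\<^sub>R h) - g x) - G h
        = real (Suc k) *\<^sub>R (g (x + (1 / real (Suc k)) *\<^sub>R h) - g x - G ((1 / real (Suc k)) *\<^sub>R h))"
      by (subst hom) (auto simp: algebra_simps)
    then show "norm (g (x + (1 / real (Suc k)) *\<^sub>R h) - g x - G ((1 / real (Suc k)) *\<^sub>R h))
      / norm ((1 / real (Suc k)) *\<^sub>R h) * norm h =
     norm (real (Suc k) *\<^sub>R (g (x + (1 / real (Suc k)) *\<^sub>R h) - g x) - G h)"
      using False by simp
  qed
  finally show ?thesis
    by (simp add: tendsto_norm_zero_iff LIM_zero_iff)
qed

lemma has_B_derivative_imp_LIMSEQ:
  assumes "has_B_derivative g G x"
  shows "(\<lambda>k. real (Suc k) *\<^sub>R (g (x + (1 / real (Suc k)) *\<^sub>R h) - g x)) \<longlonglongrightarrow> G h"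
  using assms unfolding has_B_derivative_def by (intro directional_derivative_LIMSEQ) auto

lemma has_derivative_imp_LIMSEQ:
  assumes "(g has_derivative G) (at x)"
  shows "(\<lambda>k. real (Suc k) *\<^sub>R (g (x + (1 / real (Suc k)) *\<^sub>R h) - g x)) \<longlonglongrightarrow> G h"
  using assms unfolding has_derivative_at
  by (intro directional_derivative_LIMSEQ) (auto dest: bounded_linear.linear linear_scale)

lemma B_derivative_eq:
  assumes "has_B_derivative g G x"
  shows "B_derivative g x = G"
  unfolding B_derivative_def
proof (rule the_equality, rule assms)
  show "G' = G" if "has_B_derivative g G' x" for G'
    using LIMSEQ_unique[OF has_B_derivative_imp_LIMSEQ[OF that] has_B_derivative_imp_LIMSEQ[OF assms]] by blast
qed

context critical_cone
begin

lemma B_derivative_closest_point: "B_derivative (closest_point S) z = closest_point K"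
  by (rule B_derivative_eq[OF has_B_derivative_closest_point])

text \<open>Since \<open>\<Pi>\<^sub>S\<close> is affine along the segment from \<open>z + h\<close> back to \<open>z\<close>, its derivative at the far end is
  an exact difference.\<close>

lemma B_derivative_closest_point_backwards:
  obtains e where "e > 0"
    "\<And>h. norm h \<le> e \<Longrightarrow> closest_point S (z + h) = x + closest_point K h"
    "\<And>h. norm h \<le> e \<Longrightarrow> B_derivative (closest_point S) (z + h) (- h) = - closest_point K h"
proof -
  obtain e where e: "e > 0" "\<And>v. norm v \<le> e \<Longrightarrow> closest_point S (z + v) = x + closest_point K v"
    using closest_point_local by blast
  have "B_derivative (closest_point S) (z + h) (- h) = - closest_point K h" if h: "norm h \<le> e" for h
  proof -
    interpret h: critical_cone S "z + h" "closest_point S (z + h)"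
      "tangent_cone S (closest_point S (z + h)) \<inter> {v. v \<bullet> (z + h - closest_point S (z + h)) = 0}"
      using polyhedron nonempty by unfold_locales auto
    let ?t = "\<lambda>k. 1 / real (Suc k)"
    \<comment> \<open>The critical cone at \<open>z + h\<close> is never computed. Positive
      homogeneity of \<open>closest_point K\<close> makes the difference quotients towards
      \<open>z\<close> constant in \<open>k\<close>, and their common value is the
      derivative.\<close>
    have "real (Suc k) *\<^sub>R (closest_point S (z + h + ?t k *\<^sub>R (- h)) - closest_point S (z + h))
        = - closest_point K h" for k
    proof -
      have t: "0 \<le> 1 - ?t k" "1 - ?t k \<le> 1" by auto
      have "norm ((1 - ?t k) *\<^sub>R h) \<le> e"
        using h t mult_left_le_one_le[OF norm_ge_zero[of h] t(1) t(2)] by (simp only: norm_scaleR)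
      moreover have "z + h + ?t k *\<^sub>R (- h) = z + (1 - ?t k) *\<^sub>R h"
        by (simp add: algebra_simps)
      ultimately have "closest_point S (z + h + ?t k *\<^sub>R (- h)) = x + closest_point K ((1 - ?t k) *\<^sub>R h)"
        using e(2) by metis
      also have "\<dots> = x + (1 - ?t k) *\<^sub>R closest_point K h"
        by (simp only: closest_K_scaleR[OF t(1)])
      finally have "closest_point S (z + h + ?t k *\<^sub>R (- h)) - closest_point S (z + h) = - (?t k *\<^sub>R closest_point K h)"
        unfolding e(2)[OF h] by (simp add: algebra_simps)
      then show ?thesis
        by simp
    qed
    then show ?thesis
      using has_B_derivative_imp_LIMSEQ[OF h.has_B_derivative_closest_point, of "- h"]
      by (simp only: h.B_derivative_closest_point LIMSEQ_const_iff)
  qed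
  with e show thesis by (auto intro: that)
qed

end

section \<open>Square roots and inverses of positive semidefinite matrices\<close>

text \<open>Rayleigh's principle: a maximiser \<open>b\<close> of \<open>x \<bullet> T x\<close> on
  the unit sphere of \<open>U\<close> is an eigenvector, since a nonzero residual
  \<open>T b - m *\<^sub>R b\<close> would be a direction of ascent.\<close>

lemma selfadjoint_eigenvector:
  fixes T :: "'a::euclidean_space \<Rightarrow> 'a"
  assumes "linear T" and sym: "\<And>x y. x \<bullet> T y = T x \<bullet> y"
    and U: "subspace U" "\<And>x. x \<in> U \<Longrightarrow> T x \<in> U" and nontriv: "u \<in> U" "u \<noteq> 0"
  obtains b l where "b \<in> U" "norm b = 1" "T b = l *\<^sub>R b"
proof -
  interpret linear T by fact
  let ?C = "U \<inter> sphere 0 1"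
  have "compact ?C"
    using U closed_subspace by (intro closed_Int_compact) auto
  moreover have "(1 / norm u) *\<^sub>R u \<in> ?C"
    using nontriv U by (auto simp: subspace_scale)
  moreover have "continuous_on ?C (\<lambda>x. x \<bullet> T x)"
    by (intro continuous_intros linear_continuous_on linear_conv_bounded_linear[THEN iffD1] assms)
  ultimately have "\<exists>b\<in>?C. \<forall>y\<in>?C. y \<bullet> T y \<le> b \<bullet> T b"
    by (intro continuous_attains_sup) blast+
  then obtain b where b: "b \<in> U" "norm b = 1" and max: "\<And>y. y \<in> U \<Longrightarrow> norm y = 1 \<Longrightarrow> y \<bullet> T y \<le> b \<bullet> T b"
    by auto
  define m where "m = b \<bullet> T b"
  have le: "y \<bullet> T y \<le> m * (y \<bullet> y)" if "y \<in> U" for y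
  proof (cases "y = 0")
    case False
    have "((1 / norm y) *\<^sub>R y) \<bullet> T ((1 / norm y) *\<^sub>R y) \<le> m"
      unfolding m_def using that U False by (intro max) (auto simp: subspace_scale)
    then show ?thesis
      using False by (simp add: scale divide_simps power2_norm_eq_inner[symmetric] power2_eq_square)
  qed (simp add: zero)
  define w where "w = T b - m *\<^sub>R b"
  have wU: "w \<in> U" unfolding w_def using U b by (simp add: subspace_diff subspace_scale)
  define c where "c = m * (w \<bullet> w) - w \<bullet> T w"
  have bb: "b \<bullet> b = 1" using b(2) by (simp add: norm_eq_1)
  \<comment> \<open>Maximality tested at \<open>b + t *\<^sub>R w\<close>: the linear term in
    \<open>t\<close> has to be dominated by the quadratic one for every \<open>t\<close>.\<close>
  have key: "2 * t * (w \<bullet> w) \<le> t\<^sup>2 * c" for t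
  proof -
    have "b + t *\<^sub>R w \<in> U" using U b wU by (simp add: subspace_add subspace_scale)
    from le[OF this] have "m + 2 * t * (w \<bullet> T b) + t\<^sup>2 * (w \<bullet> T w) \<le> m * (1 + 2 * t * (w \<bullet> b) + t\<^sup>2 * (w \<bullet> w))"
      using sym[of b w] bb
      by (simp add: add scale inner_add_left inner_add_right inner_commute m_def power2_eq_square algebra_simps)
    moreover have "w \<bullet> T b = w \<bullet> w + m * (w \<bullet> b)"
      by (simp add: w_def inner_diff_right inner_diff_left)
    ultimately show ?thesis by (simp add: c_def algebra_simps)
  qed
  have "w \<bullet> w = 0"
  proof (rule ccontr)
    assume "w \<bullet> w \<noteq> 0"
    then have pos: "w \<bullet> w > 0" by (simp add: order_less_le)
    \<comment> \<open>The step is so short that the quadratic term reaches at most half of the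
      linear one.\<close>
    let ?t = "(w \<bullet> w) / (1 + \<bar>c\<bar>)"
    have t: "?t > 0" using pos by (simp add: add_pos_nonneg)
    have "?t * (2 * (w \<bullet> w)) \<le> ?t * (?t * c)" using key[of ?t] by (simp add: power2_eq_square mult_ac)
    then have "2 * (w \<bullet> w) \<le> ?t * c" using t mult_le_cancel_left_pos by blast
    also have "\<dots> \<le> ?t * (1 + \<bar>c\<bar>)" using t by (intro mult_left_mono) auto
    also have "\<dots> = w \<bullet> w" by simp
    finally show False using pos by simp
  qed
  with b show thesis by (intro that[of b m]) (auto simp: w_def)
qed

text \<open>Induction on the dimension: one unit eigenvector is split off, and self-adjointness
  keeps its orthogonal complement in \<open>U\<close> invariant.\<close>

lemma selfadjoint_eigenbasis:
  fixes T :: "'a::euclidean_space \<Rightarrow> 'a"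
  assumes "linear T" and sym: "\<And>x y. x \<bullet> T y = T x \<bullet> y"
    and "subspace U" "\<And>x. x \<in> U \<Longrightarrow> T x \<in> U"
  shows "\<exists>B. finite B \<and> pairwise orthogonal B \<and> (\<forall>b\<in>B. norm b = 1 \<and> (\<exists>l. T b = l *\<^sub>R b)) \<and> span B = U"
  using assms(3,4)
proof (induction "dim U" arbitrary: U rule: less_induct)
  case less
  show ?case
  proof (cases "U = {0}")
    case True
    then show ?thesis by (intro exI[of _ "{}"]) auto
  next
    case False
    then obtain u where "u \<in> U" "u \<noteq> 0" using less.prems(1) subspace_0 by blast
    then obtain b l where b: "b \<in> U" "norm b = 1" "T b = l *\<^sub>R b"
      using selfadjoint_eigenvector[OF assms(1) sym less.prems] by metis
    have bb: "b \<bullet> b = 1" using b(2) by (simp add: norm_eq_1)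
    define V where "V = U \<inter> {x. b \<bullet> x = 0}"
    have V: "subspace V" unfolding V_def using subspace_inter[OF less.prems(1) subspace_hyperplane] .
    have inv: "T x \<in> V" if "x \<in> V" for x
      using that less.prems(2) b(3) sym[of b x] by (auto simp: V_def)
    have "b \<notin> V" using bb by (simp add: V_def)
    then have "V \<noteq> U" using b by blast
    then have "dim V < dim U"
      using V less.prems(1) subspace_dim_equal[of V U] dim_subset[of V U]
      by (auto simp: V_def order_less_le)
    from less.hyps[OF this V inv] obtain B where B: "finite B" "pairwise orthogonal B"
      "\<forall>b\<in>B. norm b = 1 \<and> (\<exists>l. T b = l *\<^sub>R b)" "span B = V" by auto
    have orth: "b \<bullet> x = 0" if "x \<in> B" for x
      using that span_superset[of B] B(4) by (auto simp: V_def)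
    have "pairwise orthogonal (insert b B)"
      using B(2) orth by (auto simp: pairwise_insert orthogonal_def inner_commute)
    moreover have "span (insert b B) = U"
    proof
      have "B \<subseteq> U" using span_superset[of B] B(4) by (auto simp: V_def)
      then show "span (insert b B) \<subseteq> U" using b less.prems(1) by (intro span_minimal) auto
      show "U \<subseteq> span (insert b B)"
      proof
        fix x assume "x \<in> U"
        have "x - (b \<bullet> x) *\<^sub>R b \<in> V"
          using \<open>x \<in> U\<close> b less.prems(1) bb by (auto simp: V_def subspace_diff subspace_scale inner_diff_right)
        then show "x \<in> span (insert b B)"
          unfolding span_insert B(4) by blast
      qed
    qed
    ultimately show ?thesis using B b by (intro exI[of _ "insert b B"]) auto
  qed
qed

section \<open>Existence and uniqueness of the positive semidefinite square root\<close>

definition psd :: "real^'n^'n \<Rightarrow> bool" where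
  "psd A \<longleftrightarrow> transpose A = A \<and> (\<forall>x. 0 \<le> x \<bullet> (A *v x))"

lemma transpose_eq_self_iff: "transpose A = A \<longleftrightarrow> (\<forall>x y. x \<bullet> (A *v y) = (A *v x) \<bullet> y)"
  for A :: "real^'n^'n"
proof
  assume "transpose A = A"
  then show "\<forall>x y. x \<bullet> (A *v y) = (A *v x) \<bullet> y"
    by (metis dot_lmul_matrix transpose_matrix_vector)
next
  assume *: "\<forall>x y. x \<bullet> (A *v y) = (A *v x) \<bullet> y"
  show "transpose A = A"
    unfolding vec_eq_iff
  proof (intro allI)
    fix i j
    show "transpose A $ i $ j = A $ i $ j"
      using *[rule_format, of "axis i 1" "axis j 1"]
      by (simp add: transpose_def inner_axis inner_axis' matrix_vector_mult_basis column_def)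
  qed
qed

lemma psd_sym: "psd A \<Longrightarrow> x \<bullet> (A *v y) = (A *v x) \<bullet> y"
  unfolding psd_def transpose_eq_self_iff by blast

lemma psd_eigenbasis:
  assumes "psd A"
  obtains B l where "finite B" "pairwise orthogonal B" "span B = UNIV"
    "\<And>b. b \<in> B \<Longrightarrow> b \<bullet> b = 1 \<and> A *v b = l b *\<^sub>R b \<and> l b \<ge> 0"
proof -
  obtain B where B: "finite B" "pairwise orthogonal B" "\<forall>b\<in>B. norm b = 1 \<and> (\<exists>l. A *v b = l *\<^sub>R b)"
    "span B = UNIV"
    using selfadjoint_eigenbasis[of "(*v) A" UNIV] psd_sym[OF assms] by (auto simp: matrix_vector_mul_linear)
  from B(3) have "\<forall>b\<in>B. \<exists>l. A *v b = l *\<^sub>R b" by blast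
  from bchoice[OF this] obtain l where l: "\<forall>b\<in>B. A *v b = l b *\<^sub>R b" ..
  show thesis
  proof (rule that[OF B(1,2,4)])
    fix b assume b: "b \<in> B"
    then have "b \<bullet> b = 1" using B(3) by (simp add: norm_eq_1)
    moreover have "0 \<le> b \<bullet> (A *v b)" using assms by (simp add: psd_def)
    ultimately show "b \<bullet> b = 1 \<and> A *v b = l b *\<^sub>R b \<and> l b \<ge> 0" using l b by simp
  qed
qed

lemma matrix_eq_on_spanning:
  fixes A C :: "real^'n^'m"
  assumes "span B = UNIV" "\<And>b. b \<in> B \<Longrightarrow> A *v b = C *v b"
  shows "A = C"
proof -
  have "A *v x = C *v x" for x
    using linear_eq_on_span[OF matrix_vector_mul_linear matrix_vector_mul_linear, of B A C x] assms by auto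
  then show ?thesis by (simp add: matrix_eq)
qed

text \<open>The root keeps the orthonormal eigenvectors of \<open>A\<close> and takes the square
  roots of its eigenvalues.\<close>

lemma psd_sqrt_exists:
  assumes "psd A" obtains R where "psd R" "R ** R = A"
proof -
  obtain B l where B: "finite B" "pairwise orthogonal B" "span B = UNIV"
    and l: "\<And>b. b \<in> B \<Longrightarrow> b \<bullet> b = 1 \<and> A *v b = l b *\<^sub>R b \<and> l b \<ge> 0"
    using psd_eigenbasis[OF assms] by metis
  let ?f = "\<lambda>x. \<Sum>b\<in>B. (sqrt (l b) * (b \<bullet> x)) *\<^sub>R b"
  define R where "R = matrix ?f"
  have "linear ?f"
    by (intro linearI) (auto simp: inner_add_right algebra_simps sum.distrib scaleR_sum_right)
  then have R: "R *v x = ?f x" for x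
    unfolding R_def by (simp add: matrix_works)
  have Rb: "R *v b = sqrt (l b) *\<^sub>R b" if "b \<in> B" for b
  proof -
    have "(sqrt (l c) * (c \<bullet> b)) *\<^sub>R c = (if c = b then sqrt (l b) *\<^sub>R b else 0)" if "c \<in> B" for c
      using B(2) \<open>b \<in> B\<close> \<open>c \<in> B\<close> l[of b] by (auto simp: pairwise_def orthogonal_def)
    then show ?thesis
      unfolding R using that B(1) by (simp cong: sum.cong)
  qed
  have inner: "x \<bullet> (R *v y) = (\<Sum>b\<in>B. sqrt (l b) * (b \<bullet> x) * (b \<bullet> y))" for x y
    unfolding R by (simp add: inner_sum_right inner_commute mult_ac)
  have "psd R"
    unfolding psd_def transpose_eq_self_iff
  proof (intro conjI allI)
    show "x \<bullet> (R *v y) = (R *v x) \<bullet> y" for x y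
      using inner[of x y] inner[of y x] by (simp add: inner_commute mult_ac)
    show "0 \<le> x \<bullet> (R *v x)" for x
      unfolding inner using l by (intro sum_nonneg) (simp add: mult.assoc)
  qed
  moreover have "R ** R = A"
  proof (rule matrix_eq_on_spanning[OF B(3)])
    fix b assume "b \<in> B"
    then show "(R ** R) *v b = A *v b"
      using l[of b] by (simp add: matrix_vector_mul_assoc[symmetric] Rb matrix_vector_mult_scaleR)
  qed
  ultimately show thesis by (rule that)
qed

text \<open>On an eigenvector \<open>b\<close> of \<open>Q\<close> with eigenvalue \<open>l\<close>
  one has \<open>(R + l) (R - l) b = 0\<close>. For \<open>l > 0\<close> the factor
  \<open>R + l\<close> is injective because \<open>R\<close> is positive semidefinite; for
  \<open>l = 0\<close> the square of the norm of \<open>R b\<close> is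
  \<open>b \<bullet> R (R b) = 0\<close>.\<close>

lemma psd_square_inj:
  assumes "psd R" "psd Q" "R ** R = Q ** Q"
  shows "R = Q"
proof -
  obtain B l where B: "span B = UNIV"
    and l: "\<And>b. b \<in> B \<Longrightarrow> b \<bullet> b = 1 \<and> Q *v b = l b *\<^sub>R b \<and> l b \<ge> 0"
    using psd_eigenbasis[OF assms(2)] by metis
  show ?thesis
  proof (rule matrix_eq_on_spanning[OF B])
    fix b assume "b \<in> B"
    have RR: "R *v (R *v b) = (l b)\<^sup>2 *\<^sub>R b"
      using l[OF \<open>b \<in> B\<close>] assms(3)
      by (simp add: matrix_vector_mul_assoc) (simp add: matrix_vector_mul_assoc[symmetric] matrix_vector_mult_scaleR power2_eq_square)
    show "R *v b = Q *v b"
    proof (cases "l b = 0")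
      case True
      have "(R *v b) \<bullet> (R *v b) = b \<bullet> (R *v (R *v b))"
        using psd_sym[OF assms(1)] by metis
      also have "\<dots> = 0" using RR True by simp
      finally show ?thesis using True l[OF \<open>b \<in> B\<close>] by simp
    next
      case False
      then have pos: "l b > 0" using l[OF \<open>b \<in> B\<close>] by simp
      define w where "w = R *v b - l b *\<^sub>R b"
      have "R *v w = - l b *\<^sub>R w"
        by (simp add: w_def matrix_vector_mult_diff_distrib matrix_vector_mult_scaleR RR algebra_simps power2_eq_square)
      then have "w \<bullet> (R *v w) = - l b * (w \<bullet> w)" by simp
      moreover have "0 \<le> w \<bullet> (R *v w)" using assms(1) by (simp add: psd_def)
      ultimately have "w \<bullet> w \<le> 0" using pos by (simp add: mult_le_0_iff)
      then have "w = 0" by (metis inner_eq_zero_iff inner_ge_zero order_antisym)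
      then show ?thesis using l[OF \<open>b \<in> B\<close>] by (simp add: w_def)
    qed
  qed
qed

lemma psd_sqrt_square:
  assumes "psd R" shows "psd_sqrt (R ** R) = R"
  unfolding psd_sqrt_def
proof (rule the_equality)
  show "transpose R = R \<and> (\<forall>x. 0 \<le> x \<bullet> (R *v x)) \<and> R ** R = R ** R"
    using assms by (simp add: psd_def)
  show "B = R" if "transpose B = B \<and> (\<forall>x. 0 \<le> x \<bullet> (B *v x)) \<and> B ** B = R ** R" for B
    using psd_square_inj[OF _ assms, of B] that unfolding psd_def by blast
qed

lemma
  assumes "psd A"
  shows psd_psd_sqrt: "psd (psd_sqrt A)" and psd_sqrt_mult_self: "psd_sqrt A ** psd_sqrt A = A"
proof -
  obtain R where "psd R" "R ** R = A" using psd_sqrt_exists[OF assms] .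
  with psd_sqrt_square[OF this(1)] show "psd (psd_sqrt A)" "psd_sqrt A ** psd_sqrt A = A" by auto
qed

text \<open>This a priori bound confines the roots of all matrices near \<open>A\<close> to one
  compact set.\<close>

lemma norm_psd_sqrt:
  assumes "psd A" shows "(norm (psd_sqrt A))\<^sup>2 = trace A"
proof -
  let ?R = "psd_sqrt A"
  have sym: "?R $ i $ j = ?R $ j $ i" for i j
    using psd_psd_sqrt[OF assms] unfolding psd_def transpose_def vec_eq_iff by simp
  have "(norm ?R)\<^sup>2 = (\<Sum>i\<in>UNIV. \<Sum>j\<in>UNIV. ?R $ i $ j * ?R $ i $ j)"
    by (simp add: power2_norm_eq_inner inner_vec_def)
  also have "\<dots> = (\<Sum>i\<in>UNIV. \<Sum>j\<in>UNIV. ?R $ i $ j * ?R $ j $ i)"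
    by (intro sum.cong refl arg_cong2[where f="(*)"] sym)
  also have "\<dots> = trace (?R ** ?R)"
    by (simp add: trace_def matrix_matrix_mult_def)
  finally show ?thesis using psd_sqrt_mult_self[OF assms] by simp
qed

section \<open>Continuity and measurability of square root and inverse\<close>

lemma continuous_matrix_mult [continuous_intros]:
  fixes f g :: "'a::t2_space \<Rightarrow> real^'n^'n"
  shows "continuous_on S f \<Longrightarrow> continuous_on S g \<Longrightarrow> continuous_on S (\<lambda>x. f x ** g x)"
  unfolding matrix_matrix_mult_def by (intro continuous_intros)

lemma continuous_matrix_vector_mult [continuous_intros]:
  fixes f :: "'a::t2_space \<Rightarrow> real^'n^'m"
  shows "continuous_on S f \<Longrightarrow> continuous_on S g \<Longrightarrow> continuous_on S (\<lambda>x. f x *v g x)"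
  unfolding matrix_vector_mult_def by (intro continuous_intros)

lemma closed_psd: "closed {A::real^'n^'n. psd A}"
proof -
  have "{A::real^'n^'n. psd A} = {A. transpose A = A} \<inter> (\<Inter>x. {A. 0 \<le> x \<bullet> (A *v x)})"
    by (auto simp: psd_def)
  moreover have "closed {A::real^'n^'n. transpose A = A}"
    unfolding transpose_def by (intro closed_Collect_eq continuous_intros)
  moreover have "closed {A::real^'n^'n. 0 \<le> x \<bullet> (A *v x)}" for x
    by (intro closed_Collect_le continuous_intros)
  ultimately show ?thesis by (auto intro!: closed_Int closed_INT)
qed

text \<open>Squaring is a continuous injection on the compact set of positive semidefinite matrices
  of bounded norm, so its inverse is continuous on the image. The trace bound shows that this image
  contains a relative neighbourhood of \<open>A\<close>.\<close>

lemma continuous_on_psd_sqrt: "continuous_on {A. psd A} (psd_sqrt :: real^'n^'n \<Rightarrow> _)"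
  unfolding continuous_on_eq_continuous_within
proof
  fix A :: "real^'n^'n" assume A: "A \<in> {A. psd A}"
  let ?P = "{A::real^'n^'n. psd A}" and ?O = "{C::real^'n^'n. trace C < trace A + 1}"
  define K :: "(real^'n^'n) set" where "K = {R. psd R} \<inter> cball 0 (sqrt (trace A + 1))"
  have "compact K" unfolding K_def by (intro closed_Int_compact closed_psd compact_cball)
  then have "continuous_on ((\<lambda>R. R ** R) ` K) psd_sqrt"
    by (intro continuous_on_inv) (auto simp: K_def psd_sqrt_square intro!: continuous_intros)
  moreover have "?P \<inter> ?O \<subseteq> (\<lambda>R. R ** R) ` K"
  proof
    fix C assume C: "C \<in> ?P \<inter> ?O"
    then have "(norm (psd_sqrt C))\<^sup>2 \<le> trace A + 1" using norm_psd_sqrt[of C] by auto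
    then have "psd_sqrt C \<in> K"
      using C psd_psd_sqrt[of C] by (simp add: K_def real_le_rsqrt)
    moreover have "C = psd_sqrt C ** psd_sqrt C" using C psd_sqrt_mult_self[of C] by simp
    ultimately show "C \<in> (\<lambda>R. R ** R) ` K" by blast
  qed
  ultimately have "continuous_on (?P \<inter> ?O) psd_sqrt"
    using continuous_on_subset by blast
  moreover have "A \<in> ?P \<inter> ?O" using A by auto
  ultimately have "continuous (at A within ?P \<inter> ?O) psd_sqrt"
    by (simp add: continuous_on_eq_continuous_within)
  moreover have "open ?O"
    unfolding trace_def by (intro open_Collect_less continuous_intros)
  then have "at A within ?P \<inter> ?O = at A within ?P"
    by (intro at_within_nhd[of A ?O]) auto
  ultimately show "continuous (at A within ?P) psd_sqrt" by simp
qed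

lemma
  fixes A :: "real^'n^'n"
  assumes "invertible A"
  shows matrix_mult_inv: "A ** matrix_inv A = mat 1" and matrix_inv_mult: "matrix_inv A ** A = mat 1"
  using someI_ex[OF assms[unfolded invertible_def]] unfolding matrix_inv_def by blast+

text \<open>Cramer's rule exhibits the entries of the inverse as rational functions of the matrix
  entries, from which continuity is immediate.\<close>

lemma matrix_inv_cramer:
  fixes A :: "real^'n^'n"
  assumes "det A \<noteq> 0"
  shows "matrix_inv A = (\<chi> k j. det (\<chi> i l. if l = k then (axis j 1 :: real^'n) $ i else A $ i $ l) / det A)"
  (is "_ = ?C")
proof -
  have inv: "A ** matrix_inv A = mat 1"
    using assms by (simp add: invertible_det_nz matrix_mult_inv)
  have "matrix_inv A *v axis j 1 = (\<chi> k. det (\<chi> i l. if l = k then (axis j 1 :: real^'n) $ i else A $ i $ l) / det A)" for j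
  proof -
    have "A *v (matrix_inv A *v axis j 1) = axis j 1"
      by (simp add: matrix_vector_mul_assoc inv)
    then show ?thesis using cramer[OF assms] by blast
  qed
  then have "matrix_inv A $ k $ j = ?C $ k $ j" for k j
    by (simp add: matrix_vector_mult_basis column_def vec_eq_iff)
  then show ?thesis by (simp add: vec_eq_iff)
qed

lemma continuous_on_det [continuous_intros]:
  fixes f :: "'a::t2_space \<Rightarrow> real^'n^'n"
  assumes "continuous_on S f" shows "continuous_on S (\<lambda>x. det (f x))"
  unfolding det_def by (intro continuous_intros assms)

lemma continuous_on_matrix_inv: "continuous_on {A. invertible A} (matrix_inv :: real^'n^'n \<Rightarrow> _)"
proof -
  have "continuous_on {A::real^'n^'n. invertible A}
      (\<lambda>A. \<chi> k j. det (\<chi> i l. if l = k then (axis j 1 :: real^'n) $ i else A $ i $ l) / det A)"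
  proof (intro continuous_intros)
    show "continuous_on {A::real^'n^'n. invertible A} (\<lambda>x. if l = k then (axis j 1 :: real^'n) $ i else x $ i $ l)"
      for i j k l by (cases "l = k") (auto intro!: continuous_intros)
  qed (auto simp: invertible_det_nz)
  then show ?thesis
    by (rule continuous_on_cong[THEN iffD1, rotated 2]) (auto simp: matrix_inv_cramer invertible_det_nz)
qed

lemma open_invertible: "open {A::real^'n^'n. invertible A}"
  unfolding invertible_det_nz by (intro open_Collect_neq continuous_intros)

lemma borel_measurable_matrix_inv [measurable]: "(matrix_inv :: real^'n^'n \<Rightarrow> _) \<in> borel_measurable borel"
proof -
  \<comment> \<open>On every singular matrix \<open>matrix_inv\<close> chooses from the same
    unsatisfiable predicate, so it takes one constant value there.\<close>
  define C :: "real^'n^'n" where "C = (SOME B. False)"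
  have C: "matrix_inv A = C" if "\<not> invertible A" for A :: "real^'n^'n"
  proof -
    have "(\<lambda>B. A ** B = mat 1 \<and> B ** A = mat 1) = (\<lambda>B. False)"
      using that unfolding invertible_def by auto
    then show ?thesis unfolding matrix_inv_def C_def by simp
  qed
  have "(\<lambda>A::real^'n^'n. if A \<in> {A. invertible A} then matrix_inv A else C) \<in> borel_measurable borel"
    by (intro borel_measurable_continuous_on_if continuous_on_matrix_inv continuous_on_const borel_open open_invertible)
  also have "(\<lambda>A::real^'n^'n. if A \<in> {A. invertible A} then matrix_inv A else C) = matrix_inv"
    using C by auto
  finally show ?thesis .
qed

lemma borel_measurable_psd_sqrt [measurable (raw)]:
  fixes f :: "'a \<Rightarrow> real^'n^'n"
  assumes [measurable]: "f \<in> borel_measurable M" and "\<And>x. x \<in> space M \<Longrightarrow> psd (f x)"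
  shows "(\<lambda>x. psd_sqrt (f x)) \<in> borel_measurable M"
proof -
  have "(\<lambda>A::real^'n^'n. if A \<in> {A. psd A} then psd_sqrt A else 0) \<in> borel_measurable borel"
    by (intro borel_measurable_continuous_on_if continuous_on_psd_sqrt continuous_on_const borel_closed closed_psd)
  from measurable_compose[OF assms(1) this] show ?thesis
    by (rule measurable_cong[THEN iffD1, rotated]) (use assms(2) in auto)
qed

lemma invertible_psd_sqrt:
  assumes "psd A" "invertible A" shows "invertible (psd_sqrt A)"
  using assms psd_sqrt_mult_self[OF assms(1)] unfolding invertible_det_nz
  by (metis det_mul mult_zero_left)

lemma tendsto_inv_sqrt:
  assumes "(f \<longlongrightarrow> A) F" "\<forall>\<^sub>F x in F. psd (f x)" "psd A" "invertible A"
  shows "((\<lambda>x. inv_sqrt (f x)) \<longlongrightarrow> inv_sqrt A) F"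
proof -
  have "((\<lambda>x. psd_sqrt (f x)) \<longlongrightarrow> psd_sqrt A) F"
    using assms by (intro continuous_on_tendsto_compose[OF continuous_on_psd_sqrt]) auto
  moreover have "isCont matrix_inv (psd_sqrt A)"
    using continuous_on_eq_continuous_at[OF open_invertible] continuous_on_matrix_inv
      invertible_psd_sqrt[OF assms(3,4)] by blast
  ultimately show ?thesis
    unfolding inv_sqrt_def by (rule isCont_tendsto_compose[rotated])
qed

text \<open>The sandwich identity gives whitened variables the identity covariance; the last
  identity turns the squared norm of a whitened vector into the quadratic form of the confidence
  region.\<close>

lemma
  assumes "psd A" "invertible A"
  shows inv_sqrt_sandwich: "inv_sqrt A ** A ** inv_sqrt A = mat 1"
    and inv_sqrt_sym: "x \<bullet> (inv_sqrt A *v y) = (inv_sqrt A *v x) \<bullet> y"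
    and inv_sqrt_quadratic_form: "(norm (inv_sqrt A *v v))\<^sup>2 = v \<bullet> (matrix_inv A *v v)"
proof -
  let ?R = "psd_sqrt A" and ?Q = "inv_sqrt A"
  have RQ: "?R ** ?Q = mat 1" and QR: "?Q ** ?R = mat 1"
    unfolding inv_sqrt_def using invertible_psd_sqrt[OF assms] by (simp_all add: matrix_inv_mult matrix_mult_inv)
  have RR: "?R ** ?R = A" by (rule psd_sqrt_mult_self[OF assms(1)])
  show "?Q ** A ** ?Q = mat 1"
    using RQ QR RR by (metis matrix_mul_assoc matrix_mul_rid)
  have QQA: "?Q ** ?Q ** A = mat 1"
    using RQ QR RR by (metis matrix_mul_assoc matrix_mul_rid)
  have A: "A ** matrix_inv A = mat 1" using assms(2) by (simp add: matrix_mult_inv)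
  have QQ: "?Q ** ?Q = matrix_inv A"
    using QQA A by (metis matrix_mul_assoc matrix_mul_lid matrix_mul_rid)
  have sym: "x \<bullet> (?Q *v y) = (?Q *v x) \<bullet> y" for x y
  proof -
    have "x \<bullet> (?Q *v y) = (?R *v (?Q *v x)) \<bullet> (?Q *v y)" by (simp add: matrix_vector_mul_assoc RQ)
    also have "\<dots> = (?Q *v x) \<bullet> (?R *v (?Q *v y))" using psd_sym[OF psd_psd_sqrt[OF assms(1)]] by simp
    also have "\<dots> = (?Q *v x) \<bullet> y" by (simp add: matrix_vector_mul_assoc RQ)
    finally show ?thesis .
  qed
  show "x \<bullet> (?Q *v y) = (?Q *v x) \<bullet> y" by (rule sym)
  show "(norm (?Q *v v))\<^sup>2 = v \<bullet> (matrix_inv A *v v)"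
    by (simp add: power2_norm_eq_inner QQ[symmetric] matrix_vector_mul_assoc[symmetric] sym)
qed

section \<open>The strong law of large numbers\<close>

context prob_space
begin

text \<open>Reindexing serves to shift a sequence, to move the samples from \<open>{1..}\<close> to
  all natural numbers, and to extract a pair from a family.\<close>

lemma indep_vars_reindex_inj:
  assumes "inj_on f I" "indep_vars N X (f ` I)"
  shows "indep_vars (\<lambda>i. N (f i)) (\<lambda>i. X (f i)) I"
  unfolding indep_vars_def2
proof (intro conjI ballI indep_setsI)
  show "random_variable (N (f i)) (X (f i))" if "i \<in> I" for i
    using assms(2) that by (auto simp: indep_vars_def2)
  show "{X (f i) -` A \<inter> space M |A. A \<in> sets (N (f i))} \<subseteq> events" if "i \<in> I" for i
    using assms(2) that by (auto simp: indep_vars_def2 intro: measurable_sets)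
  fix A J assume J: "J \<noteq> {}" "J \<subseteq> I" "finite J"
    and A: "\<forall>j\<in>J. A j \<in> {X (f j) -` A \<inter> space M |A. A \<in> sets (N (f j))}"
  have inj: "inj_on f J" using assms(1) J(2) inj_on_subset by blast
  define A' where "A' k = A (the_inv_into J f k)" for k
  have A': "A' (f j) = A j" if "j \<in> J" for j
    using that inj by (simp add: A'_def the_inv_into_f_f)
  have "prob (\<Inter>k\<in>f ` J. A' k) = (\<Prod>k\<in>f ` J. prob (A' k))"
    using assms(2) J A A' by (intro indep_setsD[where I = "f ` I"]) (auto simp: indep_vars_def2)
  then show "prob (\<Inter>j\<in>J. A j) = (\<Prod>j\<in>J. prob (A j))"
    using A' by (simp add: prod.reindex[OF inj])
qed

end

locale iid_sequence = prob_space +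
  fixes X :: "nat \<Rightarrow> 'a \<Rightarrow> real"
  assumes indep: "indep_vars (\<lambda>_. borel) X UNIV"
    and distr_eq: "\<And>i. distr M borel (X i) = distr M borel (X 0)"
begin

lemma measurable_X [measurable]: "X i \<in> borel_measurable M"
  using indep by (auto simp: indep_vars_def2)

lemma integrable_transfer:
  assumes "f \<in> borel_measurable borel" "integrable M (\<lambda>\<omega>. f (X 0 \<omega>) :: real)"
  shows "integrable M (\<lambda>\<omega>. f (X i \<omega>))"
  using assms integrable_distr_eq[of "X i" M borel f] integrable_distr_eq[of "X 0" M borel f] distr_eq[of i]
  by simp

lemma compose:
  assumes [measurable]: "f \<in> borel_measurable borel"
  shows "iid_sequence M (\<lambda>i \<omega>. f (X i \<omega>))"
proof
  show "indep_vars (\<lambda>_. borel) (\<lambda>i \<omega>. f (X i \<omega>)) UNIV"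
    by (rule indep_vars_compose2[OF indep]) simp
  show "distr M borel (\<lambda>\<omega>. f (X i \<omega>)) = distr M borel (\<lambda>\<omega>. f (X 0 \<omega>))" for i
    using distr_distr[of f borel borel "X i" M] distr_distr[of f borel borel "X 0" M] distr_eq[of i]
    by (simp add: comp_def)
qed

text \<open>Both laws are the product measure of the common marginal. This stationarity is the
  probabilistic input of the maximal ergodic lemma.\<close>

lemma distr_shift:
  "distr M (\<Pi>\<^sub>M i\<in>UNIV. borel) (\<lambda>\<omega> i. X (Suc i) \<omega>) = distr M (\<Pi>\<^sub>M i\<in>UNIV. borel) (\<lambda>\<omega> i. X i \<omega>)"
proof -
  have "indep_vars (\<lambda>_. borel) X (Suc ` UNIV)"
    using indep_vars_subset[OF indep] by blast
  then have *: "indep_vars (\<lambda>_. borel) (\<lambda>i. X (Suc i)) UNIV"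
    using indep_vars_reindex_inj[of Suc UNIV "\<lambda>_. borel" X] by simp
  have "distr M (\<Pi>\<^sub>M i\<in>UNIV. borel) (\<lambda>\<omega>. \<lambda>i\<in>UNIV. X (Suc i) \<omega>) = (\<Pi>\<^sub>M i\<in>UNIV. distr M borel (X (Suc i)))"
    using * by (subst indep_vars_iff_distr_eq_PiM[symmetric]) auto
  also have "\<dots> = (\<Pi>\<^sub>M i\<in>UNIV. distr M borel (X i))"
    by (metis distr_eq)
  also have "\<dots> = distr M (\<Pi>\<^sub>M i\<in>UNIV. borel) (\<lambda>\<omega>. \<lambda>i\<in>UNIV. X i \<omega>)"
    using indep by (subst indep_vars_iff_distr_eq_PiM[THEN iffD1]) auto
  finally show ?thesis by (simp add: restrict_def)
qed

end

section \<open>The maximal ergodic lemma and the maximal inequality\<close>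

text \<open>The maximum of the partial sums of lengths 0 to \<open>N\<close>, written as a recursion
  through the shifted sequence because this is the form in which Garsia's argument uses it.\<close>

primrec max_partial_sum :: "nat \<Rightarrow> (nat \<Rightarrow> real) \<Rightarrow> real" where
  "max_partial_sum 0 x = 0"
| "max_partial_sum (Suc N) x = max 0 (x 0 + max_partial_sum N (\<lambda>i. x (Suc i)))"

lemma max_partial_sum_nonneg: "0 \<le> max_partial_sum N x"
  by (cases N) auto

lemma max_partial_sum_le_Suc: "max_partial_sum N x \<le> max_partial_sum (Suc N) x"
proof (induction N arbitrary: x)
  case (Suc N)
  show ?case
    using Suc[of "\<lambda>i. x (Suc i)"] by (simp only: max_partial_sum.simps(2)[of _ x])
qed auto

lemma partial_sum_le_max: "n \<le> N \<Longrightarrow> (\<Sum>i<n. x i) \<le> max_partial_sum N x"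
proof (induction N arbitrary: x n)
  case (Suc N)
  show ?case
  proof (cases n)
    case (Suc m)
    with Suc.prems Suc.IH[of m "\<lambda>i. x (Suc i)"] show ?thesis
      by (simp add: sum.lessThan_Suc_shift del: sum.lessThan_Suc)
  qed (simp add: max_partial_sum_nonneg del: max_partial_sum.simps)
qed auto

lemma measurable_max_partial_sum [measurable]:
  "max_partial_sum N \<in> borel_measurable (\<Pi>\<^sub>M i\<in>UNIV. borel)"
proof (induction N)
  case (Suc N)
  have shift: "(\<lambda>x i. x (Suc i)) \<in> measurable (\<Pi>\<^sub>M i\<in>UNIV. borel) (\<Pi>\<^sub>M i\<in>UNIV. (borel :: real measure))"
    by (rule measurable_PiM_single') (auto simp: space_PiM)
  show ?case
    unfolding max_partial_sum.simps
    by (intro borel_measurable_max borel_measurable_add borel_measurable_const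
        measurable_component_singleton measurable_compose[OF shift Suc]) simp_all
qed simp

lemma max_partial_sum_abs_le: "\<bar>max_partial_sum N x\<bar> \<le> (\<Sum>i<N. \<bar>x i\<bar>)"
proof (induction N arbitrary: x)
  case (Suc N)
  from Suc[of "\<lambda>i. x (Suc i)"] show ?case
    by (simp add: sum.lessThan_Suc_shift del: sum.lessThan_Suc)
qed auto

context iid_sequence
begin

text \<open>Garsia's argument: on the event that some partial sum is positive, the first variable is at
  least the maximal partial sum minus that of the shifted sequence, which has the same law.\<close>

lemma maximal_ergodic:
  assumes int: "integrable M (X 0)"
  shows "0 \<le> (\<integral>\<omega>. X 0 \<omega> * indicator {\<omega>. max_partial_sum N (\<lambda>i. X i \<omega>) > 0} \<omega> \<partial>M)"
proof (cases N)
  case (Suc K)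
  have [measurable]: "(\<lambda>\<omega> i. X i \<omega>) \<in> measurable M (\<Pi>\<^sub>M i\<in>UNIV. borel)"
    "(\<lambda>\<omega> i. X (Suc i) \<omega>) \<in> measurable M (\<Pi>\<^sub>M i\<in>UNIV. borel)"
    by (auto intro!: measurable_PiM_single')
  have intX: "integrable M (X i)" for i
    using integrable_transfer[of "\<lambda>x. x" i] int by simp
  have intm: "integrable M (\<lambda>\<omega>. max_partial_sum n (\<lambda>i. X (f i) \<omega>))"
    if [measurable]: "(\<lambda>\<omega> i. X (f i) \<omega>) \<in> measurable M (\<Pi>\<^sub>M i\<in>UNIV. borel)" for n f
  proof (rule Bochner_Integration.integrable_bound)
    show "integrable M (\<lambda>\<omega>. \<Sum>i<n. \<bar>X (f i) \<omega>\<bar>)" by (intro Bochner_Integration.integrable_sum integrable_abs intX)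
    show "AE \<omega> in M. norm (max_partial_sum n (\<lambda>i. X (f i) \<omega>)) \<le> norm (\<Sum>i<n. \<bar>X (f i) \<omega>\<bar>)"
      using max_partial_sum_abs_le by (intro always_eventually) (auto intro: order_trans)
  qed simp
  let ?m = "\<lambda>n \<omega>. max_partial_sum n (\<lambda>i. X i \<omega>)"
  have ints: "integrable M (?m n)" "integrable M (\<lambda>\<omega>. max_partial_sum n (\<lambda>i. X (Suc i) \<omega>))" for n
    using intm[of "\<lambda>i. i"] intm[of Suc] by simp_all
  have "(\<integral>\<omega>. max_partial_sum K (\<lambda>i. X (Suc i) \<omega>) \<partial>M)
      = (\<integral>x. max_partial_sum K x \<partial>distr M (\<Pi>\<^sub>M i\<in>UNIV. borel) (\<lambda>\<omega> i. X (Suc i) \<omega>))"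
    by (subst integral_distr) auto
  also have "\<dots> = (\<integral>\<omega>. ?m K \<omega> \<partial>M)"
    unfolding distr_shift by (subst integral_distr) auto
  also have "\<dots> \<le> (\<integral>\<omega>. ?m N \<omega> \<partial>M)"
    unfolding Suc using max_partial_sum_le_Suc by (intro integral_mono ints) auto
  finally have "0 \<le> (\<integral>\<omega>. ?m N \<omega> - max_partial_sum K (\<lambda>i. X (Suc i) \<omega>) \<partial>M)"
    using ints by (subst Bochner_Integration.integral_diff) auto
  also have "\<dots> \<le> (\<integral>\<omega>. X 0 \<omega> * indicator {\<omega>. ?m N \<omega> > 0} \<omega> \<partial>M)"
  proof (rule integral_mono)
    show "integrable M (\<lambda>\<omega>. ?m N \<omega> - max_partial_sum K (\<lambda>i. X (Suc i) \<omega>))"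
      by (intro Bochner_Integration.integrable_diff ints)
    have "integrable M (\<lambda>\<omega>. indicator {\<omega>\<in>space M. ?m N \<omega> > 0} \<omega> *\<^sub>R X 0 \<omega>)"
      by (intro integrable_mult_indicator int) measurable
    moreover have "integrable M (\<lambda>\<omega>. indicator {\<omega>\<in>space M. ?m N \<omega> > 0} \<omega> *\<^sub>R X 0 \<omega>) \<longleftrightarrow>
        integrable M (\<lambda>\<omega>. X 0 \<omega> * indicator {\<omega>. ?m N \<omega> > 0} \<omega>)"
      by (intro Bochner_Integration.integrable_cong refl) (simp add: indicator_def)
    ultimately show "integrable M (\<lambda>\<omega>. X 0 \<omega> * indicator {\<omega>. ?m N \<omega> > 0} \<omega>)"
      by blast
    fix \<omega>
    \<comment> \<open>Off the event the maximal sum is zero, so the left side is minus a nonnegative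
      number and the right side is zero.\<close>
    show "?m N \<omega> - max_partial_sum K (\<lambda>i. X (Suc i) \<omega>) \<le> X 0 \<omega> * indicator {\<omega>. ?m N \<omega> > 0} \<omega>"
      using max_partial_sum_nonneg[of K "\<lambda>i. X (Suc i) \<omega>"]
      unfolding Suc max_partial_sum.simps by (auto split: split_indicator)
  qed
  finally show ?thesis .
qed simp

end

text \<open>The maximal ergodic lemma for \<open>X i - e\<close> bounds \<open>e\<close> times the
  probability by the integral of \<open>X 0\<close> over the event: Markov's inequality, but for all
  averages simultaneously. The finite horizons \<open>A N\<close> increase to the full
  event.\<close>

lemma (in iid_sequence) maximal_inequality:
  fixes e :: real
  assumes int: "integrable M (X 0)" and nonneg: "\<And>i \<omega>. 0 \<le> X i \<omega>" and "0 < e"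
  shows "{\<omega>\<in>space M. \<exists>n. (\<Sum>i<n. X i \<omega>) > n * e} \<in> events"
    "prob {\<omega>\<in>space M. \<exists>n. (\<Sum>i<n. X i \<omega>) > n * e} \<le> expectation (X 0) / e"
proof -
  show "{\<omega>\<in>space M. \<exists>n. (\<Sum>i<n. X i \<omega>) > n * e} \<in> events" by measurable
  let ?Y = "\<lambda>i \<omega>. X i \<omega> - e"
  interpret Y: iid_sequence M ?Y by (rule compose) simp
  define A where "A N = {\<omega>\<in>space M. \<exists>n\<le>N. (\<Sum>i<n. X i \<omega>) > n * e}" for N
  have [measurable]: "A N \<in> events" for N unfolding A_def by measurable
  have le: "prob (A N) \<le> expectation (X 0) / e" for N
  proof -
    let ?B = "{\<omega>. max_partial_sum N (\<lambda>i. ?Y i \<omega>) > 0}"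
    have [measurable]: "(\<lambda>\<omega> i. ?Y i \<omega>) \<in> measurable M (\<Pi>\<^sub>M i\<in>UNIV. borel)"
      by (auto intro!: measurable_PiM_single')
    have B [measurable]: "?B \<inter> space M \<in> events"
    proof -
      have "{\<omega>\<in>space M. max_partial_sum N (\<lambda>i. ?Y i \<omega>) > 0} \<in> events" by measurable
      then show ?thesis by (simp add: Int_def conj_commute)
    qed
    have intB: "integrable M (indicator (?B \<inter> space M) :: 'a \<Rightarrow> real)"
      using B by (intro integrable_real_indicator) (auto simp: emeasure_eq_measure)
    have "0 \<le> (\<integral>\<omega>. ?Y 0 \<omega> * indicator ?B \<omega> \<partial>M)"
      using int by (intro Y.maximal_ergodic) auto
    also have "\<dots> \<le> (\<integral>\<omega>. X 0 \<omega> - e * indicator (?B \<inter> space M) \<omega> \<partial>M)"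
    proof (rule integral_mono)
      have "integrable M (\<lambda>\<omega>. indicator (?B \<inter> space M) \<omega> *\<^sub>R ?Y 0 \<omega>)"
        using int by (intro integrable_mult_indicator) auto
      moreover have "integrable M (\<lambda>\<omega>. indicator (?B \<inter> space M) \<omega> *\<^sub>R ?Y 0 \<omega>) \<longleftrightarrow>
          integrable M (\<lambda>\<omega>. ?Y 0 \<omega> * indicator ?B \<omega>)"
        by (intro Bochner_Integration.integrable_cong refl) (simp add: indicator_def)
      ultimately show "integrable M (\<lambda>\<omega>. ?Y 0 \<omega> * indicator ?B \<omega>)"
        by blast
      show "integrable M (\<lambda>\<omega>. X 0 \<omega> - e * indicator (?B \<inter> space M) \<omega>)"
        using int intB by (intro Bochner_Integration.integrable_diff integrable_mult_right) auto
    qed (use nonneg in \<open>auto split: split_indicator\<close>)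
    also have "\<dots> = expectation (X 0) - e * prob (?B \<inter> space M)"
      using int intB B by (subst Bochner_Integration.integral_diff) (auto simp: Int_absorb1)
    finally have "prob (?B \<inter> space M) \<le> expectation (X 0) / e"
      using \<open>0 < e\<close> by (simp add: field_simps)
    moreover have "A N \<subseteq> ?B \<inter> space M"
    proof
      fix \<omega> assume "\<omega> \<in> A N"
      then obtain n where "n \<le> N" "(\<Sum>i<n. X i \<omega>) > n * e" "\<omega> \<in> space M" by (auto simp: A_def)
      with partial_sum_le_max[of n N "\<lambda>i. ?Y i \<omega>"] show "\<omega> \<in> ?B \<inter> space M"
        by (simp add: sum_subtractf)
    qed
    ultimately show ?thesis using finite_measure_mono[OF _ B] order_trans by blast
  qed
  have "(\<lambda>N. prob (A N)) \<longlonglongrightarrow> prob (\<Union>N. A N)"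
  proof (rule finite_Lim_measure_incseq)
    show "range A \<subseteq> events" by auto
    show "incseq A" by (rule incseq_SucI) (auto simp: A_def intro: le_SucI)
  qed
  then have "prob (\<Union>N. A N) \<le> expectation (X 0) / e"
    by (rule LIMSEQ_le_const2) (use le in auto)
  also have "(\<Union>N. A N) = {\<omega>\<in>space M. \<exists>n. (\<Sum>i<n. X i \<omega>) > n * e}"
    by (auto simp: A_def)
  finally show "prob {\<omega>\<in>space M. \<exists>n. (\<Sum>i<n. X i \<omega>) > n * e} \<le> expectation (X 0) / e" .
qed

section \<open>The strong law by truncation\<close>

context iid_sequence
begin

text \<open>Hoeffding's inequality makes the deviation probabilities geometrically small, hence
  summable, and the Borel-Cantelli lemma applies.\<close>

lemma strong_law_bounded:
  assumes bound: "\<And>i \<omega>. \<bar>X i \<omega>\<bar> \<le> c" and "c > 0" "e > 0"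
  shows "AE \<omega> in M. \<forall>\<^sub>F n in sequentially. \<bar>(\<Sum>i<n. X i \<omega>) / n - expectation (X 0)\<bar> < e"
proof -
  let ?A = "\<lambda>n. {\<omega>\<in>space M. \<bar>(\<Sum>i<n. X i \<omega>) / n - expectation (X 0)\<bar> \<ge> e}"
  \<comment> \<open>Hoeffding's bound for variables with range of length \<open>2 * c\<close>,
    written as an \<open>n\<close>-th power.\<close>
  define r where "r = exp (- 2 * e\<^sup>2 / (2 * c)\<^sup>2)"
  have r: "0 \<le> r" "r < 1" using assms by (auto simp: r_def)
  have bd: "prob (?A n) \<le> 2 * r ^ n" if "n > 0" for n
  proof -
    interpret H: Hoeffding_ineq_iid M "{..<n}" X "X 0" "- c" c "expectation (X 0)"
    proof unfold_locales
      show "indep_vars (\<lambda>_. borel) X {..<n}" using indep_vars_subset[OF indep] by blast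
      show "AE x in M. X 0 x \<in> {- c..c}" using bound[of 0] by (intro always_eventually allI) (auto simp: abs_le_iff minus_le_iff)
    qed (use distr_eq in auto)
    have "r ^ n = exp (- 2 * real n * e\<^sup>2 / (2 * c)\<^sup>2)"
      unfolding r_def by (simp add: exp_of_nat_mult[symmetric] mult_ac)
    moreover have "{..<n} \<noteq> {}" "0 \<le> e" "- c < c" "c - - c = 2 * c" using that assms(2,3) by auto
    ultimately show ?thesis
      using H.Hoeffding_ineq_abs_ge'[of e] by (simp only: card_lessThan simp_thms)
  qed
  have "summable (\<lambda>n. prob (?A n))"
  proof (rule summable_comparison_test')
    show "summable (\<lambda>n. 2 * r ^ n)" using r by (intro summable_mult summable_geometric) auto
    show "norm (prob (?A n)) \<le> 2 * r ^ n" if "n \<ge> 1" for n using bd[of n] that by simp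
  qed
  then have "AE \<omega> in M. \<forall>\<^sub>F n in sequentially. \<omega> \<in> space M - ?A n"
    by (intro borel_cantelli_AE1) (auto simp: emeasure_eq_measure)
  then show ?thesis
    by eventually_elim (auto elim!: eventually_mono)
qed

text \<open>The truncated variables obey the bounded case. The averages of the remainders are
  controlled for all \<open>n\<close> at once by the maximal inequality, whose bound vanishes with
  growing truncation level.\<close>

theorem strong_law:
  assumes int: "integrable M (X 0)"
  shows "AE \<omega> in M. (\<lambda>n. (\<Sum>i<n. X i \<omega>) / n) \<longlonglongrightarrow> expectation (X 0)"
proof -
  define T where "T k x = (if \<bar>x\<bar> \<le> real k then x else 0)" for k x
  define R where "R k x = \<bar>x - T k x\<bar>" for k x
  have [measurable]: "T k \<in> borel_measurable borel" "R k \<in> borel_measurable borel" for k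
    unfolding T_def R_def by measurable
  have R_le: "R k x \<le> \<bar>x\<bar>" "0 \<le> R k x" "\<bar>T k x\<bar> \<le> k" for k x by (auto simp: R_def T_def)
  have intR: "integrable M (\<lambda>\<omega>. R k (X 0 \<omega>))" for k
    using R_le by (intro Bochner_Integration.integrable_bound[OF int]) auto
  have intT: "integrable M (\<lambda>\<omega>. T k (X 0 \<omega>))" for k
    using R_le by (intro integrable_const_bound[of _ k]) auto
  have "(\<lambda>k. expectation (\<lambda>\<omega>. R k (X 0 \<omega>))) \<longlonglongrightarrow> expectation (\<lambda>\<omega>. 0)"
  proof (rule integral_dominated_convergence[where w = "\<lambda>\<omega>. \<bar>X 0 \<omega>\<bar>"])
    have "(\<lambda>k. R k x) \<longlonglongrightarrow> 0" for x
    proof (rule tendsto_eventually)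
      show "\<forall>\<^sub>F k in sequentially. R k x = 0"
        using eventually_ge_at_top[of "nat \<lceil>\<bar>x\<bar>\<rceil>"]
        by eventually_elim (auto simp: R_def T_def nat_le_iff ceiling_le_iff)
    qed
    then show "AE \<omega> in M. (\<lambda>k. R k (X 0 \<omega>)) \<longlonglongrightarrow> 0" by auto
  qed (use int R_le in auto)
  then have ER: "(\<lambda>k. expectation (\<lambda>\<omega>. R k (X 0 \<omega>))) \<longlonglongrightarrow> 0" by simp
  \<comment> \<open>One \<open>e\<close> each for the deviation of the truncated average, the
    average of the remainders and the shift of the mean caused by truncation.\<close>
  have main: "AE \<omega> in M. \<forall>\<^sub>F n in sequentially. \<bar>(\<Sum>i<n. X i \<omega>) / n - expectation (X 0)\<bar> < 3 * e" if epos: "e > 0" for e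
  proof -
    define E where "E k = {\<omega>\<in>space M. \<exists>n. (\<Sum>i<n. R k (X i \<omega>)) > n * e}" for k
    have E [measurable]: "E k \<in> events" and PE: "prob (E k) \<le> expectation (\<lambda>\<omega>. R k (X 0 \<omega>)) / e" for k
      using iid_sequence.maximal_inequality[OF compose[of "R k"], of e] intR R_le epos by (auto simp: E_def)
    obtain K where K: "\<And>k. k \<ge> K \<Longrightarrow> expectation (\<lambda>\<omega>. R k (X 0 \<omega>)) < e"
      using order_tendstoD(2)[OF ER epos] by (auto simp: eventually_sequentially)
    \<comment> \<open>For a given \<open>\<omega>\<close> a single level \<open>k\<close> outside
      its exceptional event suffices, so only the intersection of these events has to be
      null.\<close>
    have "prob (\<Inter>k\<in>{K..}. E k) \<le> 0"
    proof (rule LIMSEQ_le_const)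
      show "(\<lambda>k. expectation (\<lambda>\<omega>. R k (X 0 \<omega>)) / e) \<longlonglongrightarrow> 0"
        using tendsto_divide[OF ER tendsto_const, of e] epos by simp
      show "\<exists>N. \<forall>k\<ge>N. prob (\<Inter>k\<in>{K..}. E k) \<le> expectation (\<lambda>\<omega>. R k (X 0 \<omega>)) / e"
      proof (intro exI[of _ K] allI impI)
        fix k assume "k \<ge> K"
        then have "prob (\<Inter>k\<in>{K..}. E k) \<le> prob (E k)" by (intro finite_measure_mono) auto
        with PE[of k] show "prob (\<Inter>k\<in>{K..}. E k) \<le> expectation (\<lambda>\<omega>. R k (X 0 \<omega>)) / e" by linarith
      qed
    qed
    moreover have "(\<Inter>k\<in>{K..}. E k) \<in> events" by (rule sets.countable_INT) auto
    ultimately have "(\<Inter>k\<in>{K..}. E k) \<in> null_sets M"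
      by (simp add: null_sets_def emeasure_eq_measure measure_le_0_iff)
    then have "AE \<omega> in M. \<omega> \<notin> (\<Inter>k\<in>{K..}. E k)" by (rule AE_not_in)
    moreover have "AE \<omega> in M. \<forall>k. \<forall>\<^sub>F n in sequentially.
        \<bar>(\<Sum>i<n. T k (X i \<omega>)) / n - expectation (\<lambda>\<omega>. T k (X 0 \<omega>))\<bar> < e"
      unfolding AE_all_countable
    proof
      fix k
      have "AE \<omega> in M. \<forall>\<^sub>F n in sequentially.
          \<bar>(\<Sum>i<n. T k (X i \<omega>)) / real n - expectation (\<lambda>\<omega>. T k (X 0 \<omega>))\<bar> < e"
        by (rule iid_sequence.strong_law_bounded[OF compose[of "T k"], of "real k + 1"])
          (use order_trans[OF R_le(3), of _ "real k + 1"] epos in auto)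
      then show "AE \<omega> in M. \<forall>\<^sub>F n in sequentially.
          \<bar>(\<Sum>i<n. T k (X i \<omega>)) / real n - expectation (\<lambda>\<omega>. T k (X 0 \<omega>))\<bar> < e" .
    qed
    ultimately show ?thesis
      using AE_space
    proof eventually_elim
      case (elim \<omega>)
      then obtain k where k: "k \<ge> K" "\<omega> \<notin> E k" by auto
      have Rn: "(\<Sum>i<n. R k (X i \<omega>)) \<le> n * e" for n
        using k elim(3) unfolding E_def by (simp add: not_less)
      have mean: "\<bar>expectation (\<lambda>\<omega>. T k (X 0 \<omega>)) - expectation (X 0)\<bar> < e"
      proof -
        have "expectation (\<lambda>\<omega>. T k (X 0 \<omega>)) - expectation (X 0) = expectation (\<lambda>\<omega>. T k (X 0 \<omega>) - X 0 \<omega>)"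
          using int intT by simp
        also have "\<bar>\<dots>\<bar> \<le> expectation (\<lambda>\<omega>. \<bar>T k (X 0 \<omega>) - X 0 \<omega>\<bar>)"
          by (rule integral_abs_bound)
        also have "\<dots> = expectation (\<lambda>\<omega>. R k (X 0 \<omega>))" by (simp add: R_def abs_minus_commute)
        also have "\<dots> < e" using K[OF k(1)] .
        finally show ?thesis .
      qed
      from elim(2) have "\<forall>\<^sub>F n in sequentially.
        \<bar>(\<Sum>i<n. T k (X i \<omega>)) / n - expectation (\<lambda>\<omega>. T k (X 0 \<omega>))\<bar> < e" by blast
      then show ?case
        using eventually_gt_at_top[of 0]
      proof eventually_elim
        case (elim n)
        have "\<bar>(\<Sum>i<n. X i \<omega>) / n - (\<Sum>i<n. T k (X i \<omega>)) / n\<bar> = \<bar>\<Sum>i<n. X i \<omega> - T k (X i \<omega>)\<bar> / n"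
          by (simp add: sum_subtractf abs_divide flip: diff_divide_distrib)
        also have "\<dots> \<le> (\<Sum>i<n. R k (X i \<omega>)) / n"
          unfolding R_def by (intro divide_right_mono sum_abs) auto
        also have "\<dots> \<le> e" using Rn[of n] elim by (simp add: field_simps)
        finally show ?case using elim mean by linarith
      qed
    qed
  qed
  have "AE \<omega> in M. \<forall>j. \<forall>\<^sub>F n in sequentially. \<bar>(\<Sum>i<n. X i \<omega>) / n - expectation (X 0)\<bar> < 3 * (1 / Suc j)"
    unfolding AE_all_countable by (intro allI main) auto
  then show ?thesis
  proof eventually_elim
    case (elim \<omega>)
    show ?case
      unfolding tendsto_iff dist_real_def
    proof (intro allI impI)
      fix e :: real assume "e > 0"
      then obtain j where j: "inverse (Suc j) < e / 3" using reals_Archimedean[of "e / 3"] by auto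
      from elim have "\<forall>\<^sub>F n in sequentially. \<bar>(\<Sum>i<n. X i \<omega>) / n - expectation (X 0)\<bar> < 3 * (1 / Suc j)" by blast
      then show "\<forall>\<^sub>F n in sequentially. \<bar>(\<Sum>i<n. X i \<omega>) / n - expectation (X 0)\<bar> < e"
        by eventually_elim (use j in \<open>simp add: inverse_eq_divide\<close>)
    qed
  qed
qed

end

section \<open>The standard normal vector and the chi-square distribution\<close>

lemma norm_vec_sq: "(norm v)\<^sup>2 = (\<Sum>i\<in>UNIV. (v $ i)\<^sup>2)" for v :: "real^'n"
  unfolding power2_norm_eq_inner inner_vec_def by (simp add: power2_eq_square)

lemma sets_std_normal_vec [simp, measurable_cong]: "sets std_normal_vec = sets borel"
  by (simp add: std_normal_vec_def)

lemma space_std_normal_vec [simp]: "space std_normal_vec = UNIV"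
  by (simp add: std_normal_vec_def)

lemma nn_integral_lborel_vec_prod:
  fixes f :: "'n::finite \<Rightarrow> real \<Rightarrow> ennreal"
  assumes [measurable]: "\<And>i. f i \<in> borel_measurable borel"
  shows "(\<integral>\<^sup>+x. (\<Prod>i\<in>UNIV. f i (x $ i)) \<partial>(lborel :: (real^'n) measure)) = (\<Prod>i\<in>UNIV. (\<integral>\<^sup>+x. f i x \<partial>lborel))"
proof -
  have Basis: "(Basis :: (real^'n) set) = range (\<lambda>i. axis i 1)"
    by (auto simp: Basis_vec_def)
  have inj: "inj (\<lambda>i. axis i 1 :: real^'n)" by (auto simp: inj_on_def axis_eq_axis)
  define g where "g b = f (THE i. b = axis i (1::real))" for b :: "real^'n"
  have g: "g (axis i 1) = f i" for i by (simp add: g_def axis_eq_axis)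
  have "(\<integral>\<^sup>+x. (\<Prod>b\<in>Basis. g b (x \<bullet> b)) \<partial>lborel) = (\<Prod>b\<in>Basis. (\<integral>\<^sup>+x. g b x \<partial>lborel))"
    by (rule nn_integral_lborel_prod) (auto simp: Basis g)
  then show ?thesis
    by (simp add: Basis prod.reindex[OF inj] g inner_axis)
qed

text \<open>The density factors, so measures of boxes factor. Independence of the coordinates and
  the link to \<open>chi_square\<close>, which lives on a product space, both rest on this.\<close>

lemma distr_std_normal_vec_components:
  "distr std_normal_vec (\<Pi>\<^sub>M i\<in>UNIV. borel) (\<lambda>v i. v $ i) = (\<Pi>\<^sub>M i\<in>(UNIV::'n::finite set). std_normal_distribution)"
proof -
  interpret prob_space "std_normal_distribution" by (rule prob_space_normal_density) simp
  interpret product_sigma_finite "\<lambda>_::'n. std_normal_distribution"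
    by standard
  have comp [measurable]: "(\<lambda>v i. v $ i) \<in> measurable (std_normal_vec :: (real^'n) measure) (\<Pi>\<^sub>M i\<in>UNIV. borel)"
    by (intro measurable_PiM_single') auto
  show ?thesis
  proof (rule PiM_eqI)
    show "sets (distr (std_normal_vec :: (real^'n) measure) (\<Pi>\<^sub>M i\<in>UNIV. borel) (\<lambda>v i. v $ i)) =
        sets (\<Pi>\<^sub>M i\<in>(UNIV::'n::finite set). std_normal_distribution)"
      by (simp add: sets_PiM_cong[of UNIV UNIV "\<lambda>_. borel" "\<lambda>_. density lborel std_normal_density"])
    fix A :: "'n \<Rightarrow> real set" assume A: "\<And>i. i \<in> UNIV \<Longrightarrow> A i \<in> sets std_normal_distribution"
    then have [measurable]: "A i \<in> sets borel" for i by simp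
    have *: "{v::real^'n. \<forall>i. v $ i \<in> A i} \<in> sets borel" by measurable
    have "(\<lambda>v i. v $ i) -` Pi\<^sub>E UNIV A \<inter> space std_normal_vec = {v::real^'n. \<forall>i. v $ i \<in> A i}"
      by (auto simp: PiE_def)
    then have "emeasure (distr (std_normal_vec :: (real^'n) measure) (\<Pi>\<^sub>M i\<in>UNIV. borel) (\<lambda>v i. v $ i)) (Pi\<^sub>E UNIV A)
        = emeasure std_normal_vec {v::real^'n. \<forall>i. v $ i \<in> A i}"
      by (subst emeasure_distr) (auto intro!: sets_PiM_I_finite)
    also have "\<dots> = (\<integral>\<^sup>+v. ennreal (\<Prod>i\<in>UNIV. std_normal_density (v $ i)) * indicator {v::real^'n. \<forall>i. v $ i \<in> A i} v \<partial>lborel)"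
      unfolding std_normal_vec_def using * by (subst emeasure_density) auto
    also have "\<dots> = (\<integral>\<^sup>+v. (\<Prod>i\<in>UNIV. ennreal (std_normal_density (v $ i)) * indicator (A i) (v $ i)) \<partial>(lborel :: (real^'n) measure))"
    proof (rule nn_integral_cong)
      fix v :: "real^'n"
      have "indicator {v::real^'n. \<forall>i. v $ i \<in> A i} v = (\<Prod>i\<in>UNIV. indicator (A i) (v $ i) :: ennreal)"
        by (auto simp: indicator_def prod_eq_1_iff intro!: prod_zero[symmetric])
      then show "ennreal (\<Prod>i\<in>UNIV. std_normal_density (v $ i)) * indicator {v::real^'n. \<forall>i. v $ i \<in> A i} v =
          (\<Prod>i\<in>UNIV. ennreal (std_normal_density (v $ i)) * indicator (A i) (v $ i))"
        by (simp add: prod.distrib prod_ennreal)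
    qed
    also have "\<dots> = (\<Prod>i\<in>UNIV. (\<integral>\<^sup>+x. ennreal (std_normal_density x) * indicator (A i) x \<partial>lborel))"
      by (rule nn_integral_lborel_vec_prod) measurable
    also have "\<dots> = (\<Prod>i\<in>UNIV. emeasure std_normal_distribution (A i))"
      by (intro prod.cong refl) (subst emeasure_density, auto)
    finally show "emeasure (distr (std_normal_vec :: (real^'n) measure) (\<Pi>\<^sub>M i\<in>UNIV. borel) (\<lambda>v i. v $ i)) (Pi\<^sub>E UNIV A)
        = (\<Prod>i\<in>UNIV. emeasure std_normal_distribution (A i))" .
  qed simp
qed

lemma prob_space_std_normal_vec: "prob_space (std_normal_vec :: (real^'n) measure)"
proof -
  have "prob_space (distr (std_normal_vec :: (real^'n) measure) (\<Pi>\<^sub>M i\<in>UNIV. borel) (\<lambda>v i. v $ i))"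
    unfolding distr_std_normal_vec_components
    by (intro prob_space_PiM prob_space_normal_density) simp
  moreover have "(\<lambda>v i. v $ i) \<in> measurable (std_normal_vec :: (real^'n) measure) (\<Pi>\<^sub>M i\<in>UNIV. borel)"
    by (intro measurable_PiM_single') auto
  ultimately show ?thesis by (rule prob_space_distrD[rotated])
qed

interpretation std_normal_vec: prob_space "std_normal_vec :: (real^'n) measure"
  by (rule prob_space_std_normal_vec)

lemma distr_std_normal_vec_component:
  "distr (std_normal_vec :: (real^'n) measure) borel (\<lambda>v. v $ i) = std_normal_distribution"
proof -
  have comp [measurable]: "(\<lambda>v i. v $ i) \<in> measurable (std_normal_vec :: (real^'n) measure) (\<Pi>\<^sub>M i\<in>UNIV. borel)"
    by (intro measurable_PiM_single') auto
  have "distr (std_normal_vec :: (real^'n) measure) borel (\<lambda>v. v $ i)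
      = distr (distr (std_normal_vec :: (real^'n) measure) (\<Pi>\<^sub>M i\<in>UNIV. borel) (\<lambda>v i. v $ i)) borel (\<lambda>x. x i)"
    by (subst distr_distr) (auto simp: comp_def)
  also have "\<dots> = distr (\<Pi>\<^sub>M i\<in>(UNIV::'n::finite set). std_normal_distribution) std_normal_distribution (\<lambda>x. x i)"
    unfolding distr_std_normal_vec_components by (rule distr_cong) auto
  also have "\<dots> = std_normal_distribution"
    by (rule distr_PiM_component) (auto intro!: prob_space_normal_density)
  finally show ?thesis .
qed

lemma indep_vars_std_normal_vec:
  "std_normal_vec.indep_vars (\<lambda>_. borel) (\<lambda>i v. (v :: real^'n) $ i) UNIV"
proof (subst std_normal_vec.indep_vars_iff_distr_eq_PiM)
  show "distr std_normal_vec (\<Pi>\<^sub>M i\<in>UNIV. borel) (\<lambda>x. \<lambda>i\<in>UNIV. (x :: real^'n) $ i) =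
      (\<Pi>\<^sub>M i\<in>UNIV. distr (std_normal_vec :: (real^'n) measure) borel (\<lambda>v. v $ i))"
    by (simp add: distr_std_normal_vec_component distr_std_normal_vec_components restrict_def)
qed auto

lemma char_distr_scale:
  fixes c t :: real
  assumes [measurable]: "X \<in> borel_measurable M"
  shows "char (distr M borel (\<lambda>\<omega>. c * X \<omega>)) t = char (distr M borel X) (c * t)"
  by (simp add: char_def integral_distr mult_ac)

text \<open>By independence the characteristic function is a product of Gaussian ones, whose
  exponents add up to the square of the norm of \<open>u\<close>. It identifies the limit of each
  one-dimensional projection.\<close>

lemma distr_std_normal_vec_inner:
  fixes u :: "real^'n"
  shows "distr std_normal_vec borel (\<lambda>v. u \<bullet> v) = distr std_normal_distribution borel (\<lambda>z. norm u * z)"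
proof (rule Levy_uniqueness)
  show "real_distribution (distr std_normal_vec borel (\<lambda>v. u \<bullet> v))"
    by (rule std_normal_vec.real_distribution_distr) simp
  interpret N: prob_space "std_normal_distribution" by (rule prob_space_normal_density) simp
  show "real_distribution (distr std_normal_distribution borel (\<lambda>z. norm u * z))"
    by (rule N.real_distribution_distr) simp
  show "char (distr std_normal_vec borel (\<lambda>v. u \<bullet> v)) = char (distr std_normal_distribution borel (\<lambda>z. norm u * z))"
  proof
    fix t
    have id: "distr std_normal_distribution borel (\<lambda>x. x) = std_normal_distribution"
      by (rule distr_id2) simp
    have "std_normal_vec.indep_vars (\<lambda>_. borel) (\<lambda>i v. u $ i * (v :: real^'n) $ i) UNIV"
      by (rule std_normal_vec.indep_vars_compose2[OF indep_vars_std_normal_vec]) simp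
    then have "char (distr std_normal_vec borel (\<lambda>v. \<Sum>i\<in>UNIV. u $ i * v $ i)) t
        = (\<Prod>i\<in>UNIV. char (distr (std_normal_vec :: (real^'n) measure) borel (\<lambda>v. u $ i * v $ i)) t)"
      by (rule std_normal_vec.char_distr_sum)
    also have "\<dots> = (\<Prod>i\<in>UNIV. complex_of_real (exp (- (u $ i * t)\<^sup>2 / 2)))"
      by (subst char_distr_scale) (auto simp: distr_std_normal_vec_component char_std_normal_distribution)
    also have "\<dots> = complex_of_real (exp (\<Sum>i\<in>UNIV. - (u $ i * t)\<^sup>2 / 2))"
      by (simp add: exp_sum)
    also have "(\<Sum>i\<in>UNIV. - (u $ i * t)\<^sup>2 / 2) = - (norm u * t)\<^sup>2 / 2"
      by (simp add: power_mult_distrib norm_vec_sq sum_distrib_right sum_negf flip: sum_divide_distrib)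
    also have "complex_of_real (exp (- (norm u * t)\<^sup>2 / 2)) = char (distr std_normal_distribution borel (\<lambda>z. norm u * z)) t"
      by (subst char_distr_scale) (auto simp: id char_std_normal_distribution)
    finally show "char (distr std_normal_vec borel (\<lambda>v. u \<bullet> v)) t = char (distr std_normal_distribution borel (\<lambda>z. norm u * z)) t"
      by (simp add: inner_vec_def)
  qed
qed

text \<open>The limit law obeys the same second moment bound \<open>CARD('n)\<close> as the
  normalised sums, so one constant serves both in the approximation argument.\<close>

lemma std_normal_vec_norm_sq:
  shows "integrable std_normal_vec (\<lambda>v::real^'n. (norm v)\<^sup>2)"
    and "(\<integral>v. (norm v)\<^sup>2 \<partial>(std_normal_vec :: (real^'n) measure)) = CARD('n)"
proof -
  have one: "integrable std_normal_vec (\<lambda>v::real^'n. (v $ i)\<^sup>2)"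
    "(\<integral>v. (v $ i)\<^sup>2 \<partial>(std_normal_vec :: (real^'n) measure)) = 1" for i
  proof -
    have *: "integrable std_normal_distribution (\<lambda>x. x\<^sup>2)"
      by (rule integrable_std_normal_distribution_moment)
    then have "integrable (distr (std_normal_vec :: (real^'n) measure) borel (\<lambda>v. v $ i)) (\<lambda>x. x\<^sup>2)"
      by (simp add: distr_std_normal_vec_component)
    then show "integrable std_normal_vec (\<lambda>v::real^'n. (v $ i)\<^sup>2)"
      by (subst (asm) integrable_distr_eq) auto
    have "(\<integral>v. (v $ i)\<^sup>2 \<partial>(std_normal_vec :: (real^'n) measure))
        = (\<integral>x. x\<^sup>2 \<partial>distr (std_normal_vec :: (real^'n) measure) borel (\<lambda>v. v $ i))"
      by (subst integral_distr) auto
    also have "\<dots> = 1"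
      using std_normal_distribution_even_moments[of 1] by (simp add: distr_std_normal_vec_component)
    finally show "(\<integral>v. (v $ i)\<^sup>2 \<partial>(std_normal_vec :: (real^'n) measure)) = 1" .
  qed
  show "integrable std_normal_vec (\<lambda>v::real^'n. (norm v)\<^sup>2)"
    unfolding norm_vec_sq by (intro Bochner_Integration.integrable_sum one)
  show "(\<integral>v. (norm v)\<^sup>2 \<partial>(std_normal_vec :: (real^'n) measure)) = CARD('n)"
    unfolding norm_vec_sq by (subst Bochner_Integration.integral_sum) (auto simp: one)
qed

section \<open>The chi-square law and its quantiles\<close>

text \<open>A bijection between \<open>{..<CARD('n)}\<close> and the index type carries the defining
  product space to the coordinates of a vector.\<close>

lemma chi_square_eq_distr_norm:
  "chi_square CARD('n) = distr (std_normal_vec :: (real^'n) measure) borel (\<lambda>v. (norm v)\<^sup>2)"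
proof -
  let ?P = "\<Pi>\<^sub>M i\<in>(UNIV::'n set). std_normal_distribution"
  let ?L = "\<Pi>\<^sub>M i\<in>{..<CARD('n)}. std_normal_distribution"
  have comp [measurable]: "(\<lambda>v i. v $ i) \<in> measurable (std_normal_vec :: (real^'n) measure) (\<Pi>\<^sub>M i\<in>UNIV. borel)"
    by (intro measurable_PiM_single') auto
  obtain h where h: "bij_betw h {..<CARD('n)} (UNIV :: 'n set)"
    using ex_bij_betw_nat_finite[of "UNIV :: 'n set"] by (auto simp: atLeast0LessThan)
  have [measurable]: "(\<lambda>\<omega>. \<lambda>n\<in>{..<CARD('n)}. \<omega> (h n)) \<in> measurable ?P ?L"
    by (intro measurable_restrict measurable_component_singleton) auto
  have [measurable]: "(\<lambda>x. \<Sum>i<CARD('n). (x i)\<^sup>2) \<in> borel_measurable ?L"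
  proof (intro borel_measurable_sum borel_measurable_power)
    show "(\<lambda>x. x i) \<in> borel_measurable ?L" if "i \<in> {..<CARD('n)}" for i
      using measurable_component_singleton[OF that, of "\<lambda>_. std_normal_distribution"] by simp
  qed
  have [measurable]: "(\<lambda>x. \<Sum>i\<in>UNIV. (x i)\<^sup>2) \<in> borel_measurable (\<Pi>\<^sub>M i\<in>(UNIV::'n set). borel :: real measure)"
    by measurable
  have "?L = distr ?P ?L (\<lambda>\<omega>. \<lambda>n\<in>{..<CARD('n)}. \<omega> (h n))"
    using h by (intro distr_PiM_reindex[symmetric, of UNIV "\<lambda>_. std_normal_distribution" h])
      (auto intro!: prob_space_normal_density simp: bij_betw_def)
  then have "chi_square CARD('n) = distr (distr ?P ?L (\<lambda>\<omega>. \<lambda>n\<in>{..<CARD('n)}. \<omega> (h n))) borel (\<lambda>x. \<Sum>i<CARD('n). (x i)\<^sup>2)"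
    unfolding chi_square_def by simp
  also have "\<dots> = distr ?P borel (\<lambda>x. \<Sum>i<CARD('n). (x (h i))\<^sup>2)"
  proof (subst distr_distr)
    have "(\<lambda>x. \<Sum>i<CARD('n). (x i)\<^sup>2) \<circ> (\<lambda>\<omega>. \<lambda>n\<in>{..<CARD('n)}. \<omega> (h n)) = (\<lambda>x. \<Sum>i<CARD('n). (x (h i) :: real)\<^sup>2)"
      by (auto simp: fun_eq_iff intro!: sum.cong)
    then show "distr ?P borel ((\<lambda>x. \<Sum>i<CARD('n). (x i)\<^sup>2) \<circ> (\<lambda>\<omega>. \<lambda>n\<in>{..<CARD('n)}. \<omega> (h n))) =
        distr ?P borel (\<lambda>x. \<Sum>i<CARD('n). (x (h i))\<^sup>2)" by simp
  qed auto
  also have "\<dots> = distr ?P borel (\<lambda>x. \<Sum>i\<in>UNIV. (x i)\<^sup>2)"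
  proof -
    have "(\<Sum>i<CARD('n). (x (h i))\<^sup>2) = (\<Sum>i\<in>UNIV. (x i)\<^sup>2)" for x :: "'n \<Rightarrow> real"
      using sum.reindex_bij_betw[OF h, of "\<lambda>i. (x i)\<^sup>2"] by simp
    then show ?thesis by simp
  qed
  also have "\<dots> = distr std_normal_vec borel (\<lambda>v::real^'n. \<Sum>i\<in>UNIV. (v $ i)\<^sup>2)"
    unfolding distr_std_normal_vec_components[symmetric] by (subst distr_distr) (auto simp: comp_def)
  also have "\<dots> = distr (std_normal_vec :: (real^'n) measure) borel (\<lambda>v. (norm v)\<^sup>2)"
    by (simp add: norm_vec_sq)
  finally show ?thesis .
qed

text \<open>The density is everywhere positive. Null spheres then exclude atoms of the chi-square
  law, and non-null open shells make its distribution function strictly increasing on the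
  half-line.\<close>

lemma null_sets_std_normal_vec:
  "A \<in> null_sets (std_normal_vec :: (real^'n) measure) \<longleftrightarrow> A \<in> null_sets lborel"
proof -
  have "0 < (\<Prod>i\<in>UNIV. std_normal_density (v $ i))" for v :: "real^'n"
    by (intro prod_pos) (simp add: normal_density_pos)
  then have nz: "ennreal (\<Prod>i\<in>UNIV. std_normal_density (v $ i)) \<noteq> 0" for v :: "real^'n"
    by (simp add: ennreal_eq_0_iff not_le)
  have "A \<in> null_sets (std_normal_vec :: (real^'n) measure) \<longleftrightarrow> A \<in> sets lborel \<and> (AE x in lborel. x \<notin> A)"
    unfolding std_normal_vec_def
    by (subst null_sets_density_iff) (auto simp only: nz simp_thms, measurable)
  also have "\<dots> \<longleftrightarrow> A \<in> null_sets lborel"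
    using AE_iff_null_sets[of A lborel] by (metis null_setsD2)
  finally show ?thesis .
qed

interpretation chi_square: real_distribution "chi_square CARD('n::finite)"
  unfolding chi_square_eq_distr_norm by (rule std_normal_vec.real_distribution_distr) simp

lemma measure_chi_square:
  assumes "A \<in> sets borel"
  shows "measure (chi_square CARD('n)) A = measure (std_normal_vec :: (real^'n) measure) {v. (norm v)\<^sup>2 \<in> A}"
  unfolding chi_square_eq_distr_norm using assms by (subst measure_distr) (auto simp: vimage_def)

lemma measure_chi_square_singleton: "measure (chi_square CARD('n::finite)) {c} = 0"
proof -
  have "{v::real^'n. (norm v)\<^sup>2 \<in> {c}} \<subseteq> sphere 0 (sqrt c)"
    by auto
  moreover have "sphere (0::real^'n) (sqrt c) \<in> null_sets lborel"
    using negligible_sphere[of "0::real^'n" "sqrt c"] by (simp add: negligible_iff_null_sets null_sets_completion_iff)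
  ultimately have "{v::real^'n. (norm v)\<^sup>2 \<in> {c}} \<in> null_sets std_normal_vec"
    unfolding null_sets_std_normal_vec by (rule null_sets_subset[rotated 2]) auto
  then show ?thesis
    by (subst measure_chi_square) (auto simp: measure_def)
qed

lemma isCont_cdf_chi_square: "isCont (cdf (chi_square CARD('n::finite))) c"
  by (simp add: chi_square.isCont_cdf measure_chi_square_singleton)

lemma measure_chi_square_interval_pos:
  assumes "0 \<le> a" "a < b" shows "0 < measure (chi_square CARD('n::finite)) {a<..b}"
proof -
  let ?U = "{v::real^'n. (norm v)\<^sup>2 \<in> {a<..<b}}"
  have "open ?U"
    unfolding greaterThanLessThan_iff by (intro open_Collect_conj open_Collect_less continuous_intros)
  define i :: 'n where "i = undefined"
  have "(norm (axis i (sqrt ((a + b) / 2)) :: real^'n))\<^sup>2 = (a + b) / 2"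
    unfolding power2_norm_eq_inner inner_axis_axis using assms by simp
  then have "axis i (sqrt ((a + b) / 2)) \<in> ?U"
    using assms by simp
  then have "?U \<noteq> {}" by blast
  with \<open>open ?U\<close> have "?U \<notin> null_sets lborel"
    using open_not_negligible negligible_iff_null_sets null_sets_completionI by blast
  moreover have "?U \<in> sets borel" using \<open>open ?U\<close> by simp
  ultimately have "measure (std_normal_vec :: (real^'n) measure) ?U \<noteq> 0"
    unfolding null_sets_std_normal_vec[symmetric]
    by (auto simp: null_sets_def std_normal_vec.emeasure_eq_measure)
  then have "0 < measure (chi_square CARD('n::finite)) {a<..<b}"
    by (subst measure_chi_square) (auto simp: zero_less_measure_iff)
  also have "\<dots> \<le> measure (chi_square CARD('n::finite)) {a<..b}"
    by (intro chi_square.finite_measure_mono) auto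
  finally show ?thesis .
qed

lemma measure_chi_square_tail: "measure (chi_square CARD('n::finite)) {c<..} = 1 - cdf (chi_square CARD('n::finite)) c"
proof -
  have "{c<..} = UNIV - {..c}" by auto
  then show ?thesis
    using chi_square.prob_compl[of "{..c}"] by (simp add: cdf_def)
qed

text \<open>The intermediate value theorem supplies a quantile. The definite description also needs
  uniqueness: strict monotonicity gives it on nonnegative numbers, and a negative candidate is
  excluded because the distribution function is 0 there while \<open>1 - \<alpha>\<close> is
  positive.\<close>

lemma cdf_chi_square_quantile:
  assumes "0 < \<alpha>" "\<alpha> < 1"
  obtains c where "chi_square_quantile CARD('n::finite) \<alpha> = ereal c" "cdf (chi_square CARD('n::finite)) c = 1 - \<alpha>"
proof -
  let ?C = "cdf (chi_square CARD('n::finite))"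
  have "\<forall>\<^sub>F x in at_bot. ?C x < 1 - \<alpha>" "\<forall>\<^sub>F x in at_top. ?C x > 1 - \<alpha>"
    using chi_square.cdf_lim_at_bot chi_square.cdf_lim_at_top_prob assms by (auto intro: order_tendstoD)
  then obtain l r where lr: "?C l < 1 - \<alpha>" "?C r > 1 - \<alpha>"
    by (metis eventually_at_bot_linorder eventually_at_top_linorder order_refl)
  have mono: "?C x \<le> ?C y" if "x \<le> y" for x y
    using that by (rule chi_square.cdf_nondecreasing)
  have "l \<le> r" using lr mono[of r l] by (cases "l \<le> r") auto
  then obtain c where c: "?C c = 1 - \<alpha>"
    using IVT[of ?C l "1 - \<alpha>" r] lr isCont_cdf_chi_square by force
  have neg: "?C x = 0" if "x < 0" for x
  proof -
    have "{v::real^'n. (norm v)\<^sup>2 \<in> {..x}} = {}"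
      using that by (auto simp: not_le intro: less_le_trans)
    then show ?thesis unfolding cdf_def by (subst measure_chi_square) auto
  qed
  have strict: "?C a < ?C b" if "0 \<le> a" "a < b" for a b
  proof -
    have "?C b - ?C a = measure (chi_square CARD('n)) {a<..b}"
      using that(2) by (rule chi_square.cdf_diff_eq)
    with measure_chi_square_interval_pos[OF that, where 'n = 'n] show ?thesis by simp
  qed
  have "(THE c. measure (chi_square CARD('n)) {c<..} = \<alpha>) = c"
  proof (rule the_equality)
    show "measure (chi_square CARD('n)) {c<..} = \<alpha>" using c by (simp add: measure_chi_square_tail)
    fix d assume "measure (chi_square CARD('n)) {d<..} = \<alpha>"
    then have d: "?C d = 1 - \<alpha>" by (simp add: measure_chi_square_tail)
    have "0 \<le> c" "0 \<le> d" using neg[of c] neg[of d] c d assms by (auto simp: not_less[symmetric])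
    then show "d = c" using strict[of c d] strict[of d c] c d by (cases c d rule: linorder_cases) auto
  qed
  with c show thesis by (intro that[of c]) (use assms in \<open>auto simp: chi_square_quantile_def\<close>)
qed

lemma converges_in_distribution_chi_square_quantile:
  fixes V :: "nat \<Rightarrow> 'w \<Rightarrow> real^'n"
  assumes "prob_space M" "converges_in_distribution M V std_normal_vec" "0 \<le> \<alpha>" "\<alpha> \<le> 1"
  shows "(\<lambda>n. measure M {\<omega>\<in>space M. ereal ((norm (V n \<omega>))\<^sup>2) \<le> chi_square_quantile CARD('n) \<alpha>}) \<longlonglongrightarrow> 1 - \<alpha>"
proof -
  interpret prob_space M by fact
  have [measurable]: "V n \<in> borel_measurable M" for n
    using assms(2) unfolding converges_in_distribution_def by blast
  let ?D = "\<lambda>n. distr M borel (\<lambda>\<omega>. (norm (V n \<omega>))\<^sup>2)"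
  have D: "real_distribution (?D n)" for n
    by (rule real_distribution_distr) simp
  have "weak_conv_m ?D (chi_square CARD('n))"
  proof (rule integral_bdd_continuous_conv_imp_weak_conv[OF D chi_square.real_distribution_axioms])
    fix f :: "real \<Rightarrow> real" assume f: "\<And>x. isCont f x" "\<And>x. \<bar>f x\<bar> \<le> 1"
    then have cont: "continuous_on UNIV f" by (simp add: continuous_at_imp_continuous_on)
    then have [measurable]: "f \<in> borel_measurable borel" by (rule borel_measurable_continuous_onI)
    have "continuous_on UNIV (\<lambda>v::real^'n. f ((norm v)\<^sup>2))"
      by (intro continuous_on_compose2[OF cont] continuous_intros) auto
    moreover have "bounded (range (\<lambda>v::real^'n. f ((norm v)\<^sup>2)))"
      using f(2) by (intro boundedI[of _ 1]) auto
    ultimately have "(\<lambda>n. \<integral>\<omega>. f ((norm (V n \<omega>))\<^sup>2) \<partial>M) \<longlonglongrightarrow> (\<integral>v. f ((norm v)\<^sup>2) \<partial>(std_normal_vec :: (real^'n) measure))"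
      using assms(2) unfolding converges_in_distribution_def by blast
    then show "(\<lambda>n. integral\<^sup>L (?D n) f) \<longlonglongrightarrow> integral\<^sup>L (chi_square CARD('n)) f"
      by (simp add: chi_square_eq_distr_norm integral_distr)
  qed
  then have lim: "(\<lambda>n. cdf (?D n) c) \<longlonglongrightarrow> cdf (chi_square CARD('n)) c" for c
    using isCont_cdf_chi_square unfolding weak_conv_m_def weak_conv_def by blast
  have cdf_D: "cdf (?D n) c = measure M {\<omega>\<in>space M. ereal ((norm (V n \<omega>))\<^sup>2) \<le> ereal c}" for n c
    unfolding cdf_def by (subst measure_distr) (auto intro!: arg_cong[where f = "measure M"])
  \<comment> \<open>At level 0 the quantile is infinite and the event is the whole space; at level 1
    the limit is the mass of the singleton 0, which is zero.\<close>
  consider "\<alpha> = 0" | "\<alpha> = 1" | "0 < \<alpha>" "\<alpha> < 1" using assms by linarith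
  then show ?thesis
  proof cases
    case 1
    then show ?thesis by (simp add: chi_square_quantile_def prob_space)
  next
    case 2
    have "cdf (chi_square CARD('n)) 0 = measure (chi_square CARD('n)) {0}"
    proof -
      have "{v::real^'n. (norm v)\<^sup>2 \<in> {..0}} = {v. (norm v)\<^sup>2 \<in> {0}}" by auto
      then show ?thesis unfolding cdf_def by (simp add: measure_chi_square)
    qed
    then show ?thesis
      using lim[of 0] 2 unfolding cdf_D
      by (simp add: chi_square_quantile_def measure_chi_square_singleton zero_ereal_def)
  next
    case 3
    then obtain c where "chi_square_quantile CARD('n) \<alpha> = ereal c" "cdf (chi_square CARD('n)) c = 1 - \<alpha>"
      by (rule cdf_chi_square_quantile)
    then show ?thesis using lim[of c] unfolding cdf_D by simp
  qed
qed

section \<open>The multivariate central limit theorem\<close>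

text \<open>Arbitrary frequency vectors and phases make this an algebra that contains the sines,
  while the expectation of a member is still a finite combination of expectations of single cosines,
  which one-dimensional limit theorems control.\<close>

inductive trig_poly :: "('a::real_inner \<Rightarrow> real) \<Rightarrow> bool" where
  cos: "trig_poly (\<lambda>x. cos (u \<bullet> x + b))"
| add: "trig_poly p \<Longrightarrow> trig_poly q \<Longrightarrow> trig_poly (\<lambda>x. p x + q x)"
| scale: "trig_poly p \<Longrightarrow> trig_poly (\<lambda>x. c * p x)"

lemma trig_poly_const: "trig_poly (\<lambda>x. c)"
  using trig_poly.scale[OF trig_poly.cos[of 0 0], of c] by simp

lemma trig_poly_sum: "(\<And>i. i \<in> I \<Longrightarrow> trig_poly (f i)) \<Longrightarrow> trig_poly (\<lambda>x. \<Sum>i\<in>I. f i x)"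
  by (induction I rule: infinite_finite_induct) (auto intro: trig_poly_const trig_poly.add)

lemma trig_poly_mult:
  assumes "trig_poly p" "trig_poly q"
  shows "trig_poly (\<lambda>x. p x * q x)"
  using assms(1)
proof (induction rule: trig_poly.induct)
  case (cos u b)
  show ?case
    using assms(2)
  proof (induction rule: trig_poly.induct)
    case (cos v c)
    have "cos (u \<bullet> x + b) * cos (v \<bullet> x + c)
        = (1/2) * cos ((u - v) \<bullet> x + (b - c)) + (1/2) * cos ((u + v) \<bullet> x + (b + c))" for x
    proof -
      have *: "(u - v) \<bullet> x + (b - c) = (u \<bullet> x + b) - (v \<bullet> x + c)"
        "(u + v) \<bullet> x + (b + c) = (u \<bullet> x + b) + (v \<bullet> x + c)"
        by (simp_all add: inner_diff_left inner_add_left)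
      show ?thesis unfolding * cos_times_cos by simp
    qed
    then show ?case by (simp only:) (intro trig_poly.intros)
  next
    case (add p q)
    then show ?case by (simp add: distrib_left trig_poly.add)
  next
    case (scale p c)
    then show ?case by (simp add: mult.left_commute[of _ c] trig_poly.scale)
  qed
next
  case (add p q)
  then show ?case by (simp add: distrib_right trig_poly.add)
next
  case (scale p c)
  then show ?case by (simp add: mult.assoc trig_poly.scale)
qed

lemma trig_poly_continuous: "trig_poly p \<Longrightarrow> continuous_on S p"
  by (induction rule: trig_poly.induct) (auto intro!: continuous_intros)

lemma trig_poly_bounded: "trig_poly p \<Longrightarrow> \<exists>B. \<forall>x. \<bar>p x\<bar> \<le> B"
proof (induction rule: trig_poly.induct)
  case (cos u b)
  then show ?case by (intro exI[of _ 1]) auto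
next
  case (add p q)
  then obtain A B where "\<forall>x. \<bar>p x\<bar> \<le> A" "\<forall>x. \<bar>q x\<bar> \<le> B" by blast
  then show ?case by (intro exI[of _ "A + B"]) (auto intro: order_trans[OF abs_triangle_ineq] add_mono)
next
  case (scale p c)
  then obtain A where "\<forall>x. \<bar>p x\<bar> \<le> A" by blast
  then show ?case by (intro exI[of _ "\<bar>c\<bar> * A"]) (auto simp: abs_mult intro: mult_left_mono)
qed

text \<open>The period is \<open>2 * a\<close> in every coordinate. Embedding the torus into a
  Euclidean space provides the polynomial functions for the Stone-Weierstrass theorem.\<close>

definition torus_map :: "real \<Rightarrow> real^'n \<Rightarrow> (real^'n) \<times> (real^'n)" where
  "torus_map a x = ((\<chi> i. cos (pi / a * x $ i)), (\<chi> i. sin (pi / a * x $ i)))"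

lemma torus_map_eq_iff:
  "torus_map a x = torus_map a y \<longleftrightarrow> (\<forall>i. cos (pi / a * x $ i) = cos (pi / a * y $ i) \<and> sin (pi / a * x $ i) = sin (pi / a * y $ i))"
  by (auto simp: torus_map_def vec_eq_iff)

text \<open>Linear functionals of the torus point are combinations of cosines and sines, the sine
  being a cosine with phase \<open>- (pi / 2)\<close>; the algebra structure covers the remaining
  cases.\<close>

lemma trig_poly_polynomial_torus_map:
  fixes p :: "(real^'n) \<times> (real^'n) \<Rightarrow> real"
  assumes "real_polynomial_function p"
  shows "trig_poly (\<lambda>x. p (torus_map a x))"
  using assms
proof (induction rule: real_polynomial_function.induct)
  case (linear f)
  then interpret bounded_linear f .
  let ?c = "\<lambda>i x. cos ((axis i (pi / a) :: real^'n) \<bullet> x + 0)" and ?s = "\<lambda>i x. cos ((axis i (pi / a) :: real^'n) \<bullet> x + - (pi / 2))"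
  have c: "?c i x = cos (pi / a * x $ i)" and s: "?s i x = sin (pi / a * x $ i)" for i x
    by (simp_all add: inner_axis' cos_diff)
  have "f (torus_map a x) = (\<Sum>i\<in>UNIV. f (axis i 1, 0) * ?c i x) + (\<Sum>i\<in>UNIV. f (0, axis i 1) * ?s i x)" for x
  proof -
    have "torus_map a x = (\<Sum>i\<in>UNIV. ?c i x *\<^sub>R (axis i 1, 0)) + (\<Sum>i\<in>UNIV. ?s i x *\<^sub>R (0, axis i 1))"
      unfolding c s
    proof (rule prod_eqI)
      show "fst (torus_map a x) = fst ((\<Sum>i\<in>UNIV. cos (pi / a * x $ i) *\<^sub>R (axis i 1, 0)) +
          (\<Sum>i\<in>UNIV. sin (pi / a * x $ i) *\<^sub>R (0, axis i 1)))"
        by (simp add: torus_map_def fst_sum vec_eq_iff axis_def if_distrib cong: if_cong)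
      show "snd (torus_map a x) = snd ((\<Sum>i\<in>UNIV. cos (pi / a * x $ i) *\<^sub>R (axis i 1, 0)) +
          (\<Sum>i\<in>UNIV. sin (pi / a * x $ i) *\<^sub>R (0, axis i 1)))"
        by (simp add: torus_map_def snd_sum vec_eq_iff axis_def if_distrib cong: if_cong)
    qed
    then show ?thesis by (simp add: add sum scaleR mult.commute del: scaleR_Pair)
  qed
  then show ?case
    by (simp only:) (intro trig_poly.add trig_poly_sum trig_poly.scale trig_poly.cos)
qed (auto intro: trig_poly_const trig_poly.add trig_poly_mult)

lemma torus_map_surj_cube:
  assumes "a > 0"
  obtains y :: "real^'n" where "\<forall>i. \<bar>y $ i\<bar> \<le> a" "torus_map a y = torus_map a x"
proof
  \<comment> \<open>Rounding picks the multiple of the period \<open>2 * a\<close> nearest to the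
    coordinate.\<close>
  let ?k = "\<lambda>i. round (x $ i / (2 * a))"
  let ?y = "(\<chi> i. x $ i - 2 * a * ?k i) :: real^'n"
  show "\<forall>i. \<bar>?y $ i\<bar> \<le> a"
  proof
    fix i
    have "?y $ i = - (2 * a * (?k i - x $ i / (2 * a)))"
      using assms by (simp add: right_diff_distrib)
    then have "\<bar>?y $ i\<bar> = 2 * a * \<bar>?k i - x $ i / (2 * a)\<bar>"
      using assms by (simp add: abs_mult)
    also have "\<dots> \<le> 2 * a * (1 / 2)"
      using assms of_int_round_abs_le[of "x $ i / (2 * a)"] by (intro mult_left_mono) auto
    finally show "\<bar>?y $ i\<bar> \<le> a" by simp
  qed
  have "sin (pi / a * x $ i) = sin (pi / a * ?y $ i) \<and> cos (pi / a * x $ i) = cos (pi / a * ?y $ i)" for i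
    unfolding sin_cos_eq_iff using assms by (intro exI[of _ "?k i"]) (simp add: field_simps)
  then show "torus_map a ?y = torus_map a x"
    unfolding torus_map_eq_iff by metis
qed

text \<open>A continuous function vanishing outside a cube descends to the torus obtained by identifying
  opposite faces, where the Stone-Weierstrass theorem applies. The approximating trigonometric
  polynomial is periodic, hence bounded on the whole space.\<close>

lemma trig_poly_approximation:
  fixes G :: "real^'n \<Rightarrow> real"
  assumes cont: "continuous_on UNIV G" and supp: "\<And>x i. \<bar>x $ i\<bar> \<ge> a \<Longrightarrow> G x = 0" and "a > 0" "e > 0"
  obtains p where "trig_poly p" "\<And>x. \<forall>i. \<bar>x $ i\<bar> \<le> a \<Longrightarrow> \<bar>p x - G x\<bar> \<le> e"
    "\<And>x. \<exists>y. (\<forall>i. \<bar>y $ i\<bar> \<le> a) \<and> p x = p y"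
proof -
  define Q :: "(real^'n) set" where "Q = {x. \<forall>i. \<bar>x $ i\<bar> \<le> a}"
  let ?T = "torus_map a ` Q"
  have Q_eq: "Q = cbox (\<chi> i. - a) (\<chi> i. a)"
    by (auto simp: Q_def mem_box_cart abs_le_iff minus_le_iff)
  have Q: "compact Q" unfolding Q_eq by (rule compact_cbox)
  have cont_torus: "continuous_on S (torus_map a)" for S :: "(real^'n) set"
    unfolding torus_map_def by (intro continuous_intros)
  \<comment> \<open>Distinct points of the cube with the same image differ in some coordinate by a
    nonzero multiple of \<open>2 * a\<close>, so both lie on opposite faces, where \<open>G\<close>
    vanishes.\<close>
  have wd: "G x = G y" if xy: "x \<in> Q" "y \<in> Q" "torus_map a x = torus_map a y" for x y
  proof (cases "x = y")
    case False
    then obtain i where i: "x $ i \<noteq> y $ i" by (auto simp: vec_eq_iff)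
    from xy(3) obtain n :: int where n: "pi / a * x $ i = pi / a * y $ i + 2 * pi * n"
      using sin_cos_eq_iff unfolding torus_map_eq_iff by metis
    have "pi * (x $ i - y $ i) = pi * (2 * a * n)"
      using n \<open>a > 0\<close> by (simp add: field_simps)
    then have n': "x $ i - y $ i = 2 * a * n" by simp
    have bd: "\<bar>x $ i\<bar> \<le> a" "\<bar>y $ i\<bar> \<le> a" using xy by (auto simp: Q_def)
    have "n \<noteq> 0" using i n' by auto
    then have "\<bar>real_of_int n\<bar> \<ge> 1" by linarith
    then have "2 * a * 1 \<le> 2 * a * \<bar>real_of_int n\<bar>" using \<open>a > 0\<close> by (intro mult_left_mono) auto
    then have "2 * a \<le> \<bar>x $ i - y $ i\<bar>"
      using n' \<open>a > 0\<close> by (simp add: abs_mult)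
    then have "\<bar>x $ i\<bar> \<ge> a" "\<bar>y $ i\<bar> \<ge> a" using bd by linarith+
    then show ?thesis using supp by simp
  qed simp
  define H where "H t = G (inv_into Q (torus_map a) t)" for t
  have H: "H (torus_map a x) = G x" if "x \<in> Q" for x
    unfolding H_def using that by (intro wd inv_into_into f_inv_into_f) auto
  \<comment> \<open>Preimages of closed sets under the descended function are images of compact
    sets, hence closed.\<close>
  have "continuous_on ?T H"
  proof (rule continuous_on_closed_vimage[THEN iffD2, rule_format])
    show "closed ?T" using cont_torus Q compact_continuous_image compact_imp_closed by metis
    fix B :: "real set" assume "closed B"
    have "H -` B \<inter> ?T = torus_map a ` (G -` B \<inter> Q)"
      using H by auto
    moreover have "compact (G -` B \<inter> Q)"
      using \<open>closed B\<close> cont Q by (intro closed_Int_compact) (auto intro: closed_vimage)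
    ultimately show "closed (H -` B \<inter> ?T)"
      using cont_torus compact_continuous_image compact_imp_closed by metis
  qed
  then obtain q where q: "real_polynomial_function q" "\<And>t. t \<in> ?T \<Longrightarrow> \<bar>H t - q t\<bar> < e"
    using Stone_Weierstrass_real_polynomial_function[of ?T H e] cont_torus Q \<open>e > 0\<close>
      compact_continuous_image by metis
  show thesis
  proof
    show "trig_poly (\<lambda>x. q (torus_map a x))" by (rule trig_poly_polynomial_torus_map[OF q(1)])
    show "\<bar>q (torus_map a x) - G x\<bar> \<le> e" if "\<forall>i. \<bar>x $ i\<bar> \<le> a" for x
      using q(2)[of "torus_map a x"] H[of x] that by (auto simp: Q_def)
    show "\<exists>y. (\<forall>i. \<bar>y $ i\<bar> \<le> a) \<and> q (torus_map a x) = q (torus_map a y)" for x :: "real^'n"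
      using torus_map_surj_cube[OF \<open>a > 0\<close>, of x] by metis
  qed
qed

text \<open>A bounded continuous function has in general no uniform trigonometric approximation on
  the whole space. The error may instead grow quadratically, with a coefficient that is small for
  large \<open>r\<close>, which second moment bounds absorb. The factor \<open>2 * B + e\<close>
  adds the bound \<open>B\<close> for \<open>g\<close> to the bound \<open>B + e\<close> that
  periodicity gives for \<open>p\<close> everywhere.\<close>

lemma trig_poly_approximation_quadratic:
  fixes g :: "real^'n \<Rightarrow> real"
  assumes cont: "continuous_on UNIV g" and bd: "\<And>x. \<bar>g x\<bar> \<le> B" and "e > 0" "r > 0"
  obtains p where "trig_poly p" "\<And>x. \<bar>g x - p x\<bar> \<le> e + (2 * B + e) * (norm x)\<^sup>2 / r\<^sup>2"
proof -
  have B: "B \<ge> 0" using bd[of 0] by linarith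
  \<comment> \<open>A cutoff equal to 1 on the ball of radius \<open>r\<close> and to 0 from radius
    \<open>2 * r\<close> on.\<close>
  define \<psi> where "\<psi> x = max 0 (min 1 (2 - norm x / r))" for x :: "real^'n"
  define G where "G x = g x * \<psi> x" for x
  have \<psi>: "0 \<le> \<psi> x" "\<psi> x \<le> 1" for x by (auto simp: \<psi>_def)
  have "continuous_on UNIV G"
    unfolding G_def \<psi>_def using cont \<open>r > 0\<close> by (intro continuous_intros) auto
  moreover have "G x = 0" if "\<bar>x $ i\<bar> \<ge> 2 * r" for x i
  proof -
    have "norm x \<ge> 2 * r" using component_le_norm_cart[of x i] that by linarith
    then show ?thesis using \<open>r > 0\<close> by (simp add: G_def \<psi>_def field_simps max_def min_def)
  qed
  ultimately obtain p where p: "trig_poly p" "\<And>x. \<forall>i. \<bar>x $ i\<bar> \<le> 2 * r \<Longrightarrow> \<bar>p x - G x\<bar> \<le> e"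
    "\<And>x. \<exists>y. (\<forall>i. \<bar>y $ i\<bar> \<le> 2 * r) \<and> p x = p y"
    using trig_poly_approximation[of G "2 * r" e] assms by (metis mult_pos_pos zero_less_numeral)
  have G: "\<bar>G x\<bar> \<le> B" for x
  proof -
    have "\<bar>G x\<bar> = \<bar>g x\<bar> * \<psi> x" using \<psi>(1)[of x] by (simp add: G_def abs_mult)
    also have "\<dots> \<le> B * 1" by (intro mult_mono bd \<psi> B)
    finally show ?thesis by simp
  qed
  have pb: "\<bar>p x\<bar> \<le> B + e" for x
  proof -
    obtain y where "\<forall>i. \<bar>y $ i\<bar> \<le> 2 * r" "p x = p y" using p(3) by blast
    with p(2)[of y] G[of y] show ?thesis by auto
  qed
  show thesis
  proof
    show "trig_poly p" by fact
    show "\<bar>g x - p x\<bar> \<le> e + (2 * B + e) * (norm x)\<^sup>2 / r\<^sup>2" for x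
    proof (cases "norm x \<le> r")
      case True
      then have "G x = g x" using \<open>r > 0\<close> by (simp add: G_def \<psi>_def field_simps min_def)
      moreover have "\<forall>i. \<bar>x $ i\<bar> \<le> 2 * r"
        using order_trans[OF component_le_norm_cart[of x], of "2 * r"] True \<open>r > 0\<close> by simp
      ultimately have "\<bar>g x - p x\<bar> \<le> e" using p(2)[of x] by (simp add: abs_minus_commute)
      moreover have "0 \<le> (2 * B + e) * (norm x)\<^sup>2 / r\<^sup>2" using B \<open>e > 0\<close> by simp
      ultimately show ?thesis by linarith
    next
      case False
      then have "1 \<le> (norm x)\<^sup>2 / r\<^sup>2" using \<open>r > 0\<close> by (simp add: power_mono)
      then have "(2 * B + e) * 1 \<le> (2 * B + e) * ((norm x)\<^sup>2 / r\<^sup>2)"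
        using B \<open>e > 0\<close> by (intro mult_left_mono) auto
      moreover have "\<bar>g x - p x\<bar> \<le> 2 * B + e" using bd[of x] pb[of x] by linarith
      ultimately show ?thesis using \<open>e > 0\<close> by simp
    qed
  qed
qed

lemma (in prob_space) indep_vars_imp_indep_var:
  assumes "indep_vars (\<lambda>_. N) X I" "i \<noteq> j" "i \<in> I" "j \<in> I"
  shows "indep_var N (X i) N (X j)"
proof -
  have "indep_vars (\<lambda>_. N) (\<lambda>b. X (case_bool i j b)) UNIV"
    by (rule indep_vars_reindex_inj[of "case_bool i j" UNIV "\<lambda>_. N" X])
      (use assms in \<open>auto simp: inj_def UNIV_bool split: bool.splits intro: indep_vars_subset\<close>)
  also have "(\<lambda>b. X (case_bool i j b)) = case_bool (X i) (X j)"
    by (auto split: bool.split)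
  also have "(\<lambda>_. N) = case_bool N N"
    by (auto split: bool.split)
  finally show ?thesis unfolding indep_var_def .
qed

text \<open>Stated over an arbitrary probability space so that it covers the random vectors and,
  with the identity map in place of \<open>V\<close>, the limit law.\<close>

lemma (in prob_space) trig_poly_expectation_error:
  fixes V :: "'a \<Rightarrow> real^'n" and g p :: "real^'n \<Rightarrow> real"
  assumes [measurable]: "V \<in> borel_measurable M"
    and int: "integrable M (\<lambda>\<omega>. (norm (V \<omega>))\<^sup>2)" and le: "expectation (\<lambda>\<omega>. (norm (V \<omega>))\<^sup>2) \<le> D"
    and g: "continuous_on UNIV g" "\<And>x. \<bar>g x\<bar> \<le> B" and p: "trig_poly p"
    and c: "0 \<le> c" and err: "\<And>x. \<bar>g x - p x\<bar> \<le> e + c * (norm x)\<^sup>2"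
  shows "\<bar>expectation (\<lambda>\<omega>. g (V \<omega>)) - expectation (\<lambda>\<omega>. p (V \<omega>))\<bar> \<le> e + c * D"
proof -
  have [measurable]: "g \<in> borel_measurable borel" "p \<in> borel_measurable borel"
    using g(1) trig_poly_continuous[OF p] by (auto intro: borel_measurable_continuous_onI)
  obtain P where P: "\<forall>x. \<bar>p x\<bar> \<le> P" using trig_poly_bounded[OF p] by metis
  have ig: "integrable M (\<lambda>\<omega>. g (V \<omega>))" and ip: "integrable M (\<lambda>\<omega>. p (V \<omega>))"
    using g(2) P by (intro integrable_const_bound[where B = B] integrable_const_bound[where B = P]; simp)+
  have "expectation (\<lambda>\<omega>. g (V \<omega>)) - expectation (\<lambda>\<omega>. p (V \<omega>)) = expectation (\<lambda>\<omega>. g (V \<omega>) - p (V \<omega>))"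
    using ig ip by simp
  also have "\<bar>\<dots>\<bar> \<le> expectation (\<lambda>\<omega>. \<bar>g (V \<omega>) - p (V \<omega>)\<bar>)"
    by (rule integral_abs_bound)
  also have "\<dots> \<le> expectation (\<lambda>\<omega>. e + c * (norm (V \<omega>))\<^sup>2)"
    using ig ip int err by (intro integral_mono) auto
  also have "\<dots> = e + c * expectation (\<lambda>\<omega>. (norm (V \<omega>))\<^sup>2)"
    using int by (simp add: prob_space)
  also have "\<dots> \<le> e + c * D" using le c by (simp add: mult_left_mono)
  finally show ?thesis .
qed

text \<open>A substitute for the continuity theorem of Levy in several dimensions: the uniform
  second moment bound plays the part of tightness and reduces a general test function to a
  trigonometric polynomial.\<close>

lemma (in prob_space) weak_convergence_from_cosines:
  fixes V :: "nat \<Rightarrow> 'a \<Rightarrow> real^'n" and g :: "real^'n \<Rightarrow> real"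
  assumes [measurable]: "\<And>n. V n \<in> borel_measurable M"
    and int: "\<And>n. integrable M (\<lambda>\<omega>. (norm (V n \<omega>))\<^sup>2)"
    and le: "\<And>n. expectation (\<lambda>\<omega>. (norm (V n \<omega>))\<^sup>2) \<le> D"
    and N: "prob_space N" "sets N = sets borel" "integrable N (\<lambda>v. (norm v)\<^sup>2)" "(\<integral>v. (norm v)\<^sup>2 \<partial>N) \<le> D"
    and cos: "\<And>u b. (\<lambda>n. expectation (\<lambda>\<omega>. cos (u \<bullet> V n \<omega> + b))) \<longlonglongrightarrow> (\<integral>v. cos (u \<bullet> v + b) \<partial>N)"
    and g: "continuous_on UNIV g" "\<And>x. \<bar>g x\<bar> \<le> B"
  shows "(\<lambda>n. expectation (\<lambda>\<omega>. g (V n \<omega>))) \<longlonglongrightarrow> (\<integral>v. g v \<partial>N)"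
proof -
  interpret N: prob_space N by fact
  have [measurable]: "(\<lambda>v. v) \<in> borel_measurable N" using N(2) by (simp add: measurable_ident_sets)
  have trig: "(\<lambda>n. expectation (\<lambda>\<omega>. p (V n \<omega>))) \<longlonglongrightarrow> (\<integral>v. p v \<partial>N)" if "trig_poly p" for p
    using that
  proof (induction rule: trig_poly.induct)
    case (cos u b)
    then show ?case by (rule assms(8))
  next
    case (add p q)
    have "integrable M (\<lambda>\<omega>. p (V n \<omega>))" "integrable N p" if tp: "trig_poly p" for p n
    proof -
      have [measurable]: "p \<in> borel_measurable borel"
        using trig_poly_continuous[OF tp] by (auto intro: borel_measurable_continuous_onI)
      then have [measurable]: "p \<in> borel_measurable N"
        using N(2) by (simp cong: measurable_cong_sets)
      obtain P where P: "\<forall>x. \<bar>p x\<bar> \<le> P" using trig_poly_bounded[OF tp] by metis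
      then show "integrable M (\<lambda>\<omega>. p (V n \<omega>))" "integrable N p"
        by (auto intro!: integrable_const_bound[of _ P] N.integrable_const_bound[of _ P])
    qed
    with add show ?case by (simp add: tendsto_add)
  next
    case (scale p c)
    then show ?case by (simp add: tendsto_mult_left)
  qed
  have D: "D \<ge> 0"
    using order_trans[OF _ N(4), of 0] by simp
  have B: "B \<ge> 0" using g(2)[of 0] by linarith
  show ?thesis
  proof (rule metric_LIMSEQ_I)
    fix \<epsilon> :: real assume "0 < \<epsilon>"
    \<comment> \<open>Replacing \<open>g\<close> by \<open>p\<close> costs
      \<open>e + c * D \<le> 2 * e\<close> on either side, and comparing the expectations of
      \<open>p\<close> costs less than \<open>e\<close>.\<close>
    define e where "e = \<epsilon> / 5"
    have e: "e > 0" using \<open>0 < \<epsilon>\<close> by (simp add: e_def)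
    \<comment> \<open>Chosen so that \<open>c * (D + 1) = e\<close>; the added 1 keeps
      \<open>r\<close> positive when \<open>D = 0\<close>.\<close>
    define r where "r = sqrt ((2 * B + e) * (D + 1) / e)"
    have arg: "(2 * B + e) * (D + 1) / e > 0" using e B D by simp
    then have r: "r > 0" "r\<^sup>2 = (2 * B + e) * (D + 1) / e"
      by (simp_all add: r_def)
    define c where "c = (2 * B + e) / r\<^sup>2"
    have c0: "c \<ge> 0" using B e by (simp add: c_def)
    have "c * D \<le> c * (D + 1)" using c0 by (intro mult_left_mono) auto
    also have "c * (D + 1) = e"
    proof -
      have "2 * B + e \<noteq> 0" "D + 1 \<noteq> 0" using e B D by linarith+
      then show ?thesis unfolding c_def r(2) by simp
    qed
    finally have cD: "c * D \<le> e" .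
    obtain p where p: "trig_poly p" "\<And>x. \<bar>g x - p x\<bar> \<le> e + (2 * B + e) * (norm x)\<^sup>2 / r\<^sup>2"
      using trig_poly_approximation_quadratic[OF g e r(1)] by blast
    have err: "\<bar>g x - p x\<bar> \<le> e + c * (norm x)\<^sup>2" for x using p(2)[of x] by (simp add: c_def)
    have 1: "\<bar>expectation (\<lambda>\<omega>. g (V n \<omega>)) - expectation (\<lambda>\<omega>. p (V n \<omega>))\<bar> \<le> e + c * D" for n
      by (rule trig_poly_expectation_error[OF _ int le g p(1) c0 err]) simp
    have 2: "\<bar>(\<integral>v. g v \<partial>N) - (\<integral>v. p v \<partial>N)\<bar> \<le> e + c * D"
      by (rule N.trig_poly_expectation_error[OF _ N(3,4) g p(1) c0 err]) simp
    obtain n0 where n0: "\<And>n. n \<ge> n0 \<Longrightarrow> \<bar>expectation (\<lambda>\<omega>. p (V n \<omega>)) - (\<integral>v. p v \<partial>N)\<bar> < e"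
      using metric_LIMSEQ_D[OF trig[OF p(1)] e] by (auto simp: dist_real_def)
    show "\<exists>n0. \<forall>n\<ge>n0. dist (expectation (\<lambda>\<omega>. g (V n \<omega>))) (\<integral>v. g v \<partial>N) < \<epsilon>"
    proof (intro exI[of _ n0] allI impI)
      fix n assume "n \<ge> n0"
      from 1[of n] 2 n0[OF this] cD show "dist (expectation (\<lambda>\<omega>. g (V n \<omega>))) (\<integral>v. g v \<partial>N) < \<epsilon>"
        unfolding dist_real_def e_def by linarith
    qed
  qed
qed

text \<open>The one-dimensional central limit theorem handles every projection.\<close>

theorem (in prob_space) central_limit_theorem_vec:
  fixes X :: "nat \<Rightarrow> 'a \<Rightarrow> real^'n" and g :: "real^'n \<Rightarrow> real"
  assumes indep: "indep_vars (\<lambda>_. borel) X UNIV"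
    and distr: "\<And>i. distr M borel (X i) = distr M borel (X 0)"
    and sq: "integrable M (\<lambda>\<omega>. (norm (X 0 \<omega>))\<^sup>2)"
    and mean: "\<And>u. expectation (\<lambda>\<omega>. u \<bullet> X 0 \<omega>) = 0"
    and cov: "\<And>u. expectation (\<lambda>\<omega>. (u \<bullet> X 0 \<omega>)\<^sup>2) = (norm u)\<^sup>2"
  defines "V n \<omega> \<equiv> (1 / sqrt (real n)) *\<^sub>R (\<Sum>i<n. X i \<omega>)"
  shows "integrable M (\<lambda>\<omega>. (norm (V n \<omega>))\<^sup>2)"
    and "expectation (\<lambda>\<omega>. (norm (V n \<omega>))\<^sup>2) \<le> CARD('n)"
    and "continuous_on UNIV g \<Longrightarrow> (\<And>x. \<bar>g x\<bar> \<le> B) \<Longrightarrow>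
      (\<lambda>n. expectation (\<lambda>\<omega>. g (V n \<omega>))) \<longlonglongrightarrow> (\<integral>v. g v \<partial>std_normal_vec)"
proof -
  have X [measurable]: "X i \<in> borel_measurable M" for i
    using indep by (auto simp: indep_vars_def2)
  have [measurable]: "V n \<in> borel_measurable M" for n unfolding V_def by measurable
  have transfer: "integrable M (\<lambda>\<omega>. f (X i \<omega>)) \<longleftrightarrow> integrable M (\<lambda>\<omega>. f (X 0 \<omega>))"
      "expectation (\<lambda>\<omega>. f (X i \<omega>)) = expectation (\<lambda>\<omega>. f (X 0 \<omega>))"
    if "f \<in> borel_measurable borel" for f :: "real^'n \<Rightarrow> real" and i
    using that distr[of i] integrable_distr_eq[OF X[of i], of f] integrable_distr_eq[OF X[of 0], of f]
      integral_distr[OF X[of i], of f] integral_distr[OF X[of 0], of f] by auto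
  have sq_u: "integrable M (\<lambda>\<omega>. (u \<bullet> X i \<omega>)\<^sup>2)" for u i
  proof -
    have "integrable M (\<lambda>\<omega>. (u \<bullet> X 0 \<omega>)\<^sup>2)"
    proof (rule Bochner_Integration.integrable_bound)
      show "integrable M (\<lambda>\<omega>. (norm u)\<^sup>2 * (norm (X 0 \<omega>))\<^sup>2)" using sq by simp
      have "(u \<bullet> X 0 \<omega>)\<^sup>2 \<le> (norm u)\<^sup>2 * (norm (X 0 \<omega>))\<^sup>2" for \<omega>
        using Cauchy_Schwarz_ineq[of u "X 0 \<omega>"] by (simp add: power2_norm_eq_inner)
      then show "AE \<omega> in M. norm ((u \<bullet> X 0 \<omega>)\<^sup>2) \<le> norm ((norm u)\<^sup>2 * (norm (X 0 \<omega>))\<^sup>2)" by simp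
    qed simp
    then show ?thesis using transfer(1)[of "\<lambda>x. (u \<bullet> x)\<^sup>2" i] by simp
  qed
  have int_u: "integrable M (\<lambda>\<omega>. u \<bullet> X i \<omega>)" for u i
    by (rule square_integrable_imp_integrable[OF _ sq_u]) simp
  have mean_u: "expectation (\<lambda>\<omega>. u \<bullet> X i \<omega>) = 0" for u i
    using transfer(2)[of "\<lambda>x. u \<bullet> x" i] mean by simp
  have cov_u: "expectation (\<lambda>\<omega>. (u \<bullet> X i \<omega>)\<^sup>2) = (norm u)\<^sup>2" for u i
    using transfer(2)[of "\<lambda>x. (u \<bullet> x)\<^sup>2" i] cov by simp
  have indep_u: "indep_vars (\<lambda>_. borel) (\<lambda>i \<omega>. u \<bullet> X i \<omega>) UNIV" for u
    by (rule indep_vars_compose2[OF indep]) simp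
  have cross: "integrable M (\<lambda>\<omega>. (u \<bullet> X i \<omega>) * (u \<bullet> X j \<omega>))"
    "expectation (\<lambda>\<omega>. (u \<bullet> X i \<omega>) * (u \<bullet> X j \<omega>)) = (if i = j then (norm u)\<^sup>2 else 0)" for u i j
  proof -
    have ind: "indep_var borel (\<lambda>\<omega>. u \<bullet> X i \<omega>) borel (\<lambda>\<omega>. u \<bullet> X j \<omega>)" if "i \<noteq> j"
      using indep_vars_imp_indep_var[OF indep_u that] by simp
    show "integrable M (\<lambda>\<omega>. (u \<bullet> X i \<omega>) * (u \<bullet> X j \<omega>))"
      using indep_var_integrable[OF ind] int_u sq_u[of u i] by (cases "i = j") (auto simp: power2_eq_square)
    show "expectation (\<lambda>\<omega>. (u \<bullet> X i \<omega>) * (u \<bullet> X j \<omega>)) = (if i = j then (norm u)\<^sup>2 else 0)"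
      using indep_var_lebesgue_integral[OF ind] int_u mean_u cov_u[of u i]
      by (cases "i = j") (auto simp: power2_eq_square)
  qed
  have sum_sq: "integrable M (\<lambda>\<omega>. (u \<bullet> (\<Sum>i<n. X i \<omega>))\<^sup>2)"
    "expectation (\<lambda>\<omega>. (u \<bullet> (\<Sum>i<n. X i \<omega>))\<^sup>2) = n * (norm u)\<^sup>2" for u n
  proof -
    have eq: "(u \<bullet> (\<Sum>i<n. X i \<omega>))\<^sup>2 = (\<Sum>i<n. \<Sum>j<n. (u \<bullet> X i \<omega>) * (u \<bullet> X j \<omega>))" for \<omega>
      by (simp add: inner_sum_right power2_eq_square sum_product)
    show "integrable M (\<lambda>\<omega>. (u \<bullet> (\<Sum>i<n. X i \<omega>))\<^sup>2)"
      unfolding eq by (intro Bochner_Integration.integrable_sum cross)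
    have "expectation (\<lambda>\<omega>. (u \<bullet> (\<Sum>i<n. X i \<omega>))\<^sup>2) = (\<Sum>i<n. \<Sum>j<n. if i = j then (norm u)\<^sup>2 else 0)"
      unfolding eq by (simp add: Bochner_Integration.integral_sum cross Bochner_Integration.integrable_sum)
    then show "expectation (\<lambda>\<omega>. (u \<bullet> (\<Sum>i<n. X i \<omega>))\<^sup>2) = n * (norm u)\<^sup>2" by simp
  qed
  have norm_V: "(norm (V n \<omega>))\<^sup>2 = (\<Sum>k\<in>UNIV. (1 / n) * ((axis k 1) \<bullet> (\<Sum>i<n. X i \<omega>))\<^sup>2)" for n \<omega>
    unfolding norm_vec_sq V_def by (simp add: inner_axis' power_mult_distrib power_divide)
  show int_V: "integrable M (\<lambda>\<omega>. (norm (V n \<omega>))\<^sup>2)" for n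
    unfolding norm_V by (intro Bochner_Integration.integrable_sum integrable_mult_right sum_sq)
  show le_V: "expectation (\<lambda>\<omega>. (norm (V n \<omega>))\<^sup>2) \<le> CARD('n)" for n
  proof -
    have "expectation (\<lambda>\<omega>. (norm (V n \<omega>))\<^sup>2) = (\<Sum>k\<in>(UNIV::'n set). (1 / n) * (n * (norm (axis k 1 :: real^'n))\<^sup>2))"
      unfolding norm_V by (subst Bochner_Integration.integral_sum) (auto intro: sum_sq simp: sum_sq)
    \<comment> \<open>Equality fails only at \<open>n = 0\<close>, where \<open>1 / 0 = 0\<close>
      makes \<open>V 0\<close> vanish.\<close>
    also have "\<dots> \<le> (\<Sum>k\<in>(UNIV::'n set). 1)"
      by (intro sum_mono) simp
    finally show ?thesis by simp
  qed
  assume g: "continuous_on UNIV g" "\<And>x. \<bar>g x\<bar> \<le> B"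
  show "(\<lambda>n. expectation (\<lambda>\<omega>. g (V n \<omega>))) \<longlonglongrightarrow> (\<integral>v. g v \<partial>std_normal_vec)"
  proof (rule weak_convergence_from_cosines[OF _ int_V le_V prob_space_std_normal_vec _ std_normal_vec_norm_sq(1) _ _ g])
    fix u :: "real^'n" and b :: real
    have N: "(\<integral>v. cos (u \<bullet> v + b) \<partial>std_normal_vec) = (\<integral>z. cos (norm u * z + b) \<partial>std_normal_distribution)"
    proof -
      have "(\<integral>v. cos (u \<bullet> v + b) \<partial>std_normal_vec) = (\<integral>y. cos (y + b) \<partial>distr std_normal_vec borel (\<lambda>v. u \<bullet> v))"
        by (subst integral_distr) auto
      also have "\<dots> = (\<integral>z. cos (norm u * z + b) \<partial>std_normal_distribution)"
        unfolding distr_std_normal_vec_inner by (subst integral_distr) auto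
      finally show ?thesis .
    qed
    show "(\<lambda>n. expectation (\<lambda>\<omega>. cos (u \<bullet> V n \<omega> + b))) \<longlonglongrightarrow> (\<integral>v. cos (u \<bullet> v + b) \<partial>std_normal_vec)"
    \<comment> \<open>The one-dimensional theorem requires positive variance; for
      \<open>u = 0\<close> both sides are the constant \<open>cos b\<close>.\<close>
    proof (cases "u = 0")
      case True
      have "measure (std_normal_vec :: (real^'n) measure) UNIV = 1"
        using std_normal_vec.prob_space by simp
      with True show ?thesis by (simp add: prob_space)
    next
      case False
      let ?S = "\<lambda>n \<omega>. (\<Sum>i<n. u \<bullet> X i \<omega>) / sqrt (n * (norm u)\<^sup>2)"
      have S: "?S n \<in> borel_measurable M" for n by measurable
      have "distr M borel (\<lambda>\<omega>. u \<bullet> X i \<omega>) = distr M borel (\<lambda>\<omega>. u \<bullet> X 0 \<omega>)" for i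
        using distr_distr[of "(\<bullet>) u" borel borel "X i" M] distr_distr[of "(\<bullet>) u" borel borel "X 0" M] distr[of i]
        by (simp add: comp_def)
      then have weak: "weak_conv_m (\<lambda>n. distr M borel (?S n)) std_normal_distribution"
        using False indep_u mean_u sq_u cov_u
        by (intro central_limit_theorem_zero_mean[where \<mu> = "distr M borel (\<lambda>\<omega>. u \<bullet> X 0 \<omega>)"]) auto
      have "(\<lambda>n. \<integral>y. cos (norm u * y + b) \<partial>distr M borel (?S n)) \<longlonglongrightarrow> (\<integral>z. cos (norm u * z + b) \<partial>std_normal_distribution)"
        using real_distribution_distr[OF S] real_dist_normal_dist weak
        by (rule weak_conv_imp_integral_bdd_continuous_conv[where B = 1]) auto
      moreover have "(\<integral>y. cos (norm u * y + b) \<partial>distr M borel (?S n)) = expectation (\<lambda>\<omega>. cos (u \<bullet> V n \<omega> + b))" for n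
      proof -
        have "norm u * ?S n \<omega> = u \<bullet> V n \<omega>" for \<omega>
          using False by (simp add: V_def inner_sum_right real_sqrt_mult)
        then show ?thesis using S[of n] by (subst integral_distr) auto
      qed
      ultimately show ?thesis unfolding N by simp
    qed
  qed (auto simp: std_normal_vec_norm_sq)
qed

section \<open>Zeros of perturbed normal maps\<close>

text \<open>The mean value inequality for \<open>g - A\<close> on the ball around \<open>x0\<close>
  through \<open>y\<close>, where its derivative is at most \<open>l * norm (y - x0)\<close>. It is
  applied to whole sample averages and to single sample functions.\<close>

lemma linearization_error:
  fixes g A :: "'a::euclidean_space \<Rightarrow> 'b::euclidean_space"
  assumes diff: "\<And>v. v \<in> ball x0 \<delta> \<Longrightarrow> g differentiable (at v)" and A: "linear A" and "0 \<le> l"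
    and bound: "\<And>v h. v \<in> ball x0 \<delta> \<Longrightarrow>
      norm (frechet_derivative g (at v) h - A h) \<le> l * norm (v - x0) * norm h"
    and y: "y \<in> ball x0 \<delta>"
  shows "norm (g y - g x0 - A (y - x0)) \<le> l * (norm (y - x0))\<^sup>2"
proof -
  let ?r = "norm (y - x0)"
  have sub: "cball x0 ?r \<subseteq> ball x0 \<delta>" using y by (auto simp: dist_norm norm_minus_commute)
  have A': "bounded_linear A" using A linear_conv_bounded_linear by blast
  have "norm ((g y - A y) - (g x0 - A x0)) \<le> l * ?r * norm (y - x0)"
  proof (rule differentiable_bound)
    show "convex (cball x0 ?r)" by (rule convex_cball)
    show "x0 \<in> cball x0 ?r" "y \<in> cball x0 ?r" by (auto simp: dist_norm norm_minus_commute)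
    fix v assume v: "v \<in> cball x0 ?r"
    then have vb: "v \<in> ball x0 \<delta>" using sub by blast
    have "(g has_derivative frechet_derivative g (at v)) (at v)"
      using diff[OF vb] frechet_derivative_works by blast
    then show "((\<lambda>v. g v - A v) has_derivative (\<lambda>h. frechet_derivative g (at v) h - A h)) (at v within cball x0 ?r)"
      using bounded_linear.has_derivative[OF A' has_derivative_ident]
      by (intro has_derivative_diff) (auto intro: has_derivative_at_withinI)
    show "onorm (\<lambda>h. frechet_derivative g (at v) h - A h) \<le> l * ?r"
    proof (rule onorm_bound)
      show "0 \<le> l * ?r" using \<open>0 \<le> l\<close> by simp
      fix h
      have "norm (frechet_derivative g (at v) h - A h) \<le> l * norm (v - x0) * norm h"
        using bound vb by blast
      also have "\<dots> \<le> l * ?r * norm h"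
        using v \<open>0 \<le> l\<close> by (intro mult_right_mono mult_left_mono) (auto simp: dist_norm norm_minus_commute)
      finally show "norm (frechet_derivative g (at v) h - A h) \<le> l * ?r * norm h" .
    qed
  qed
  then show ?thesis
    by (simp add: linear_diff[OF A] algebra_simps power2_eq_square)
qed

text \<open>The situation along one sample path, free of randomness: \<open>y0\<close> is the limit
  of the values at \<open>x0\<close>, \<open>J n\<close> the sample Jacobian there,
  \<open>\<kappa> n\<close> a bound on its distance to \<open>L\<close>, and \<open>l\<close> an
  eventual Lipschitz bound for the derivatives.\<close>

locale normal_map_approximation = critical_cone S z0 x0 K
  for S :: "'a::euclidean_space set" and z0 x0 K +
  fixes y0 :: 'a and L LK LK' :: "'a \<Rightarrow> 'a" and f :: "nat \<Rightarrow> 'a \<Rightarrow> 'a" and J :: "nat \<Rightarrow> 'a \<Rightarrow> 'a"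
    and \<kappa> :: "nat \<Rightarrow> real" and l \<delta> :: real
  assumes z0: "z0 = x0 - y0"
    and L: "linear L" and LK: "\<And>h. LK h = L (closest_point K h) + h - closest_point K h"
    and LK': "homeomorphism UNIV UNIV LK LK'"
    and \<delta>: "\<delta> > 0"
    and diff: "\<And>n y. y \<in> ball x0 \<delta> \<Longrightarrow> f n differentiable (at y)"
    and J: "\<And>n. linear (J n)"
    and deriv_bound: "\<forall>\<^sub>F n in sequentially. \<forall>y\<in>ball x0 \<delta>. \<forall>h.
        norm (frechet_derivative (f n) (at y) h - J n h) \<le> l * norm (y - x0) * norm h"
    and \<kappa>: "\<And>n h. norm (J n h - L h) \<le> \<kappa> n * norm h" "\<kappa> \<longlonglongrightarrow> 0"
    and f_lim: "(\<lambda>n. f n x0) \<longlonglongrightarrow> y0"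
begin

definition remainder :: "nat \<Rightarrow> 'a \<Rightarrow> 'a" where
  "remainder n y = f n y - f n x0 - L (y - x0)"

definition good :: "nat \<Rightarrow> bool" where
  "good n \<longleftrightarrow> (\<forall>y\<in>ball x0 \<delta>. \<forall>h.
     norm (frechet_derivative (f n) (at y) h - J n h) \<le> l * norm (y - x0) * norm h)"

lemma eventually_good: "\<forall>\<^sub>F n in sequentially. good n"
  using deriv_bound by (simp add: good_def)

lemma \<kappa>_nonneg: "0 \<le> \<kappa> n"
proof -
  obtain b :: 'a where "b \<in> Basis" using nonempty_Basis by blast
  then show ?thesis using order_trans[OF norm_ge_zero \<kappa>(1)[of n b]] by simp
qed

lemma l_nonneg: "0 \<le> l"
proof -
  obtain n where n: "good n"
    using eventually_good eventually_happens'[OF sequentially_bot] by blast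
  obtain b :: 'a where b: "b \<in> Basis" using nonempty_Basis by blast
  have "x0 + (\<delta> / 2) *\<^sub>R b \<in> ball x0 \<delta>" using b \<delta> by (simp add: dist_norm)
  with n have "norm (frechet_derivative (f n) (at (x0 + (\<delta> / 2) *\<^sub>R b)) b - J n b)
      \<le> l * norm (x0 + (\<delta> / 2) *\<^sub>R b - x0) * norm b"
    unfolding good_def by blast
  then have "0 \<le> l * norm (x0 + (\<delta> / 2) *\<^sub>R b - x0) * norm b"
    using norm_ge_zero order_trans by blast
  with b \<delta> show ?thesis by (simp add: zero_le_mult_iff)
qed

text \<open>The remainder is taken with respect to the limit map \<open>L\<close>, so it splits into
  the quadratic error of linearising by \<open>J n\<close> and the error \<open>\<kappa> n\<close>
  of replacing \<open>J n\<close> by \<open>L\<close>.\<close>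

lemma norm_remainder_le:
  assumes "good n" "y \<in> ball x0 \<delta>"
  shows "norm (remainder n y) \<le> (\<kappa> n + l * norm (y - x0)) * norm (y - x0)"
proof -
  let ?r = "norm (y - x0)"
  have "norm (f n y - f n x0 - J n (y - x0)) \<le> l * ?r\<^sup>2"
    using assms diff J l_nonneg unfolding good_def by (intro linearization_error[where \<delta> = \<delta>]) auto
  moreover have "remainder n y = (f n y - f n x0 - J n (y - x0)) + (J n (y - x0) - L (y - x0))"
    by (simp add: remainder_def)
  ultimately have "norm (remainder n y) \<le> l * ?r\<^sup>2 + \<kappa> n * ?r"
    using \<kappa>(1)[of n "y - x0"] norm_triangle_mono by metis
  then show ?thesis by (simp add: algebra_simps power2_eq_square)
qed

lemma LK_inverse: "LK' (LK h) = h" "LK (LK' y) = y"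
  using LK' by (auto simp: homeomorphism_def)

lemma LK'_scaleR: "t \<ge> 0 \<Longrightarrow> LK' (t *\<^sub>R y) = t *\<^sub>R LK' y"
proof -
  assume "t \<ge> 0"
  then have "LK (t *\<^sub>R LK' y) = t *\<^sub>R LK (LK' y)"
    by (simp add: LK closest_K_scaleR linear_scale[OF L] scaleR_add_right scaleR_diff_right)
  then have "LK (t *\<^sub>R LK' y) = t *\<^sub>R y" by (simp add: LK_inverse)
  then show ?thesis using LK_inverse(1) by metis
qed

text \<open>The inverse inherits positive homogeneity from \<open>LK\<close>, so its bound on the
  compact unit sphere extends to a linear bound everywhere.\<close>

lemma LK'_bound:
  obtains c where "c > 0" "\<And>y. norm (LK' y) \<le> c * norm y"
proof -
  have "continuous_on (sphere 0 1) LK'"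
    using LK' continuous_on_subset by (auto simp: homeomorphism_def)
  then have "bounded (LK' ` sphere 0 1)"
    by (intro compact_imp_bounded compact_continuous_image) auto
  then obtain c where c: "c > 0" "\<And>y. norm y = 1 \<Longrightarrow> norm (LK' y) \<le> c"
    by (auto simp: bounded_pos)
  have "norm (LK' y) \<le> c * norm y" for y
  proof (cases "y = 0")
    case True
    then show ?thesis using LK'_scaleR[of 0 0] by simp
  next
    case False
    then have "LK' y = norm y *\<^sub>R LK' ((1 / norm y) *\<^sub>R y)"
      by (subst LK'_scaleR[symmetric]) auto
    then have "norm (LK' y) = norm y * norm (LK' ((1 / norm y) *\<^sub>R y))"
      by (metis abs_norm_cancel norm_scaleR)
    also have "\<dots> \<le> norm y * c"
      using False by (intro mult_left_mono c) auto
    finally show ?thesis by (simp add: mult.commute)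
  qed
  with c(1) show thesis by (rule that)
qed

lemma normal_map_eq:
  assumes "closest_point S (z0 + h) = x0 + closest_point K h"
  shows "normal_map (f n) S (z0 + h) = (f n x0 - y0) + remainder n (x0 + closest_point K h) + LK h"
  unfolding normal_map_def assms remainder_def LK by (simp add: z0)

text \<open>By Brouwer's theorem, \<open>h \<mapsto> LK' (- (f n x0 - y0) - remainder n (x0 + \<Pi>\<^sub>K h))\<close> has a fixed point in a
  small ball; its fixed points are the zeros of the normal map.\<close>

lemma solutions_converge:
  assumes Z: "z0 \<in> interior Z" and U: "open U" "x0 \<in> U"
    and sol: "\<forall>\<^sub>F n in sequentially. {y \<in> Z. closest_point S y \<in> U \<and> normal_map (f n) S y = 0} = {z n}"
  shows "z \<longlonglongrightarrow> z0"
    and "\<exists>\<epsilon>. \<epsilon> \<longlonglongrightarrow> 0 \<and> (\<forall>\<^sub>F n in sequentially.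
      norm (normal_map_deriv (f n) S (z n) (z0 - z n) - (f n x0 - y0)) \<le> \<epsilon> n * norm (f n x0 - y0))"
proof -
  obtain c where c: "c > 0" "\<And>y. norm (LK' y) \<le> c * norm y" using LK'_bound by blast
  obtain e0 where e0: "e0 > 0" "\<And>h. norm h \<le> e0 \<Longrightarrow> closest_point S (z0 + h) = x0 + closest_point K h"
    "\<And>h. norm h \<le> e0 \<Longrightarrow> B_derivative (closest_point S) (z0 + h) (- h) = - closest_point K h"
    using B_derivative_closest_point_backwards by blast
  obtain eZ where eZ: "eZ > 0" "ball z0 eZ \<subseteq> Z" using Z by (auto simp: mem_interior)
  obtain eU where eU: "eU > 0" "ball x0 eU \<subseteq> U" using U by (auto simp: open_contains_ball)
  \<comment> \<open>Small enough for the local formula of the projection, for staying inside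
    \<open>Z\<close>, \<open>U\<close> and the ball of differentiability, and for
    \<open>c * l * e1 \<le> 1 / 4\<close>.\<close>
  define e1 where "e1 = Min {e0, eZ / 2, eU / 2, \<delta> / 2, 1 / (4 * c * (l + 1))}"
  have l1: "l + 1 > 0" using l_nonneg by simp
  then have e1: "e1 > 0" "e1 \<le> e0" "e1 < eZ" "e1 < eU" "e1 < \<delta>" and e1c: "e1 \<le> 1 / (4 * c * (l + 1))"
    using e0 eZ eU \<delta> c by (auto simp: e1_def)
  have cl: "c * (l * e) \<le> 1 / 4" if "0 \<le> e" "e \<le> e1" for e
  proof -
    have "c * (l * e) \<le> c * ((l + 1) * e1)" using that c l_nonneg by (intro mult_left_mono mult_mono) auto
    also have "\<dots> \<le> c * ((l + 1) * (1 / (4 * c * (l + 1))))"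
      using c l1 e1c by (intro mult_left_mono) auto
    also have "\<dots> = 1 / 4" using c l1 by simp
    finally show ?thesis .
  qed
  have ev\<kappa>: "\<forall>\<^sub>F n in sequentially. c * \<kappa> n \<le> 1 / 4"
  proof -
    have "(\<lambda>n. c * \<kappa> n) \<longlonglongrightarrow> c * 0" by (intro tendsto_intros \<kappa>)
    then have "\<forall>\<^sub>F n in sequentially. c * \<kappa> n < 1 / 4" by (rule order_tendstoD) simp
    then show ?thesis by eventually_elim simp
  qed
  \<comment> \<open>A quarter each from \<open>\<kappa> n\<close> and from the Lipschitz term. The
    factor one half gives both the self-map property for Brouwer's theorem and the absorption of the
    norm of \<open>h\<close> in the rate.\<close>
  have small: "c * (\<kappa> n + l * norm w) \<le> 1 / 2" if "c * \<kappa> n \<le> 1 / 4" "norm w \<le> e1" for n and w :: 'a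
    using cl[of "norm w"] that by (simp add: distrib_left)
  have a_lim: "(\<lambda>n. norm (f n x0 - y0)) \<longlonglongrightarrow> 0"
    using f_lim by (simp add: LIM_zero_iff tendsto_norm_zero_iff)
  have near: "\<forall>\<^sub>F n in sequentially. norm (z n - z0) \<le> e" if e: "0 < e" "e \<le> e1" for e
  proof -
    have "(\<lambda>n. c * norm (f n x0 - y0)) \<longlonglongrightarrow> c * 0" by (intro tendsto_intros a_lim)
    then have "\<forall>\<^sub>F n in sequentially. c * norm (f n x0 - y0) < e / 2" by (rule order_tendstoD) (use e in auto)
    then show ?thesis
      using sol eventually_good ev\<kappa>
    proof eventually_elim
      case (elim n)
      let ?\<phi> = "\<lambda>h. LK' (- ((f n x0 - y0) + remainder n (x0 + closest_point K h)))"
      have ball: "x0 + closest_point K h \<in> ball x0 \<delta>" if "norm h \<le> e" for h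
        using norm_closest_K[of h] that e e1 by (simp add: dist_norm)
      have "\<exists>h\<in>cball 0 e. ?\<phi> h = h"
      proof (rule brouwer)
        show "compact (cball (0::'a) e)" "convex (cball (0::'a) e)" "cball (0::'a) e \<noteq> {}"
          using e by auto
        have contK: "continuous_on (cball 0 e) (closest_point K)"
          using closed_K convex_K zero_in_K by (intro continuous_on_closest_point) auto
        have contf: "continuous_on (ball x0 \<delta>) (f n)"
          using diff by (simp add: continuous_on_eq_continuous_at differentiable_imp_continuous_within)
        have "continuous_on (cball 0 e) (\<lambda>h. f n (x0 + closest_point K h))"
          using ball by (intro continuous_on_compose2[OF contf] continuous_intros contK) auto
        moreover have "continuous_on (cball 0 e) (\<lambda>h. L (closest_point K h))"
          using L linear_continuous_on[of L UNIV] continuous_on_compose2[of UNIV L "cball 0 e", OF _ contK]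
          by (simp add: linear_conv_bounded_linear)
        ultimately have "continuous_on (cball 0 e) (\<lambda>h. - ((f n x0 - y0) + remainder n (x0 + closest_point K h)))"
          unfolding remainder_def by (auto intro!: continuous_intros)
        moreover have "continuous_on UNIV LK'" using LK' by (auto simp: homeomorphism_def)
        ultimately show "continuous_on (cball 0 e) ?\<phi>"
          using continuous_on_compose2[of UNIV LK'] by blast
        show "?\<phi> \<in> cball 0 e \<rightarrow> cball 0 e"
        proof
          fix h :: 'a assume "h \<in> cball 0 e"
          then have h: "norm h \<le> e" by simp
          let ?w = "closest_point K h"
          have w: "norm ?w \<le> e" using norm_closest_K[of h] h by linarith
          have "norm (?\<phi> h) \<le> c * norm ((f n x0 - y0) + remainder n (x0 + ?w))"
            using c(2) by (metis norm_minus_cancel)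
          also have "\<dots> \<le> c * (norm (f n x0 - y0) + (\<kappa> n + l * norm ?w) * norm ?w)"
            using norm_remainder_le[OF elim(3) ball[OF h]] c(1)
            by (intro mult_left_mono norm_triangle_mono) auto
          also have "\<dots> = c * norm (f n x0 - y0) + c * (\<kappa> n + l * norm ?w) * norm ?w"
            by (simp add: algebra_simps)
          also have "\<dots> \<le> e / 2 + 1 / 2 * e"
            using elim(1) small[OF elim(4), of ?w] w e by (intro add_mono mult_mono) auto
          finally show "?\<phi> h \<in> cball 0 e" by simp
        qed
      qed blast
      then obtain h where h: "norm h \<le> e" "?\<phi> h = h" by auto
      have "LK h = - ((f n x0 - y0) + remainder n (x0 + closest_point K h))"
        using h(2) LK_inverse(2) by metis
      moreover have Ph: "closest_point S (z0 + h) = x0 + closest_point K h"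
        using h e e1 by (intro e0) auto
      ultimately have "normal_map (f n) S (z0 + h) = 0"
        by (simp add: normal_map_eq)
      moreover have "z0 + h \<in> Z" using h e e1 eZ by (auto simp: dist_norm)
      moreover have "closest_point S (z0 + h) \<in> U"
        unfolding Ph using norm_closest_K[of h] h e e1 eU by (auto simp: dist_norm)
      ultimately have "z0 + h \<in> {y \<in> Z. closest_point S y \<in> U \<and> normal_map (f n) S y = 0}" by simp
      then have "z n = z0 + h" unfolding elim(2) by simp
      then show "norm (z n - z0) \<le> e" using h by simp
    qed
  qed
  show lim: "z \<longlonglongrightarrow> z0"
    unfolding tendsto_iff dist_norm
  proof (intro allI impI)
    fix e :: real assume "e > 0"
    then have "\<forall>\<^sub>F n in sequentially. norm (z n - z0) \<le> min e1 (e / 2)"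
      using e1 by (intro near) auto
    then show "\<forall>\<^sub>F n in sequentially. norm (z n - z0) < e"
      by eventually_elim (use \<open>e > 0\<close> in auto)
  qed
  \<comment> \<open>The factor \<open>4 * c\<close> is 2, from collecting the three error terms
    below, times \<open>2 * c\<close>, from the rate at which \<open>z n\<close> approaches
    \<open>z0\<close>.\<close>
  define \<epsilon> where "\<epsilon> n = 4 * c * (\<kappa> n + l * norm (z n - z0))" for n
  have "(\<lambda>n. norm (z n - z0)) \<longlonglongrightarrow> 0"
    using lim by (simp add: LIM_zero_iff tendsto_norm_zero_iff)
  then have "\<epsilon> \<longlonglongrightarrow> 4 * c * (0 + l * 0)"
    unfolding \<epsilon>_def by (intro tendsto_intros \<kappa>)
  moreover have "\<forall>\<^sub>F n in sequentially.
      norm (normal_map_deriv (f n) S (z n) (z0 - z n) - (f n x0 - y0)) \<le> \<epsilon> n * norm (f n x0 - y0)"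
    using near[OF e1(1) order_refl] sol eventually_good ev\<kappa>
  proof eventually_elim
    case (elim n)
    define h where "h = z n - z0"
    define w where "w = closest_point K h"
    have zn: "z n = z0 + h" and h: "norm h \<le> e1" using elim(1) by (simp_all add: h_def)
    have w: "norm w \<le> norm h" unfolding w_def by (rule norm_closest_K)
    have Ph: "closest_point S (z n) = x0 + w"
      unfolding zn w_def using h e1 by (intro e0) auto
    have ball: "x0 + w \<in> ball x0 \<delta>" using w h e1 by (simp add: dist_norm)
    have "normal_map (f n) S (z n) = 0" using elim(2) by blast
    then have zero: "(f n x0 - y0) + remainder n (x0 + w) + LK h = 0"
      using Ph normal_map_eq[of h n] by (simp add: zn w_def)
    have rem: "norm (remainder n (x0 + w)) \<le> (\<kappa> n + l * norm h) * norm h"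
    proof -
      have "norm (remainder n (x0 + w)) \<le> (\<kappa> n + l * norm w) * norm w"
        using norm_remainder_le[OF elim(3) ball] by simp
      also have "\<dots> \<le> (\<kappa> n + l * norm h) * norm h"
        using w \<kappa>_nonneg l_nonneg by (intro mult_mono add_mono mult_left_mono) auto
      finally show ?thesis .
    qed
    have "h = LK' (- ((f n x0 - y0) + remainder n (x0 + w)))"
      using zero LK_inverse(1)[of h] by (metis add_eq_0_iff minus_minus)
    then have "norm h \<le> c * norm ((f n x0 - y0) + remainder n (x0 + w))"
      using c(2) by (metis norm_minus_cancel)
    also have "\<dots> \<le> c * (norm (f n x0 - y0) + (\<kappa> n + l * norm h) * norm h)"
      using rem c(1) by (intro mult_left_mono norm_triangle_mono) auto
    also have "\<dots> = c * norm (f n x0 - y0) + c * (\<kappa> n + l * norm h) * norm h"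
      by (simp add: algebra_simps)
    also have "\<dots> \<le> c * norm (f n x0 - y0) + 1 / 2 * norm h"
      using small[OF elim(4) h] by (intro add_left_mono mult_right_mono) auto
    finally have rate: "norm h \<le> 2 * c * norm (f n x0 - y0)" by simp
    let ?D = "frechet_derivative (f n) (at (x0 + w))"
    have linD: "linear ?D" using diff[OF ball] by (rule linear_frechet_derivative)
    have Bh: "B_derivative (closest_point S) (z n) (z0 - z n) = - w"
      using e0(3)[of h] h e1 by (simp add: zn w_def)
    \<comment> \<open>The derivative in the backward direction is \<open>- LK h\<close> up to
      exchanging the derivative at \<open>x0 + w\<close> for \<open>J n\<close> and
      \<open>J n\<close> for \<open>L\<close>; the equation solved by \<open>z n\<close> then trades
      \<open>- LK h\<close> for the fluctuation plus the remainder.\<close>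
    have "normal_map_deriv (f n) S (z n) (z0 - z n) = - ?D w - h + w"
      unfolding normal_map_deriv_def Ph Bh by (simp add: linear_neg[OF linD] h_def)
    also have "\<dots> = - LK h - (?D w - J n w) - (J n w - L w)"
      by (simp add: LK w_def)
    also have "\<dots> = (f n x0 - y0) + (remainder n (x0 + w) - (?D w - J n w) - (J n w - L w))"
      using zero by (simp add: add_eq_0_iff algebra_simps)
    finally have "norm (normal_map_deriv (f n) S (z n) (z0 - z n) - (f n x0 - y0))
        \<le> norm (remainder n (x0 + w)) + norm (?D w - J n w) + norm (J n w - L w)"
      using norm_triangle_ineq4[of "remainder n (x0 + w) - (?D w - J n w)" "J n w - L w"]
        norm_triangle_ineq4[of "remainder n (x0 + w)" "?D w - J n w"] by simp
    also have "\<dots> \<le> (\<kappa> n + l * norm h) * norm h + l * norm h * norm h + \<kappa> n * norm h"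
    proof (intro add_mono rem)
      have "norm (?D w - J n w) \<le> l * norm (x0 + w - x0) * norm w"
        using elim(3) ball unfolding good_def by blast
      also have "\<dots> \<le> l * norm h * norm h"
        using w l_nonneg by (intro mult_mono mult_left_mono) auto
      finally show "norm (?D w - J n w) \<le> l * norm h * norm h" .
      show "norm (J n w - L w) \<le> \<kappa> n * norm h"
        using \<kappa>(1)[of n w] w \<kappa>_nonneg[of n] by (meson mult_left_mono order_trans)
    qed
    also have "\<dots> = 2 * (\<kappa> n + l * norm h) * norm h" by (simp add: algebra_simps)
    also have "\<dots> \<le> 2 * (\<kappa> n + l * norm h) * (2 * c * norm (f n x0 - y0))"
      using \<kappa>_nonneg l_nonneg by (intro mult_left_mono rate) auto
    also have "\<dots> = \<epsilon> n * norm (f n x0 - y0)" by (simp add: \<epsilon>_def h_def algebra_simps)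
    finally show ?case .
  qed
  ultimately show "\<exists>\<epsilon>. \<epsilon> \<longlonglongrightarrow> 0 \<and> (\<forall>\<^sub>F n in sequentially.
      norm (normal_map_deriv (f n) S (z n) (z0 - z n) - (f n x0 - y0)) \<le> \<epsilon> n * norm (f n x0 - y0))"
    by (intro exI[of _ \<epsilon>]) simp
qed

end

section \<open>Sample covariances and Slutsky's theorem\<close>

lemma norm_matrix_vector_mult_le:
  fixes A :: "real^'n^'m"
  shows "norm (A *v x) \<le> norm A * norm x"
proof -
  have "norm (A *v x) = L2_set (\<lambda>i. norm ((A *v x) $ i)) UNIV" by (simp add: norm_vec_def)
  also have "\<dots> \<le> L2_set (\<lambda>i. norm x * norm (A $ i)) UNIV"
  proof (rule L2_set_mono)
    fix i
    have "(A *v x) $ i = A $ i \<bullet> x"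
      by (simp add: matrix_vector_mult_def inner_vec_def)
    then show "norm ((A *v x) $ i) \<le> norm x * norm (A $ i)"
      using Cauchy_Schwarz_ineq2[of "A $ i" x] by (simp add: mult.commute)
  qed simp
  also have "\<dots> = norm x * L2_set (\<lambda>i. norm (A $ i)) UNIV"
    by (simp add: L2_set_right_distrib)
  finally show ?thesis by (simp add: norm_vec_def mult.commute)
qed

lemma quadratic_form_eq_sum: "u \<bullet> (A *v u) = (\<Sum>i\<in>UNIV. \<Sum>j\<in>UNIV. u $ i * u $ j * A $ i $ j)"
  for u :: "real^'n" and A :: "real^'n^'n"
  by (simp add: inner_vec_def matrix_vector_mult_def sum_distrib_left mult_ac)

lemma square_inner_eq_sum: "(u \<bullet> y)\<^sup>2 = (\<Sum>i\<in>UNIV. \<Sum>j\<in>UNIV. u $ i * u $ j * (y $ i * y $ j))"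
  for u y :: "real^'n"
  by (simp add: inner_vec_def power2_eq_square sum_product mult_ac)

text \<open>Valid for all \<open>n\<close> and all data, so that \<open>psd_sqrt\<close> of a sample
  covariance is specified even when the matrix is singular.\<close>

lemma psd_sample_covariance: "psd (sample_covariance_matrix n y)"
\<comment> \<open>At \<open>n = 0\<close> the divisor \<open>real n - 1\<close> is negative, but the
  sums are empty; at \<open>n = 1\<close> division by zero gives the zero matrix.\<close>
proof (cases "n = 0")
  case True
  then have "sample_covariance_matrix n y = 0" by (simp add: sample_covariance_matrix_def vec_eq_iff)
  moreover have "psd (0 :: real^'n^'n)"
    unfolding psd_def quadratic_form_eq_sum by (simp add: transpose_def vec_eq_iff)
  ultimately show ?thesis by simp
next
  case False
  let ?w = "\<lambda>k. y k - sample_mean n y"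
  have "u \<bullet> (sample_covariance_matrix n y *v u) = (\<Sum>k=1..n. (u \<bullet> ?w k)\<^sup>2) / (real n - 1)" for u
  proof -
    have "(\<Sum>k=1..n. (u \<bullet> ?w k)\<^sup>2) = (\<Sum>i\<in>UNIV. \<Sum>k=1..n. \<Sum>j\<in>UNIV. u $ i * u $ j * (?w k $ i * ?w k $ j))"
      unfolding square_inner_eq_sum by (rule sum.swap)
    also have "\<dots> = (\<Sum>i\<in>UNIV. \<Sum>j\<in>UNIV. \<Sum>k=1..n. u $ i * u $ j * (?w k $ i * ?w k $ j))"
      by (intro sum.cong refl sum.swap)
    finally show ?thesis
      unfolding quadratic_form_eq_sum sample_covariance_matrix_def
      by (simp only: vec_lambda_beta sum_divide_distrib sum_distrib_left times_divide_eq_right)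
  qed
  then show ?thesis
    using False unfolding psd_def
    by (auto simp: sample_covariance_matrix_def transpose_def vec_eq_iff mult.commute sum_nonneg)
qed

text \<open>Raw first and second moments are what the strong law controls. At \<open>n = 1\<close>
  both sides vanish by division by zero.\<close>

lemma sample_covariance_entry:
  assumes "n > 0"
  shows "sample_covariance_matrix n y $ i $ j =
    (n / (real n - 1)) * ((\<Sum>k=1..n. y k $ i * y k $ j) / n - ((\<Sum>k=1..n. y k $ i) / n) * ((\<Sum>k=1..n. y k $ j) / n))"
proof -
  let ?m = "sample_mean n y"
  have m: "(\<Sum>k=1..n. y k $ i) = n * ?m $ i" for i
    using assms by (simp add: sample_mean_def)
  have "(\<Sum>k=1..n. (y k - ?m) $ i * (y k - ?m) $ j)
      = (\<Sum>k=1..n. y k $ i * y k $ j) - ?m $ j * (\<Sum>k=1..n. y k $ i) - ?m $ i * (\<Sum>k=1..n. y k $ j) + n * (?m $ i * ?m $ j)"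
    by (simp add: sum.distrib sum_subtractf algebra_simps sum_distrib_left)
  also have "\<dots> = (\<Sum>k=1..n. y k $ i * y k $ j) - n * (?m $ i * ?m $ j)"
    unfolding m by simp
  finally show ?thesis
    using assms unfolding sample_covariance_matrix_def m by (simp add: right_diff_distrib diff_divide_distrib)
qed

text \<open>The data \<open>y n k\<close> change with \<open>n\<close> through the random point
  \<open>x_n\<close>, so averages converge by the strong law only for the unperturbed
  \<open>u k\<close>. The perturbation is a vanishing factor \<open>d n\<close> times weights whose
  squares have convergent averages.\<close>

lemma sample_covariance_tendsto:
  fixes u :: "nat \<Rightarrow> real^'n" and y :: "nat \<Rightarrow> nat \<Rightarrow> real^'n"
  assumes mean: "\<And>i. (\<lambda>n. (\<Sum>k=1..n. u k $ i) / n) \<longlonglongrightarrow> m i"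
    and sq: "\<And>i j. (\<lambda>n. (\<Sum>k=1..n. u k $ i * u k $ j) / n) \<longlonglongrightarrow> q i j"
    and l: "(\<lambda>n. (\<Sum>k=1..n. (l k)\<^sup>2) / n) \<longlonglongrightarrow> c"
    and d: "d \<longlonglongrightarrow> 0" "\<And>n. d n \<ge> 0" "\<And>k. l k \<ge> 0"
    and pert: "\<forall>\<^sub>F n in sequentially. \<forall>k\<ge>1. norm (y n k - u k) \<le> l k * d n"
  shows "(\<lambda>n. sample_covariance_matrix n (y n)) \<longlonglongrightarrow> (\<chi> i j. q i j - m i * m j)"
proof -
  have usq: "(\<lambda>n. (\<Sum>k=1..n. (norm (u k))\<^sup>2) / n) \<longlonglongrightarrow> (\<Sum>i\<in>UNIV. q i i)"
  proof -
    have "(\<Sum>k=1..n. (norm (u k))\<^sup>2) = (\<Sum>i\<in>UNIV. \<Sum>k=1..n. u k $ i * u k $ i)" for n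
      unfolding norm_vec_sq power2_eq_square[of "_ $ _"] by (rule sum.swap)
    then have "(\<Sum>k=1..n. (norm (u k))\<^sup>2) / n = (\<Sum>i\<in>UNIV. (\<Sum>k=1..n. u k $ i * u k $ i) / n)" for n
      by (simp only: sum_divide_distrib)
    then show ?thesis by (simp only:) (intro tendsto_sum sq)
  qed
  let ?avg = "\<lambda>n. (\<Sum>k=1..n. (norm (u k))\<^sup>2) / n" and ?avl = "\<lambda>n. (\<Sum>k=1..n. (l k)\<^sup>2) / n"
  \<comment> \<open>This crude bound takes the place of the Cauchy-Schwarz inequality for
    sums.\<close>
  have half: "a * b \<le> a\<^sup>2 + b\<^sup>2" if "a \<ge> 0" "b \<ge> 0" for a b :: real
    using sum_squares_bound[of a b] mult_nonneg_nonneg[OF that] by linarith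
  have mean': "(\<lambda>n. (\<Sum>k=1..n. y n k $ i) / n) \<longlonglongrightarrow> m i" for i
  proof (rule Lim_transform2[OF mean[of i]])
    have "(\<lambda>n. d n * (1 + ?avl n)) \<longlonglongrightarrow> 0 * (1 + c)" by (intro tendsto_intros d l)
    then have "(\<lambda>n. d n * (1 + ?avl n)) \<longlonglongrightarrow> 0" by simp
    then show "(\<lambda>n. (\<Sum>k=1..n. u k $ i) / n - (\<Sum>k=1..n. y n k $ i) / n) \<longlonglongrightarrow> 0"
    proof (rule Lim_null_comparison[rotated])
      show "\<forall>\<^sub>F n in sequentially. norm ((\<Sum>k=1..n. u k $ i) / n - (\<Sum>k=1..n. y n k $ i) / n) \<le> d n * (1 + ?avl n)"
        using pert eventually_gt_at_top[of 0]
      proof eventually_elim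
        case (elim n)
        have "\<bar>u k $ i - y n k $ i\<bar> \<le> d n * (1 + (l k)\<^sup>2)" if "k \<ge> 1" for k
        proof -
          have "\<bar>u k $ i - y n k $ i\<bar> \<le> l k * d n"
            using order_trans[OF component_le_norm_cart[of "y n k - u k" i]] elim(1) that
            by (metis abs_minus_commute vector_minus_component)
          also have "\<dots> \<le> (1 + (l k)\<^sup>2) * d n"
            using half[of 1 "l k"] d by (intro mult_right_mono) auto
          finally show ?thesis by (simp add: mult.commute)
        qed
        then have "\<bar>\<Sum>k=1..n. u k $ i - y n k $ i\<bar> \<le> (\<Sum>k=1..n. d n * (1 + (l k)\<^sup>2))"
          by (intro order_trans[OF sum_abs] sum_mono) auto
        also have "\<dots> = d n * (n + (\<Sum>k=1..n. (l k)\<^sup>2))"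
          by (simp add: sum_distrib_left[symmetric] sum.distrib)
        finally show ?case
          using elim(2) by (simp add: sum_subtractf field_simps flip: diff_divide_distrib)
      qed
    qed
  qed
  have sq': "(\<lambda>n. (\<Sum>k=1..n. y n k $ i * y n k $ j) / n) \<longlonglongrightarrow> q i j" for i j
  proof (rule Lim_transform2[OF sq[of i j]])
    have "(\<lambda>n. 2 * d n * (?avg n + ?avl n) + (d n)\<^sup>2 * ?avl n) \<longlonglongrightarrow> 2 * 0 * ((\<Sum>i\<in>UNIV. q i i) + c) + 0\<^sup>2 * c"
      by (intro tendsto_intros d l usq)
    then have "(\<lambda>n. 2 * d n * (?avg n + ?avl n) + (d n)\<^sup>2 * ?avl n) \<longlonglongrightarrow> 0" by simp
    then show "(\<lambda>n. (\<Sum>k=1..n. u k $ i * u k $ j) / n - (\<Sum>k=1..n. y n k $ i * y n k $ j) / n) \<longlonglongrightarrow> 0"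
    proof (rule Lim_null_comparison[rotated])
      show "\<forall>\<^sub>F n in sequentially. norm ((\<Sum>k=1..n. u k $ i * u k $ j) / n - (\<Sum>k=1..n. y n k $ i * y n k $ j) / n)
          \<le> 2 * d n * (?avg n + ?avl n) + (d n)\<^sup>2 * ?avl n"
        using pert eventually_gt_at_top[of 0]
      proof eventually_elim
        case (elim n)
        have "\<bar>u k $ i * u k $ j - y n k $ i * y n k $ j\<bar> \<le> 2 * d n * ((norm (u k))\<^sup>2 + (l k)\<^sup>2) + (d n)\<^sup>2 * (l k)\<^sup>2"
          if "k \<ge> 1" for k
        proof -
          define e where "e = y n k - u k"
          have e: "\<bar>e $ i\<bar> \<le> l k * d n" for i
            using order_trans[OF component_le_norm_cart[of e i]] elim(1) that by (auto simp: e_def)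
          have ld: "0 \<le> l k * d n" using d by simp
          have "u k $ i * u k $ j - y n k $ i * y n k $ j = - (u k $ i * e $ j + e $ i * u k $ j + e $ i * e $ j)"
            by (simp add: e_def algebra_simps)
          also have "\<bar>\<dots>\<bar> \<le> \<bar>u k $ i\<bar> * \<bar>e $ j\<bar> + \<bar>e $ i\<bar> * \<bar>u k $ j\<bar> + \<bar>e $ i\<bar> * \<bar>e $ j\<bar>"
            by (simp add: abs_mult[symmetric])
          also have "\<dots> \<le> norm (u k) * (l k * d n) + (l k * d n) * norm (u k) + (l k * d n) * (l k * d n)"
            using e ld by (intro add_mono mult_mono component_le_norm_cart) auto
          also have "\<dots> = 2 * d n * (norm (u k) * l k) + (d n)\<^sup>2 * (l k)\<^sup>2"
            by (simp add: algebra_simps power2_eq_square)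
          also have "\<dots> \<le> 2 * d n * ((norm (u k))\<^sup>2 + (l k)\<^sup>2) + (d n)\<^sup>2 * (l k)\<^sup>2"
            using d by (intro add_right_mono mult_left_mono half) auto
          finally show ?thesis .
        qed
        then have "\<bar>\<Sum>k=1..n. u k $ i * u k $ j - y n k $ i * y n k $ j\<bar>
            \<le> (\<Sum>k=1..n. 2 * d n * ((norm (u k))\<^sup>2 + (l k)\<^sup>2) + (d n)\<^sup>2 * (l k)\<^sup>2)"
          by (intro order_trans[OF sum_abs] sum_mono) auto
        also have "\<dots> = 2 * d n * ((\<Sum>k=1..n. (norm (u k))\<^sup>2) + (\<Sum>k=1..n. (l k)\<^sup>2)) + (d n)\<^sup>2 * (\<Sum>k=1..n. (l k)\<^sup>2)"
          by (simp add: sum_distrib_left sum.distrib distrib_left)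
        finally show ?case
          using elim(2) by (simp add: sum_subtractf field_simps flip: diff_divide_distrib)
      qed
    qed
  qed
  have "(\<lambda>n. real n / (real n - 1)) \<longlonglongrightarrow> 1" by real_asymp
  then have entry: "(\<lambda>n. (n / (real n - 1)) * ((\<Sum>k=1..n. y n k $ i * y n k $ j) / n - ((\<Sum>k=1..n. y n k $ i) / n) * ((\<Sum>k=1..n. y n k $ j) / n)))
      \<longlonglongrightarrow> 1 * (q i j - m i * m j)" for i j
    by (intro tendsto_intros mean' sq')
  have "(\<lambda>n. sample_covariance_matrix n (y n) $ i $ j) \<longlonglongrightarrow> q i j - m i * m j" for i j
  proof (rule Lim_transform_eventually)
    show "(\<lambda>n. (n / (real n - 1)) * ((\<Sum>k=1..n. y n k $ i * y n k $ j) / n - ((\<Sum>k=1..n. y n k $ i) / n) * ((\<Sum>k=1..n. y n k $ j) / n)))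
      \<longlonglongrightarrow> q i j - m i * m j" using entry by simp
    show "\<forall>\<^sub>F n in sequentially. (n / (real n - 1)) * ((\<Sum>k=1..n. y n k $ i * y n k $ j) / n - ((\<Sum>k=1..n. y n k $ i) / n) * ((\<Sum>k=1..n. y n k $ j) / n))
        = sample_covariance_matrix n (y n) $ i $ j"
      using eventually_gt_at_top[of 0] by eventually_elim (simp add: sample_covariance_entry)
  qed
  then show ?thesis
    by (intro vec_tendstoI) simp
qed

lemma (in prob_space) integrable_if_norm_sq_integrable:
  fixes Y :: "'a \<Rightarrow> 'b::{banach, second_countable_topology}"
  assumes [measurable]: "Y \<in> borel_measurable M" and sq: "integrable M (\<lambda>\<omega>. (norm (Y \<omega>))\<^sup>2)"
  shows "integrable M Y"
proof (rule Bochner_Integration.integrable_bound)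
  show "integrable M (\<lambda>\<omega>. 1 + (norm (Y \<omega>))\<^sup>2)" using sq by simp
  show "AE \<omega> in M. norm (Y \<omega>) \<le> norm (1 + (norm (Y \<omega>))\<^sup>2)"
  proof (intro always_eventually allI)
    fix \<omega> show "norm (Y \<omega>) \<le> norm (1 + (norm (Y \<omega>))\<^sup>2)"
      using sum_squares_bound[of 1 "norm (Y \<omega>)"] norm_ge_zero[of "Y \<omega>"]
      by (simp del: norm_ge_zero)
  qed
qed simp

text \<open>The identity for the quadratic form is used twice: its sign gives \<open>psd\<close>,
  and its value is the variance of a projection in the central limit theorem.\<close>

lemma (in prob_space) covariance_quadratic_form:
  fixes Y :: "'a \<Rightarrow> real^'n"
  assumes [measurable]: "Y \<in> borel_measurable M" and sq: "integrable M (\<lambda>\<omega>. (norm (Y \<omega>))\<^sup>2)"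
  shows "integrable M Y"
    and "\<And>i j. integrable M (\<lambda>\<omega>. Y \<omega> $ i * Y \<omega> $ j)"
    and "covariance_matrix M Y = (\<chi> i j. expectation (\<lambda>\<omega>. Y \<omega> $ i * Y \<omega> $ j) - expectation (\<lambda>\<omega>. Y \<omega> $ i) * expectation (\<lambda>\<omega>. Y \<omega> $ j))"
    and "\<And>u. u \<bullet> (covariance_matrix M Y *v u) = expectation (\<lambda>\<omega>. (u \<bullet> (Y \<omega> - expectation Y))\<^sup>2)"
    and "psd (covariance_matrix M Y)"
proof -
  have comp [measurable]: "(\<lambda>\<omega>. Y \<omega> $ i) \<in> borel_measurable M" for i
    unfolding cart_eq_inner_axis by measurable
  show Y: "integrable M Y" by (rule integrable_if_norm_sq_integrable[OF assms])
  show prod: "integrable M (\<lambda>\<omega>. Y \<omega> $ i * Y \<omega> $ j)" for i j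
  proof (rule Bochner_Integration.integrable_bound[OF sq])
    show "AE \<omega> in M. norm (Y \<omega> $ i * Y \<omega> $ j) \<le> norm ((norm (Y \<omega>))\<^sup>2)"
      unfolding power2_eq_square by (auto simp: abs_mult intro!: mult_mono component_le_norm_cart)
  qed simp
  have lin: "expectation (\<lambda>\<omega>. Y \<omega> $ i) = expectation Y $ i" "integrable M (\<lambda>\<omega>. Y \<omega> $ i)" for i
    using integral_bounded_linear[OF bounded_linear_vec_nth Y] integrable_bounded_linear[OF bounded_linear_vec_nth Y] by auto
  show "covariance_matrix M Y = (\<chi> i j. expectation (\<lambda>\<omega>. Y \<omega> $ i * Y \<omega> $ j) - expectation (\<lambda>\<omega>. Y \<omega> $ i) * expectation (\<lambda>\<omega>. Y \<omega> $ j))"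
    unfolding covariance_matrix_def vec_eq_iff using prod lin
    by (simp add: left_diff_distrib right_diff_distrib prob_space)
  let ?m = "expectation Y"
  have prod': "integrable M (\<lambda>\<omega>. (Y \<omega> $ i - ?m $ i) * (Y \<omega> $ j - ?m $ j))" for i j
    using prod lin by (simp add: left_diff_distrib right_diff_distrib)
  show form: "u \<bullet> (covariance_matrix M Y *v u) = expectation (\<lambda>\<omega>. (u \<bullet> (Y \<omega> - ?m))\<^sup>2)" for u
    unfolding quadratic_form_eq_sum square_inner_eq_sum covariance_matrix_def
    using prod' by (simp add: lin(1))
  show "psd (covariance_matrix M Y)"
    unfolding psd_def
  proof (intro conjI allI)
    show "transpose (covariance_matrix M Y) = covariance_matrix M Y"
      by (simp add: transpose_def covariance_matrix_def vec_eq_iff mult.commute)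
    show "0 \<le> u \<bullet> (covariance_matrix M Y *v u)" for u unfolding form by simp
  qed
qed

section \<open>Slutsky's theorem with a relative error\<close>

text \<open>The sequence \<open>W n \<omega>\<close> need not be bounded for fixed
  \<open>\<omega>\<close>, so the relative error need not tend to 0 pathwise. On the event that
  \<open>W n\<close> lies in a ball of radius \<open>R\<close> it does, and uniform continuity of
  \<open>g\<close> on a compact ball permits dominated convergence; off this event Chebyshev's bound
  \<open>D / R\<^sup>2\<close> applies.\<close>

lemma (in prob_space) slutsky:
  fixes V W :: "nat \<Rightarrow> 'a \<Rightarrow> real^'n" and g :: "real^'n \<Rightarrow> real"
  assumes [measurable]: "\<And>n. V n \<in> borel_measurable M" "\<And>n. W n \<in> borel_measurable M"
    and int: "\<And>n. integrable M (\<lambda>\<omega>. (norm (W n \<omega>))\<^sup>2)" "\<And>n. expectation (\<lambda>\<omega>. (norm (W n \<omega>))\<^sup>2) \<le> D"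
    and close: "AE \<omega> in M. \<exists>\<eta>. \<eta> \<longlonglongrightarrow> 0 \<and> (\<forall>\<^sub>F n in sequentially. norm (V n \<omega> - W n \<omega>) \<le> \<eta> n * norm (W n \<omega>))"
    and g: "continuous_on UNIV g" "\<And>x. \<bar>g x\<bar> \<le> B"
    and lim: "(\<lambda>n. expectation (\<lambda>\<omega>. g (W n \<omega>))) \<longlonglongrightarrow> c"
  shows "(\<lambda>n. expectation (\<lambda>\<omega>. g (V n \<omega>))) \<longlonglongrightarrow> c"
proof (rule Lim_transform2[OF lim])
  have [measurable]: "g \<in> borel_measurable borel" using g(1) by (rule borel_measurable_continuous_onI)
  have B: "B \<ge> 0" using g(2)[of 0] by linarith
  have D: "D \<ge> 0" using order_trans[OF _ int(2), of 0] by simp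
  let ?\<Delta> = "\<lambda>n \<omega>. \<bar>g (W n \<omega>) - g (V n \<omega>)\<bar>"
  have \<Delta>: "?\<Delta> n \<omega> \<le> 2 * B" for n \<omega> using g(2)[of "W n \<omega>"] g(2)[of "V n \<omega>"] by linarith
  have ig: "integrable M (\<lambda>\<omega>. g (W n \<omega>))" "integrable M (\<lambda>\<omega>. g (V n \<omega>))" for n
    using g(2) by (auto intro!: integrable_const_bound[where B = B])
  have local: "(\<lambda>n. expectation (\<lambda>\<omega>. ?\<Delta> n \<omega> * indicator (cball 0 R) (W n \<omega>))) \<longlonglongrightarrow> 0" if R: "R > 0" for R
  proof -
    have "(\<lambda>n. expectation (\<lambda>\<omega>. ?\<Delta> n \<omega> * indicator (cball 0 R) (W n \<omega>))) \<longlonglongrightarrow> expectation (\<lambda>\<omega>. 0)"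
    proof (rule integral_dominated_convergence[where w = "\<lambda>_. 2 * B"])
      show "AE \<omega> in M. norm (?\<Delta> n \<omega> * indicator (cball 0 R) (W n \<omega>)) \<le> 2 * B" for n
        using \<Delta>[of n] B by (auto simp: indicator_def)
      show "AE \<omega> in M. (\<lambda>n. ?\<Delta> n \<omega> * indicator (cball 0 R) (W n \<omega>)) \<longlonglongrightarrow> 0"
        using close
      proof eventually_elim
        case (elim \<omega>)
        then obtain \<eta> where \<eta>: "\<eta> \<longlonglongrightarrow> 0"
          "\<forall>\<^sub>F n in sequentially. norm (V n \<omega> - W n \<omega>) \<le> \<eta> n * norm (W n \<omega>)" by blast
        have uc: "uniformly_continuous_on (cball 0 (R + 1)) g"
          using g(1) by (intro compact_uniformly_continuous) (auto intro: continuous_on_subset)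
        show ?case
          unfolding tendsto_iff
        proof (intro allI impI)
          fix e :: real assume "e > 0"
          with uc obtain d where d: "d > 0" "\<And>x y. x \<in> cball 0 (R + 1) \<Longrightarrow> y \<in> cball 0 (R + 1) \<Longrightarrow> dist y x < d \<Longrightarrow> dist (g y) (g x) < e"
            unfolding uniformly_continuous_on_def by metis
          have "\<forall>\<^sub>F n in sequentially. \<eta> n < min 1 d / R"
            using \<eta>(1) R d by (intro order_tendstoD) auto
          with \<eta>(2) show "\<forall>\<^sub>F n in sequentially. dist (?\<Delta> n \<omega> * indicator (cball 0 R) (W n \<omega>)) 0 < e"
          proof eventually_elim
            case (elim n)
            show ?case
            proof (cases "norm (W n \<omega>) \<le> R")
              case True
              have "norm (V n \<omega> - W n \<omega>) < min 1 d"
              proof (cases "W n \<omega> = 0")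
                case False
                have "norm (V n \<omega> - W n \<omega>) \<le> \<eta> n * norm (W n \<omega>)" by fact
                also have "\<dots> < min 1 d / R * norm (W n \<omega>)"
                  using elim False by (intro mult_strict_right_mono) auto
                also have "\<dots> \<le> min 1 d / R * R"
                  using True R d by (intro mult_left_mono) auto
                finally show ?thesis using R by simp
              qed (use elim d in auto)
              moreover have "norm (V n \<omega>) \<le> norm (W n \<omega>) + norm (V n \<omega> - W n \<omega>)"
                using norm_triangle_ineq[of "W n \<omega>" "V n \<omega> - W n \<omega>"] by simp
              ultimately have "dist (g (W n \<omega>)) (g (V n \<omega>)) < e"
                using True by (intro d) (auto simp: dist_norm norm_minus_commute)
              then show ?thesis using True by (simp add: dist_real_def)
            qed (use \<open>e > 0\<close> in simp)
          qed
        qed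
      qed
    qed (measurable, auto)
    then show ?thesis by simp
  qed
  show "(\<lambda>n. expectation (\<lambda>\<omega>. g (W n \<omega>)) - expectation (\<lambda>\<omega>. g (V n \<omega>))) \<longlonglongrightarrow> 0"
    unfolding tendsto_iff
  proof (intro allI impI)
    fix e :: real assume "e > 0"
    \<comment> \<open>Makes the tail contribution \<open>2 * B * (D / R\<^sup>2)\<close> at most
      \<open>e / 2\<close>; the added ones keep \<open>R\<close> positive when \<open>B\<close> or
      \<open>D\<close> is zero.\<close>
    define R where "R = sqrt (4 * (B + 1) * (D + 1) / e)"
    have "4 * (B + 1) * (D + 1) / e > 0" using \<open>e > 0\<close> B D by simp
    then have R: "R > 0" "R\<^sup>2 = 4 * (B + 1) * (D + 1) / e" by (simp_all add: R_def)
    have tail: "2 * B * (D / R\<^sup>2) \<le> e / 2"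
    proof -
      have "4 * (B * D) * e \<le> (4 * (B + 1) * (D + 1)) * e"
        using B D \<open>e > 0\<close> by (intro mult_right_mono) (auto simp: algebra_simps)
      then show ?thesis unfolding R(2) using \<open>e > 0\<close> B D by (simp add: divide_simps mult_ac)
    qed
    have "\<forall>\<^sub>F n in sequentially. expectation (\<lambda>\<omega>. ?\<Delta> n \<omega> * indicator (cball 0 R) (W n \<omega>)) < e / 2"
      using local[OF R(1)] \<open>e > 0\<close> by (intro order_tendstoD) auto
    then show "\<forall>\<^sub>F n in sequentially. dist (expectation (\<lambda>\<omega>. g (W n \<omega>)) - expectation (\<lambda>\<omega>. g (V n \<omega>))) 0 < e"
    proof eventually_elim
      case (elim n)
      have i\<Delta>: "integrable M (\<lambda>\<omega>. ?\<Delta> n \<omega> * indicator (cball 0 R) (W n \<omega>))"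
        using \<Delta>[of n] B by (intro integrable_const_bound[where B = "2 * B"]) (auto simp: indicator_def)
      have "\<bar>expectation (\<lambda>\<omega>. g (W n \<omega>)) - expectation (\<lambda>\<omega>. g (V n \<omega>))\<bar> = \<bar>expectation (\<lambda>\<omega>. g (W n \<omega>) - g (V n \<omega>))\<bar>"
        using ig by simp
      also have "\<dots> \<le> expectation (?\<Delta> n)" by (rule integral_abs_bound)
      also have "\<dots> \<le> expectation (\<lambda>\<omega>. ?\<Delta> n \<omega> * indicator (cball 0 R) (W n \<omega>) + 2 * B * ((norm (W n \<omega>))\<^sup>2 / R\<^sup>2))"
      proof (rule integral_mono)
        show "integrable M (?\<Delta> n)" using ig by auto
        show "integrable M (\<lambda>\<omega>. ?\<Delta> n \<omega> * indicator (cball 0 R) (W n \<omega>) + 2 * B * ((norm (W n \<omega>))\<^sup>2 / R\<^sup>2))"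
          using i\<Delta> int(1)[of n] by simp
        fix \<omega>
        show "?\<Delta> n \<omega> \<le> ?\<Delta> n \<omega> * indicator (cball 0 R) (W n \<omega>) + 2 * B * ((norm (W n \<omega>))\<^sup>2 / R\<^sup>2)"
        proof (cases "norm (W n \<omega>) \<le> R")
          case False
          then have "1 \<le> (norm (W n \<omega>))\<^sup>2 / R\<^sup>2" using R(1) by (simp add: power_mono)
          then have "2 * B * 1 \<le> 2 * B * ((norm (W n \<omega>))\<^sup>2 / R\<^sup>2)" using B by (intro mult_left_mono) auto
          then show ?thesis using \<Delta>[of n \<omega>] False by simp
        qed (use B in simp)
      qed
      also have "\<dots> = expectation (\<lambda>\<omega>. ?\<Delta> n \<omega> * indicator (cball 0 R) (W n \<omega>)) + 2 * B * (expectation (\<lambda>\<omega>. (norm (W n \<omega>))\<^sup>2) / R\<^sup>2)"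
        using i\<Delta> int(1)[of n] by simp
      also have "\<dots> \<le> expectation (\<lambda>\<omega>. ?\<Delta> n \<omega> * indicator (cball 0 R) (W n \<omega>)) + 2 * B * (D / R\<^sup>2)"
        using int(2)[of n] B by (intro add_left_mono mult_left_mono divide_right_mono) auto
      also have "\<dots> < e" using elim tail by linarith
      finally show ?case by (simp add: dist_real_def)
    qed
  qed
qed

text \<open>The difference of the indicators tends to 0 on almost every path. This exchanges an
  event about the norm of the whitened statistic for the coverage event, which agrees with it only
  where the sample covariance is invertible.\<close>

lemma (in prob_space) measure_tendsto_if_eventually_iff:
  assumes [measurable]: "\<And>n. A n \<in> events" "\<And>n. C n \<in> events"
    and iff: "AE \<omega> in M. \<forall>\<^sub>F n in sequentially. \<omega> \<in> A n \<longleftrightarrow> \<omega> \<in> C n"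
    and lim: "(\<lambda>n. prob (A n)) \<longlonglongrightarrow> c"
  shows "(\<lambda>n. prob (C n)) \<longlonglongrightarrow> c"
proof (rule Lim_transform2[OF lim])
  have "(\<lambda>n. expectation (\<lambda>\<omega>. indicator (A n) \<omega> - indicator (C n) \<omega>)) \<longlonglongrightarrow> expectation (\<lambda>\<omega>. 0 :: real)"
  proof (rule integral_dominated_convergence[where w = "\<lambda>_. 1"])
    show "AE \<omega> in M. (\<lambda>n. indicator (A n) \<omega> - indicator (C n) \<omega> :: real) \<longlonglongrightarrow> 0"
      using iff
    proof eventually_elim
      case (elim \<omega>)
      then have "\<forall>\<^sub>F n in sequentially. indicator (A n) \<omega> - indicator (C n) \<omega> = (0 :: real)"
        by eventually_elim (auto simp: indicator_def)
      then show ?case by (rule tendsto_eventually)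
    qed
  qed (auto simp: indicator_def)
  then show "(\<lambda>n. prob (A n) - prob (C n)) \<longlonglongrightarrow> 0"
    by (simp add: emeasure_eq_measure)
qed

section \<open>Sample averages of a smooth random field\<close>

lemma bounded_linear_matrix_vector_left: "bounded_linear (\<lambda>A :: real^'n^'m. A *v v)"
  unfolding linear_conv_bounded_linear[symmetric]
  by (intro linearI) (simp_all add: matrix_vector_mult_add_rdistrib scaleR_matrix_vector_assoc)

lemma C1_on_has_derivative:
  assumes "C1_on U g" "x \<in> U"
  shows "(g has_derivative (*v) (jacobian g (at x))) (at x)"
  using assms jacobian_works unfolding C1_on_def by blast

lemma frechet_derivative_eq_jacobian:
  fixes g :: "real^'n \<Rightarrow> real^'m"
  assumes "g differentiable (at x)" shows "frechet_derivative g (at x) = (*v) (jacobian g (at x))"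
  using frechet_derivative_at[OF jacobian_works[THEN iffD1, OF assms]] by simp

text \<open>\<open>G\<close> is a Borel set of sample points on which smoothness holds without
  exception. Setting \<open>F\<close> to zero off \<open>U \<times> G\<close> gives the total Borel
  function \<open>Fm\<close>, with \<open>Jm\<close> as its companion for the Jacobian.\<close>

locale regular_field =
  fixes U :: "(real^'q) set" and F :: "real^'q \<Rightarrow> real^'d \<Rightarrow> real^'q" and G :: "(real^'d) set"
  assumes open_U: "open U" and G_borel: "G \<in> sets borel"
    and F_measurable: "(\<lambda>p. if fst p \<in> U \<and> snd p \<in> G then F (fst p) (snd p) else 0) \<in> borel_measurable borel"
    and C1: "\<And>s. s \<in> G \<Longrightarrow> C1_on U (\<lambda>x. F x s)"
begin

definition Fm :: "real^'q \<Rightarrow> real^'d \<Rightarrow> real^'q" where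
  "Fm x s = (if x \<in> U \<and> s \<in> G then F x s else 0)"

definition Jm :: "real^'q \<Rightarrow> real^'d \<Rightarrow> real^'q^'q" where
  "Jm x s = (if x \<in> U \<and> s \<in> G then jacobian (\<lambda>x. F x s) (at x) else 0)"

lemma measurable_Fm [measurable (raw)]:
  assumes "Y \<in> borel_measurable N" "T \<in> borel_measurable N"
  shows "(\<lambda>\<omega>. Fm (Y \<omega>) (T \<omega>)) \<in> borel_measurable N"
  using measurable_compose[OF borel_measurable_Pair[OF assms] F_measurable] unfolding Fm_def fst_conv snd_conv .

lemma has_derivative_F:
  assumes "x \<in> U" "s \<in> G" shows "((\<lambda>x. F x s) has_derivative (*v) (Jm x s)) (at x)"
  using C1_on_has_derivative[OF C1[OF assms(2)] assms(1)] assms by (simp add: Jm_def)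

lemma differentiable_F: "x \<in> U \<Longrightarrow> s \<in> G \<Longrightarrow> (\<lambda>x. F x s) differentiable (at x)"
  using has_derivative_F differentiableI by blast

lemma Jm_quotient_LIMSEQ:
  assumes "x \<in> U" "s \<in> G"
  shows "(\<lambda>k. real (Suc k) *\<^sub>R (Fm (x + (1 / real (Suc k)) *\<^sub>R v) s - Fm x s)) \<longlonglongrightarrow> Jm x s *v v"
proof (rule Lim_transform_eventually)
  show "(\<lambda>k. real (Suc k) *\<^sub>R (F (x + (1 / real (Suc k)) *\<^sub>R v) s - F x s)) \<longlonglongrightarrow> Jm x s *v v"
    by (rule has_derivative_imp_LIMSEQ[OF has_derivative_F[OF assms]])
  have "(\<lambda>k. 1 / real (Suc k)) \<longlonglongrightarrow> 0" by (rule LIMSEQ_Suc[OF lim_1_over_n])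
  then have "(\<lambda>k. x + (1 / real (Suc k)) *\<^sub>R v) \<longlonglongrightarrow> x + 0 *\<^sub>R v"
    by (intro tendsto_intros)
  then have "\<forall>\<^sub>F k in sequentially. x + (1 / real (Suc k)) *\<^sub>R v \<in> U"
    using topological_tendstoD[OF _ open_U] assms(1) by simp
  then show "\<forall>\<^sub>F k in sequentially. real (Suc k) *\<^sub>R (F (x + (1 / real (Suc k)) *\<^sub>R v) s - F x s)
      = real (Suc k) *\<^sub>R (Fm (x + (1 / real (Suc k)) *\<^sub>R v) s - Fm x s)"
    by eventually_elim (use assms in \<open>simp add: Fm_def\<close>)
qed

text \<open>Joint measurability in base point, sample point and direction is needed because the
  Jacobian is evaluated at the random point \<open>x_n\<close>; the difference quotients of
  \<open>Fm\<close> supply it.\<close>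

lemma measurable_Jm_mult [measurable (raw)]:
  assumes [measurable]: "Y \<in> borel_measurable N" "T \<in> borel_measurable N" "V \<in> borel_measurable N"
  shows "(\<lambda>\<omega>. Jm (Y \<omega>) (T \<omega>) *v V \<omega>) \<in> borel_measurable N"
proof -
  note G_borel [measurable] borel_open[OF open_U, measurable]
  have [measurable]: "Measurable.pred N (\<lambda>\<omega>. Y \<omega> \<in> U \<and> T \<omega> \<in> G)" by measurable
  show ?thesis
  proof (rule borel_measurable_LIMSEQ_metric)
    show "(\<lambda>\<omega>. if Y \<omega> \<in> U \<and> T \<omega> \<in> G then real (Suc k) *\<^sub>R (Fm (Y \<omega> + (1 / real (Suc k)) *\<^sub>R V \<omega>) (T \<omega>) - Fm (Y \<omega>) (T \<omega>)) else 0)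
        \<in> borel_measurable N" for k by measurable
    show "(\<lambda>k. if Y \<omega> \<in> U \<and> T \<omega> \<in> G then real (Suc k) *\<^sub>R (Fm (Y \<omega> + (1 / real (Suc k)) *\<^sub>R V \<omega>) (T \<omega>) - Fm (Y \<omega>) (T \<omega>)) else 0)
        \<longlonglongrightarrow> Jm (Y \<omega>) (T \<omega>) *v V \<omega>" for \<omega>
    proof (cases "Y \<omega> \<in> U \<and> T \<omega> \<in> G")
      case True
      then show ?thesis using Jm_quotient_LIMSEQ[of "Y \<omega>" "T \<omega>" "V \<omega>"] by simp
    next
      case False
      then have "Jm (Y \<omega>) (T \<omega>) = 0" unfolding Jm_def by auto
      then show ?thesis by (simp only: False if_False) simp
    qed
  qed
qed

lemma measurable_Jm [measurable (raw)]:
  assumes [measurable]: "Y \<in> borel_measurable N" "T \<in> borel_measurable N"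
  shows "(\<lambda>\<omega>. Jm (Y \<omega>) (T \<omega>)) \<in> borel_measurable N"
proof (rule borel_measurable_euclidean_space[THEN iffD2], rule ballI)
  fix b :: "real^'q^'q" assume "b \<in> Basis"
  then obtain i j where b: "b = axis i (axis j 1)" by (auto simp: Basis_vec_def)
  have "Jm (Y \<omega>) (T \<omega>) \<bullet> b = (Jm (Y \<omega>) (T \<omega>) *v axis j 1) \<bullet> axis i 1" for \<omega>
    by (simp add: b inner_axis matrix_vector_mult_basis column_def)
  then show "(\<lambda>\<omega>. Jm (Y \<omega>) (T \<omega>) \<bullet> b) \<in> borel_measurable N" by simp
qed

lemma continuous_on_F: "s \<in> G \<Longrightarrow> continuous_on U (\<lambda>x. F x s)"
  by (intro continuous_at_imp_continuous_on ballI differentiable_imp_continuous_within differentiable_F)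

lemma continuous_on_jacobian: "s \<in> G \<Longrightarrow> continuous_on U (\<lambda>x. jacobian (\<lambda>x. F x s) (at x))"
  using C1 by (simp add: C1_on_def)

end

section \<open>Almost sure limits of sample averages\<close>

text \<open>The Lipschitz constant \<open>\<Lambda>\<close> is a function of the sample point alone,
  so its values at the copies of \<open>\<xi>\<close> obey the strong law. Increments are bounded
  against the centre \<open>x0\<close> only, which is the form that the linearisation at
  \<open>x0\<close> takes.\<close>

locale regular_sample = regular_field U F G + prob_space M
  for U :: "(real^'q) set" and F :: "real^'q \<Rightarrow> real^'d \<Rightarrow> real^'q" and G and M :: "'w measure" +
  fixes \<xi> :: "'w \<Rightarrow> real^'d" and \<xi>s :: "nat \<Rightarrow> 'w \<Rightarrow> real^'d" and x0 :: "real^'q"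
    and \<Lambda> :: "real^'d \<Rightarrow> real" and \<delta> :: real
  assumes \<xi>_measurable [measurable]: "\<xi> \<in> borel_measurable M"
    and indep: "indep_vars (\<lambda>_. borel) \<xi>s {1..}"
    and ident: "\<And>i. i \<ge> 1 \<Longrightarrow> distr M borel (\<xi>s i) = distr M borel \<xi>"
    and AE_G: "AE \<omega> in M. \<xi> \<omega> \<in> G"
    and x0: "x0 \<in> U" and \<delta>: "\<delta> > 0" "ball x0 \<delta> \<subseteq> U"
    and \<Lambda>_measurable [measurable]: "\<Lambda> \<in> borel_measurable borel"
    and \<Lambda>_nonneg: "\<And>s. 0 \<le> \<Lambda> s"
    and \<Lambda>_sq: "integrable M (\<lambda>\<omega>. (\<Lambda> (\<xi> \<omega>))\<^sup>2)"
    and lipschitz: "\<And>s y. s \<in> G \<Longrightarrow> y \<in> ball x0 \<delta> \<Longrightarrow> norm (F y s - F x0 s)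
      + norm (jacobian (\<lambda>x. F x s) (at y) - jacobian (\<lambda>x. F x s) (at x0)) \<le> \<Lambda> s * norm (y - x0)"
    and F_integrable: "\<And>y. y \<in> U \<Longrightarrow> integrable M (\<lambda>\<omega>. F y (\<xi> \<omega>))"
    and F_sq: "integrable M (\<lambda>\<omega>. (norm (Fm x0 (\<xi> \<omega>)))\<^sup>2)"
    and J_sq: "integrable M (\<lambda>\<omega>. (norm (Jm x0 (\<xi> \<omega>)))\<^sup>2)"
begin

lemma \<xi>s_measurable [measurable]: "i \<ge> 1 \<Longrightarrow> \<xi>s i \<in> borel_measurable M"
  using indep by (auto simp: indep_vars_def2)

lemma AE_sample_G: "AE \<omega> in M. \<forall>i\<ge>1. \<xi>s i \<omega> \<in> G"
proof -
  note G_borel [measurable]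
  have "AE \<omega> in M. i \<ge> 1 \<longrightarrow> \<xi>s i \<omega> \<in> G" for i
  proof (cases "i \<ge> 1")
    case True
    have "AE s in distr M borel \<xi>. s \<in> G" using AE_G by (subst AE_distr_iff) auto
    then have "AE s in distr M borel (\<xi>s i). s \<in> G" by (simp only: ident[OF True])
    then show ?thesis using True by (subst (asm) AE_distr_iff) auto
  qed simp
  then show ?thesis by (simp add: AE_all_countable)
qed

lemma indep_sample_Suc: "indep_vars (\<lambda>_. borel) (\<lambda>i. \<xi>s (Suc i)) UNIV"
proof -
  have "Suc ` UNIV = {1::nat..}" by (auto simp: image_iff) (metis Suc_le_D)
  then show ?thesis
    using indep_vars_reindex_inj[of Suc UNIV "\<lambda>_. borel" \<xi>s] indep by simp
qed

lemma strong_law_sample: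
  fixes h :: "real^'d \<Rightarrow> real"
  assumes [measurable]: "h \<in> borel_measurable borel" and int: "integrable M (\<lambda>\<omega>. h (\<xi> \<omega>))"
  shows "AE \<omega> in M. (\<lambda>n. (\<Sum>i=1..n. h (\<xi>s i \<omega>)) / n) \<longlonglongrightarrow> expectation (\<lambda>\<omega>. h (\<xi> \<omega>))"
proof -
  have distr_h: "distr M borel (\<lambda>\<omega>. h (\<xi>s (Suc i) \<omega>)) = distr (distr M borel \<xi>) borel h" for i
    using ident[of "Suc i"] distr_distr[of h borel borel "\<xi>s (Suc i)" M] by (simp add: comp_def)
  interpret X: iid_sequence M "\<lambda>i \<omega>. h (\<xi>s (Suc i) \<omega>)"
  proof
    show "indep_vars (\<lambda>_. borel) (\<lambda>i \<omega>. h (\<xi>s (Suc i) \<omega>)) UNIV"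
      by (rule indep_vars_compose2[OF indep_sample_Suc]) simp
    show "distr M borel (\<lambda>\<omega>. h (\<xi>s (Suc i) \<omega>)) = distr M borel (\<lambda>\<omega>. h (\<xi>s (Suc 0) \<omega>))" for i
      unfolding distr_h ..
  qed
  have "integrable (distr M borel \<xi>) h" using int by (subst integrable_distr_eq) auto
  then have "integrable (distr M borel (\<xi>s 1)) h" using ident[of 1] by simp
  then have "integrable M (\<lambda>\<omega>. h (\<xi>s (Suc 0) \<omega>))" by (subst (asm) integrable_distr_eq) auto
  from X.strong_law[OF this]
  have "AE \<omega> in M. (\<lambda>n. (\<Sum>i<n. h (\<xi>s (Suc i) \<omega>)) / n) \<longlonglongrightarrow> expectation (\<lambda>\<omega>. h (\<xi>s (Suc 0) \<omega>))" .
  moreover have "expectation (\<lambda>\<omega>. h (\<xi>s (Suc 0) \<omega>)) = expectation (\<lambda>\<omega>. h (\<xi> \<omega>))"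
    using integral_distr[of "\<xi>s (Suc 0)" M borel h] integral_distr[of \<xi> M borel h] ident[of 1] by simp
  moreover have "(\<Sum>i<n. h (\<xi>s (Suc i) \<omega>)) = (\<Sum>i=1..n. h (\<xi>s i \<omega>))" for n \<omega>
    by (rule sum.reindex_bij_witness[of _ "\<lambda>i. i - 1" Suc]) auto
  ultimately show ?thesis by simp
qed

lemma F0_integrable: "integrable M (\<lambda>\<omega>. Fm x0 (\<xi> \<omega>))"
  by (rule integrable_if_norm_sq_integrable[OF _ F_sq]) measurable

lemma J_integrable: "integrable M (\<lambda>\<omega>. Jm x0 (\<xi> \<omega>))"
  by (rule integrable_if_norm_sq_integrable[OF _ J_sq]) measurable

lemma \<Lambda>_integrable: "integrable M (\<lambda>\<omega>. \<Lambda> (\<xi> \<omega>))"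
  by (rule square_integrable_imp_integrable[OF _ \<Lambda>_sq]) measurable

definition f0 :: "real^'q \<Rightarrow> real^'q" where "f0 y = expectation (\<lambda>\<omega>. F y (\<xi> \<omega>))"
definition J0 :: "real^'q^'q" where "J0 = expectation (\<lambda>\<omega>. Jm x0 (\<xi> \<omega>))"
definition fn :: "nat \<Rightarrow> 'w \<Rightarrow> real^'q \<Rightarrow> real^'q" where
  "fn n \<omega> y = (1 / real n) *\<^sub>R (\<Sum>i=1..n. F y (\<xi>s i \<omega>))"
definition Jn :: "nat \<Rightarrow> 'w \<Rightarrow> real^'q \<Rightarrow> real^'q^'q" where
  "Jn n \<omega> y = (1 / real n) *\<^sub>R (\<Sum>i=1..n. Jm y (\<xi>s i \<omega>))"

lemma AE_F_eq_Fm: "y \<in> U \<Longrightarrow> AE \<omega> in M. F y (\<xi> \<omega>) = Fm y (\<xi> \<omega>)"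
  using AE_G by eventually_elim (simp add: Fm_def)

lemma f0_eq: "y \<in> U \<Longrightarrow> f0 y = expectation (\<lambda>\<omega>. Fm y (\<xi> \<omega>))"
  unfolding f0_def using AE_F_eq_Fm F_integrable by (intro integral_cong_AE) auto

lemma norm_Jm_diff_le:
  assumes "s \<in> G" "y \<in> ball x0 \<delta>"
  shows "norm ((Jm y s - Jm x0 s) *v h) \<le> \<Lambda> s * norm (y - x0) * norm h"
proof -
  have "norm ((Jm y s - Jm x0 s) *v h) \<le> norm (Jm y s - Jm x0 s) * norm h"
    by (rule norm_matrix_vector_mult_le)
  also have "norm (Jm y s - Jm x0 s) \<le> \<Lambda> s * norm (y - x0)"
    using lipschitz[OF assms] norm_ge_zero[of "F y s - F x0 s"] assms \<delta> x0
    by (auto simp: Jm_def simp del: norm_ge_zero)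
  finally show ?thesis by (simp add: mult_right_mono)
qed

lemma norm_Fm_diff_le:
  assumes "s \<in> G" "y \<in> ball x0 \<delta>"
  shows "norm (Fm y s - Fm x0 s) \<le> \<Lambda> s * norm (y - x0)"
  using lipschitz[OF assms] norm_ge_zero[of "jacobian (\<lambda>x. F x s) (at y) - jacobian (\<lambda>x. F x s) (at x0)"] assms \<delta> x0
  by (auto simp: Fm_def simp del: norm_ge_zero)

lemma Fm_linearization_error:
  assumes "s \<in> G" "y \<in> ball x0 \<delta>"
  shows "norm (Fm y s - Fm x0 s - Jm x0 s *v (y - x0)) \<le> \<Lambda> s * (norm (y - x0))\<^sup>2"
proof -
  have "norm (F y s - F x0 s - Jm x0 s *v (y - x0)) \<le> \<Lambda> s * (norm (y - x0))\<^sup>2"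
  proof (rule linearization_error[OF _ matrix_vector_mul_linear \<Lambda>_nonneg _ assms(2)])
    fix v assume v: "v \<in> ball x0 \<delta>"
    then show diff: "(\<lambda>y. F y s) differentiable (at v)" using differentiable_F \<delta> assms by blast
    show "norm (frechet_derivative (\<lambda>y. F y s) (at v) h - Jm x0 s *v h) \<le> \<Lambda> s * norm (v - x0) * norm h" for h
      using norm_Jm_diff_le[OF assms(1) v, of h] v \<delta> assms(1) unfolding frechet_derivative_eq_jacobian[OF diff]
      by (auto simp: matrix_vector_mult_diff_rdistrib Jm_def)
  qed
  then show ?thesis using assms x0 \<delta> by (auto simp: Fm_def)
qed

text \<open>Differentiation under the integral: every sample function has linearisation error at
  most \<open>\<Lambda> s\<close> times the squared distance, and integrating this bound leaves a
  quadratic error for \<open>f0\<close>.\<close>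

lemma f0_derivative: "frechet_derivative f0 (at x0) = (*v) J0"
proof -
  let ?l = "expectation (\<lambda>\<omega>. \<Lambda> (\<xi> \<omega>))"
  have Jv: "integrable M (\<lambda>\<omega>. Jm x0 (\<xi> \<omega>) *v v)" "expectation (\<lambda>\<omega>. Jm x0 (\<xi> \<omega>) *v v) = J0 *v v" for v
    using integrable_bounded_linear[OF bounded_linear_matrix_vector_left J_integrable]
      integral_bounded_linear[OF bounded_linear_matrix_vector_left J_integrable] by (auto simp: J0_def)
  have err: "norm (f0 y - f0 x0 - J0 *v (y - x0)) \<le> ?l * (norm (y - x0))\<^sup>2" if y: "y \<in> ball x0 \<delta>" for y
  proof -
    have yU: "y \<in> U" using y \<delta> by blast
    have Fy: "integrable M (\<lambda>\<omega>. Fm y (\<xi> \<omega>))"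
      using integrable_cong_AE[of "\<lambda>\<omega>. F y (\<xi> \<omega>)" M "\<lambda>\<omega>. Fm y (\<xi> \<omega>)"] AE_F_eq_Fm[OF yU] F_integrable[OF yU] by auto
    have eq: "f0 y - f0 x0 - J0 *v (y - x0) = expectation (\<lambda>\<omega>. Fm y (\<xi> \<omega>) - Fm x0 (\<xi> \<omega>) - Jm x0 (\<xi> \<omega>) *v (y - x0))"
      using Fy F0_integrable Jv by (simp add: f0_eq yU x0)
    have "norm (f0 y - f0 x0 - J0 *v (y - x0)) \<le> expectation (\<lambda>\<omega>. norm (Fm y (\<xi> \<omega>) - Fm x0 (\<xi> \<omega>) - Jm x0 (\<xi> \<omega>) *v (y - x0)))"
      unfolding eq by (rule integral_norm_bound)
    also have "\<dots> \<le> expectation (\<lambda>\<omega>. \<Lambda> (\<xi> \<omega>) * (norm (y - x0))\<^sup>2)"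
    proof (rule integral_mono_AE)
      show "AE \<omega> in M. norm (Fm y (\<xi> \<omega>) - Fm x0 (\<xi> \<omega>) - Jm x0 (\<xi> \<omega>) *v (y - x0)) \<le> \<Lambda> (\<xi> \<omega>) * (norm (y - x0))\<^sup>2"
      proof (rule eventually_mono[OF AE_G])
        fix \<omega> assume "\<xi> \<omega> \<in> G"
        then show "norm (Fm y (\<xi> \<omega>) - Fm x0 (\<xi> \<omega>) - Jm x0 (\<xi> \<omega>) *v (y - x0)) \<le> \<Lambda> (\<xi> \<omega>) * (norm (y - x0))\<^sup>2"
          using y by (rule Fm_linearization_error)
      qed
      show "integrable M (\<lambda>\<omega>. norm (Fm y (\<xi> \<omega>) - Fm x0 (\<xi> \<omega>) - Jm x0 (\<xi> \<omega>) *v (y - x0)))"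
        by (intro integrable_norm Bochner_Integration.integrable_diff Fy F0_integrable Jv)
      show "integrable M (\<lambda>\<omega>. \<Lambda> (\<xi> \<omega>) * (norm (y - x0))\<^sup>2)"
        by (intro integrable_mult_left \<Lambda>_integrable)
    qed
    finally show ?thesis by simp
  qed
  have "(f0 has_derivative (*v) J0) (at x0)"
    unfolding has_derivative_at
  proof
    show "bounded_linear ((*v) J0)" by (rule matrix_vector_mul_bounded_linear)
    show "(\<lambda>h. norm (f0 (x0 + h) - f0 x0 - J0 *v h) / norm h) \<midarrow>0\<rightarrow> 0"
    proof (rule Lim_null_comparison)
      show "\<forall>\<^sub>F h in at 0. norm (norm (f0 (x0 + h) - f0 x0 - J0 *v h) / norm h) \<le> ?l * norm h"
        unfolding eventually_at
      proof (intro exI[of _ \<delta>] conjI ballI impI \<delta>)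
        fix h :: "real^'q" assume h: "h \<noteq> 0 \<and> dist h 0 < \<delta>"
        then have "norm (f0 (x0 + h) - f0 x0 - J0 *v h) \<le> ?l * (norm h)\<^sup>2"
          using err[of "x0 + h"] by (simp add: dist_norm)
        with h show "norm (norm (f0 (x0 + h) - f0 x0 - J0 *v h) / norm h) \<le> ?l * norm h"
          by (simp add: divide_simps power2_eq_square mult_ac)
      qed
      show "((\<lambda>h. ?l * norm h) \<longlongrightarrow> 0) (at (0::real^'q))"
        by (rule tendsto_mult_right_zero, rule tendsto_norm_zero, rule tendsto_ident_at)
    qed
  qed
  then show ?thesis using frechet_derivative_at by metis
qed

lemma Jn_mult: "Jn n \<omega> y *v h = (1 / real n) *\<^sub>R (\<Sum>i=1..n. Jm y (\<xi>s i \<omega>) *v h)"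
  unfolding Jn_def
  using linear_sum[OF bounded_linear.linear[OF bounded_linear_matrix_vector_left], of "\<lambda>i. Jm y (\<xi>s i \<omega>)" "{1..n}" h]
  by (simp add: scaleR_matrix_vector_assoc[symmetric])

lemma has_derivative_fn:
  assumes "\<forall>i\<ge>1. \<xi>s i \<omega> \<in> G" "y \<in> U"
  shows "(fn n \<omega> has_derivative (*v) (Jn n \<omega> y)) (at y)"
proof -
  have "((\<lambda>y. \<Sum>i=1..n. F y (\<xi>s i \<omega>)) has_derivative (\<lambda>h. \<Sum>i=1..n. Jm y (\<xi>s i \<omega>) *v h)) (at y)"
    using assms by (intro has_derivative_sum has_derivative_F) auto
  then have "((\<lambda>y. (1 / real n) *\<^sub>R (\<Sum>i=1..n. F y (\<xi>s i \<omega>))) has_derivative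
      (\<lambda>h. (1 / real n) *\<^sub>R (\<Sum>i=1..n. Jm y (\<xi>s i \<omega>) *v h))) (at y)"
    by (rule has_derivative_scaleR_right)
  then show ?thesis unfolding Jn_mult[symmetric] fn_def[abs_def] .
qed

lemma frechet_derivative_fn:
  "\<forall>i\<ge>1. \<xi>s i \<omega> \<in> G \<Longrightarrow> y \<in> U \<Longrightarrow> frechet_derivative (fn n \<omega>) (at y) = (*v) (Jn n \<omega> y)"
  using frechet_derivative_at[OF has_derivative_fn] by metis

text \<open>All limits are gathered in one almost sure event, so that the pathwise argument may fix
  a single \<open>\<omega>\<close>. Vector and matrix limits are taken entrywise, which involves
  finitely many events.\<close>

lemma AE_limits:
  "AE \<omega> in M. (\<forall>i\<ge>1. \<xi>s i \<omega> \<in> G)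
    \<and> (\<lambda>n. fn n \<omega> x0) \<longlonglongrightarrow> f0 x0 \<and> (\<lambda>n. Jn n \<omega> x0) \<longlonglongrightarrow> J0
    \<and> (\<lambda>n. (\<Sum>i=1..n. \<Lambda> (\<xi>s i \<omega>)) / n) \<longlonglongrightarrow> expectation (\<lambda>\<omega>. \<Lambda> (\<xi> \<omega>))
    \<and> (\<lambda>n. (\<Sum>i=1..n. (\<Lambda> (\<xi>s i \<omega>))\<^sup>2) / n) \<longlonglongrightarrow> expectation (\<lambda>\<omega>. (\<Lambda> (\<xi> \<omega>))\<^sup>2)
    \<and> (\<forall>i. (\<lambda>n. (\<Sum>k=1..n. Fm x0 (\<xi>s k \<omega>) $ i) / n) \<longlonglongrightarrow> expectation (\<lambda>\<omega>. Fm x0 (\<xi> \<omega>) $ i))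
    \<and> (\<forall>i j. (\<lambda>n. (\<Sum>k=1..n. Fm x0 (\<xi>s k \<omega>) $ i * Fm x0 (\<xi>s k \<omega>) $ j) / n)
          \<longlonglongrightarrow> expectation (\<lambda>\<omega>. Fm x0 (\<xi> \<omega>) $ i * Fm x0 (\<xi> \<omega>) $ j))"
proof -
  have mF [measurable]: "(\<lambda>s. Fm x0 s $ i) \<in> borel_measurable borel" for i
    unfolding cart_eq_inner_axis by measurable
  have mJ [measurable]: "(\<lambda>s. Jm x0 s $ i $ j) \<in> borel_measurable borel" for i j
  proof -
    have "Jm x0 s $ i $ j = Jm x0 s \<bullet> axis i (axis j 1)" for s by (simp add: inner_axis)
    then show ?thesis by simp
  qed
  have F1: "integrable M (\<lambda>\<omega>. Fm x0 (\<xi> \<omega>) $ i)" "expectation (\<lambda>\<omega>. Fm x0 (\<xi> \<omega>) $ i) = f0 x0 $ i" for i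
    using integrable_bounded_linear[OF bounded_linear_vec_nth F0_integrable]
      integral_bounded_linear[OF bounded_linear_vec_nth F0_integrable] x0 by (auto simp: f0_eq)
  have J1: "integrable M (\<lambda>\<omega>. Jm x0 (\<xi> \<omega>) $ i $ j)" "expectation (\<lambda>\<omega>. Jm x0 (\<xi> \<omega>) $ i $ j) = J0 $ i $ j" for i j
    using integrable_bounded_linear[OF bounded_linear_compose[OF bounded_linear_vec_nth bounded_linear_vec_nth] J_integrable]
      integral_bounded_linear[OF bounded_linear_compose[OF bounded_linear_vec_nth bounded_linear_vec_nth] J_integrable]
    by (auto simp: J0_def)
  have F2: "integrable M (\<lambda>\<omega>. Fm x0 (\<xi> \<omega>) $ i * Fm x0 (\<xi> \<omega>) $ j)" for i j
    by (rule covariance_quadratic_form(2)[OF _ F_sq]) measurable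
  have 1: "AE \<omega> in M. \<forall>i. (\<lambda>n. (\<Sum>k=1..n. Fm x0 (\<xi>s k \<omega>) $ i) / n) \<longlonglongrightarrow> expectation (\<lambda>\<omega>. Fm x0 (\<xi> \<omega>) $ i)"
    using strong_law_sample[OF mF F1(1)] by (subst AE_all_countable) auto
  have 2: "AE \<omega> in M. \<forall>i j. (\<lambda>n. (\<Sum>k=1..n. Jm x0 (\<xi>s k \<omega>) $ i $ j) / n) \<longlonglongrightarrow> J0 $ i $ j"
    using strong_law_sample[OF mJ J1(1)] unfolding J1(2) by (simp add: AE_all_countable)
  have 3: "AE \<omega> in M. \<forall>i j. (\<lambda>n. (\<Sum>k=1..n. Fm x0 (\<xi>s k \<omega>) $ i * Fm x0 (\<xi>s k \<omega>) $ j) / n)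
          \<longlonglongrightarrow> expectation (\<lambda>\<omega>. Fm x0 (\<xi> \<omega>) $ i * Fm x0 (\<xi> \<omega>) $ j)"
    using strong_law_sample[OF borel_measurable_times[OF mF mF] F2] by (simp add: AE_all_countable)
  have 4: "AE \<omega> in M. (\<lambda>n. (\<Sum>i=1..n. \<Lambda> (\<xi>s i \<omega>)) / n) \<longlonglongrightarrow> expectation (\<lambda>\<omega>. \<Lambda> (\<xi> \<omega>))"
    by (rule strong_law_sample[OF _ \<Lambda>_integrable]) measurable
  have 5: "AE \<omega> in M. (\<lambda>n. (\<Sum>i=1..n. (\<Lambda> (\<xi>s i \<omega>))\<^sup>2) / n) \<longlonglongrightarrow> expectation (\<lambda>\<omega>. (\<Lambda> (\<xi> \<omega>))\<^sup>2)"
    by (rule strong_law_sample[OF _ \<Lambda>_sq]) measurable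
  show ?thesis
    using AE_sample_G 1 2 3 4 5
  proof eventually_elim
    case (elim \<omega>)
    have "(\<lambda>n. fn n \<omega> x0) \<longlonglongrightarrow> f0 x0"
    proof (rule vec_tendstoI)
      fix i
      have "fn n \<omega> x0 $ i = (\<Sum>k=1..n. Fm x0 (\<xi>s k \<omega>) $ i) / n" for n
        using elim(1) x0 by (simp add: fn_def Fm_def)
      then show "(\<lambda>n. fn n \<omega> x0 $ i) \<longlonglongrightarrow> f0 x0 $ i" using elim(2) F1(2) by simp
    qed
    moreover have "(\<lambda>n. Jn n \<omega> x0) \<longlonglongrightarrow> J0"
    proof (intro vec_tendstoI)
      fix i j
      show "(\<lambda>n. Jn n \<omega> x0 $ i $ j) \<longlonglongrightarrow> J0 $ i $ j" using elim(3) by (simp add: Jn_def)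
    qed
    ultimately show ?case using elim by blast
  qed
qed

end

section \<open>Asymptotics of the solutions\<close>

text \<open>The statistics differ from measurable functions on a null set, where a sample point lies
  outside \<open>G\<close> and nothing is known about \<open>F\<close>.\<close>

lemma (in prob_space) measurable_completion_AE:
  fixes f g :: "'a \<Rightarrow> 'b::topological_space"
  assumes "f \<in> borel_measurable M" "AE \<omega> in M. f \<omega> = g \<omega>"
  shows "g \<in> borel_measurable (completion M)"
proof (rule measurableI)
  fix A :: "'b set" assume A: "A \<in> sets borel"
  have "AE \<omega> in completion M. \<omega> \<in> f -` A \<inter> space M \<longleftrightarrow> \<omega> \<in> g -` A \<inter> space M"
    using AE_completion[OF assms(2)] by eventually_elim auto
  moreover have "f -` A \<inter> space M \<in> sets (completion M)"
    using measurable_sets[OF assms(1) A] by simp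
  ultimately have "g -` A \<inter> space M \<in> sets (completion M)"
    by (rule completion.in_sets_AE) auto
  then show "g -` A \<inter> space (completion M) \<in> sets (completion M)" by simp
qed simp

lemma has_B_derivative_closest_point_polyhedron:
  fixes S :: "'a::euclidean_space set"
  assumes "polyhedron S" "S \<noteq> {}"
  shows "has_B_derivative (closest_point S) (B_derivative (closest_point S) z) z"
proof -
  interpret critical_cone S z "closest_point S z"
    "tangent_cone S (closest_point S z) \<inter> {v. v \<bullet> (z - closest_point S z) = 0}"
    using assms by unfold_locales auto
  show ?thesis using has_B_derivative_closest_point B_derivative_closest_point by simp
qed

lemma sample_covariance_cong:
  assumes "\<And>k. k \<in> {1..n} \<Longrightarrow> y k = w k"
  shows "sample_covariance_matrix n y = sample_covariance_matrix n w"
proof -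
  have "(\<Sum>k=1..n. y k) = (\<Sum>k=1..n. w k)"
    by (rule sum.cong) (auto simp: assms)
  then have m: "sample_mean n y = sample_mean n w"
    unfolding sample_mean_def by (simp only:)
  have "(\<Sum>k=1..n. (y k - sample_mean n w) $ i * (y k - sample_mean n w) $ j)
      = (\<Sum>k=1..n. (w k - sample_mean n w) $ i * (w k - sample_mean n w) $ j)" for i j
    by (rule sum.cong) (auto simp: assms)
  then show ?thesis unfolding sample_covariance_matrix_def m by (simp only:)
qed

lemma borel_measurable_matrix_vector_mult [measurable (raw)]:
  fixes A :: "'a \<Rightarrow> real^'n^'m"
  assumes [measurable]: "A \<in> borel_measurable M" "v \<in> borel_measurable M"
  shows "(\<lambda>\<omega>. A \<omega> *v v \<omega>) \<in> borel_measurable M"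
proof -
  have "(\<lambda>p :: (real^'n^'m) \<times> (real^'n). fst p *v snd p) \<in> borel_measurable borel"
    by (intro borel_measurable_continuous_onI continuous_intros)
  from measurable_compose[OF borel_measurable_Pair[OF assms] this] show ?thesis by simp
qed

lemma borel_measurable_sample_covariance:
  fixes y :: "nat \<Rightarrow> 'a \<Rightarrow> real^'n"
  assumes [measurable]: "\<And>k. k \<in> {1..n} \<Longrightarrow> y k \<in> borel_measurable M"
  shows "(\<lambda>\<omega>. sample_covariance_matrix n (\<lambda>k. y k \<omega>)) \<in> borel_measurable M"
proof (rule borel_measurable_euclidean_space[THEN iffD2], rule ballI)
  fix b :: "real^'n^'n" assume "b \<in> Basis"
  then obtain i j where b: "b = axis i (axis j 1)" by (auto simp: Basis_vec_def)
  have comp: "(\<lambda>\<omega>. (y k \<omega> - sample_mean n (\<lambda>k. y k \<omega>)) $ i) \<in> borel_measurable M" if "k \<in> {1..n}" for k i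
    unfolding sample_mean_def cart_eq_inner_axis using that by measurable
  have "sample_covariance_matrix n (\<lambda>k. y k \<omega>) \<bullet> b
      = (\<Sum>k=1..n. (y k \<omega> - sample_mean n (\<lambda>k. y k \<omega>)) $ i * (y k \<omega> - sample_mean n (\<lambda>k. y k \<omega>)) $ j) / (real n - 1)" for \<omega>
    by (simp add: b inner_axis sample_covariance_matrix_def)
  then show "(\<lambda>\<omega>. sample_covariance_matrix n (\<lambda>k. y k \<omega>) \<bullet> b) \<in> borel_measurable M"
    by (simp only:) (intro borel_measurable_divide borel_measurable_sum borel_measurable_times comp borel_measurable_const)
qed

context regular_sample
begin

lemma
  fixes h :: "real^'d \<Rightarrow> real"
  assumes [measurable]: "h \<in> borel_measurable borel" and "i \<ge> 1"
  shows sample_expectation: "expectation (\<lambda>\<omega>. h (\<xi>s i \<omega>)) = expectation (\<lambda>\<omega>. h (\<xi> \<omega>))"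
    and sample_integrable: "integrable M (\<lambda>\<omega>. h (\<xi>s i \<omega>)) \<longleftrightarrow> integrable M (\<lambda>\<omega>. h (\<xi> \<omega>))"
  using integral_distr[of "\<xi>s i" M borel h] integral_distr[of \<xi> M borel h] ident[OF assms(2)]
    integrable_distr_eq[of "\<xi>s i" M borel h] integrable_distr_eq[of \<xi> M borel h] assms(2) by auto

lemma Jn_lipschitz:
  assumes "\<forall>i\<ge>1. \<xi>s i \<omega> \<in> G" "y \<in> ball x0 \<delta>"
  shows "norm (Jn n \<omega> y *v h - Jn n \<omega> x0 *v h) \<le> (\<Sum>i=1..n. \<Lambda> (\<xi>s i \<omega>)) / n * norm (y - x0) * norm h"
proof -
  have "Jn n \<omega> y *v h - Jn n \<omega> x0 *v h = (1 / real n) *\<^sub>R (\<Sum>i=1..n. (Jm y (\<xi>s i \<omega>) - Jm x0 (\<xi>s i \<omega>)) *v h)"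
    by (simp add: Jn_mult matrix_vector_mult_diff_rdistrib sum_subtractf scaleR_diff_right)
  then have "norm (Jn n \<omega> y *v h - Jn n \<omega> x0 *v h) = norm (\<Sum>i=1..n. (Jm y (\<xi>s i \<omega>) - Jm x0 (\<xi>s i \<omega>)) *v h) / n"
    by simp
  also have "\<dots> \<le> (\<Sum>i=1..n. \<Lambda> (\<xi>s i \<omega>) * norm (y - x0) * norm h) / n"
    using assms by (intro divide_right_mono sum_norm_le norm_Jm_diff_le) auto
  also have "\<dots> = (\<Sum>i=1..n. \<Lambda> (\<xi>s i \<omega>)) / n * norm (y - x0) * norm h"
    by (simp add: sum_distrib_right[symmetric])
  finally show ?thesis .
qed

end

section \<open>The whitened statistic and its limit law\<close>

locale saa_solutions = regular_sample U F G M \<xi> \<xi>s x0 \<Lambda> \<delta>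
  for U :: "(real^'q) set" and F :: "real^'q \<Rightarrow> real^'d \<Rightarrow> real^'q" and G and M :: "'w measure"
    and \<xi> \<xi>s x0 \<Lambda> \<delta> +
  fixes S Z K :: "(real^'q) set" and z0 :: "real^'q" and LK LK' :: "real^'q \<Rightarrow> real^'q"
    and z :: "nat \<Rightarrow> 'w \<Rightarrow> real^'q"
  assumes S: "polyhedron S" "S \<noteq> {}" and z0_projection: "x0 = closest_point S z0" and z0: "z0 = x0 - f0 x0"
    and K: "K = tangent_cone S x0 \<inter> {v. v \<bullet> (z0 - x0) = 0}"
    and LK: "\<And>h. LK h = J0 *v closest_point K h + h - closest_point K h" "homeomorphism UNIV UNIV LK LK'"
    and Z: "z0 \<in> interior Z"
    and z_measurable [measurable]: "\<And>n. z n \<in> borel_measurable M"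
    and z_projection: "\<And>n \<omega>. \<omega> \<in> space M \<Longrightarrow> closest_point S (z n \<omega>) \<in> U"
    and z_solution: "AE \<omega> in M. \<forall>\<^sub>F n in sequentially.
      {y \<in> Z. closest_point S y \<in> U \<and> normal_map (fn n \<omega>) S y = 0} = {z n \<omega>}"
    and nonsingular: "invertible (covariance_matrix M (\<lambda>\<omega>. Fm x0 (\<xi> \<omega>)))"
begin

definition xn :: "nat \<Rightarrow> 'w \<Rightarrow> real^'q" where "xn n \<omega> = closest_point S (z n \<omega>)"
definition Sig0 :: "real^'q^'q" where "Sig0 = covariance_matrix M (\<lambda>\<omega>. Fm x0 (\<xi> \<omega>))"
definition Sig :: "nat \<Rightarrow> 'w \<Rightarrow> real^'q^'q" where
  "Sig n \<omega> = sample_covariance_matrix n (\<lambda>i. F (xn n \<omega>) (\<xi>s i \<omega>))"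
definition D :: "nat \<Rightarrow> 'w \<Rightarrow> real^'q" where
  "D n \<omega> = normal_map_deriv (fn n \<omega>) S (z n \<omega>) (z0 - z n \<omega>)"
definition V :: "nat \<Rightarrow> 'w \<Rightarrow> real^'q" where
  "V n \<omega> = - (sqrt (real n) *\<^sub>R (inv_sqrt (Sig n \<omega>) *v D n \<omega>))"
text \<open>The leading term of \<open>V\<close>: an exact normalised i.i.d. sum, whitened with the
  fixed matrix \<open>Sig0\<close>. It uses \<open>Fm\<close> to be measurable over \<open>M\<close>
  itself, and indices from 0 as in the central limit theorem.\<close>

definition W :: "nat \<Rightarrow> 'w \<Rightarrow> real^'q" where
  "W n \<omega> = (1 / sqrt (real n)) *\<^sub>R (\<Sum>i<n. - (inv_sqrt Sig0 *v (Fm x0 (\<xi>s (Suc i) \<omega>) - f0 x0)))"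

lemma continuous_on_projection: "continuous_on A (closest_point S)"
  using S by (intro continuous_on_closest_point polyhedron_imp_convex polyhedron_imp_closed)

lemma projection_measurable [measurable]: "closest_point S \<in> borel_measurable borel"
  by (rule borel_measurable_continuous_onI[OF continuous_on_projection])

lemma xn_measurable [measurable]: "xn n \<in> borel_measurable M"
  unfolding xn_def[abs_def] by measurable

lemma B_derivative_measurable [measurable (raw)]:
  assumes [measurable]: "Y \<in> borel_measurable N" "H \<in> borel_measurable N"
  shows "(\<lambda>\<omega>. B_derivative (closest_point S) (Y \<omega>) (H \<omega>)) \<in> borel_measurable N"
proof (rule borel_measurable_LIMSEQ_metric)
  show "(\<lambda>\<omega>. real (Suc k) *\<^sub>R (closest_point S (Y \<omega> + (1 / real (Suc k)) *\<^sub>R H \<omega>) - closest_point S (Y \<omega>)))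
      \<in> borel_measurable N" for k by measurable
  show "(\<lambda>k. real (Suc k) *\<^sub>R (closest_point S (Y \<omega> + (1 / real (Suc k)) *\<^sub>R H \<omega>) - closest_point S (Y \<omega>)))
      \<longlonglongrightarrow> B_derivative (closest_point S) (Y \<omega>) (H \<omega>)" for \<omega>
    by (rule has_B_derivative_imp_LIMSEQ[OF has_B_derivative_closest_point_polyhedron[OF S]])
qed

text \<open>The sample average is known to be differentiable at \<open>xn n \<omega>\<close> only
  when all sample points lie in \<open>G\<close>; elsewhere the derivative is arbitrary, hence the
  completion.\<close>

lemma D_measurable [measurable]: "D n \<in> borel_measurable (completion M)"
proof (rule measurable_completion_AE)
  let ?b = "\<lambda>\<omega>. B_derivative (closest_point S) (z n \<omega>) (z0 - z n \<omega>)"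
  have [measurable]: "(\<lambda>\<omega>. \<Sum>i=1..n. Jm (xn n \<omega>) (\<xi>s i \<omega>) *v ?b \<omega>) \<in> borel_measurable M"
    by (intro borel_measurable_sum measurable_Jm_mult) auto
  show "(\<lambda>\<omega>. (1 / real n) *\<^sub>R (\<Sum>i=1..n. Jm (xn n \<omega>) (\<xi>s i \<omega>) *v ?b \<omega>) + (z0 - z n \<omega>) - ?b \<omega>) \<in> borel_measurable M"
    by measurable
  show "AE \<omega> in M. (1 / real n) *\<^sub>R (\<Sum>i=1..n. Jm (xn n \<omega>) (\<xi>s i \<omega>) *v ?b \<omega>) + (z0 - z n \<omega>) - ?b \<omega> = D n \<omega>"
    using AE_sample_G AE_space
  proof eventually_elim
    case (elim \<omega>)
    show ?case
      unfolding D_def normal_map_deriv_def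
      using frechet_derivative_fn[OF elim(1) z_projection[OF elim(2)]] by (simp add: xn_def Jn_mult)
  qed
qed

lemma Sig_eq:
  assumes "\<forall>i\<ge>1. \<xi>s i \<omega> \<in> G" "\<omega> \<in> space M"
  shows "Sig n \<omega> = sample_covariance_matrix n (\<lambda>i. Fm (xn n \<omega>) (\<xi>s i \<omega>))"
  unfolding Sig_def using assms z_projection by (intro sample_covariance_cong) (auto simp: Fm_def xn_def)

lemma Sig_measurable [measurable]: "Sig n \<in> borel_measurable (completion M)"
proof (rule measurable_completion_AE)
  show "(\<lambda>\<omega>. sample_covariance_matrix n (\<lambda>i. Fm (xn n \<omega>) (\<xi>s i \<omega>))) \<in> borel_measurable M"
    by (intro borel_measurable_sample_covariance measurable_Fm) auto
  show "AE \<omega> in M. sample_covariance_matrix n (\<lambda>i. Fm (xn n \<omega>) (\<xi>s i \<omega>)) = Sig n \<omega>"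
    using AE_sample_G AE_space by eventually_elim (simp add: Sig_eq)
qed

lemma psd_Sig: "psd (Sig n \<omega>)"
  unfolding Sig_def by (rule psd_sample_covariance)

lemma V_measurable [measurable]: "V n \<in> borel_measurable (completion M)"
proof -
  have [measurable]: "(\<lambda>\<omega>. psd_sqrt (Sig n \<omega>)) \<in> borel_measurable (completion M)"
    using psd_Sig by (intro borel_measurable_psd_sqrt) auto
  show ?thesis
    unfolding V_def[abs_def] inv_sqrt_def by measurable
qed

lemma W_measurable [measurable]: "W n \<in> borel_measurable M"
proof -
  have [measurable]: "(\<lambda>\<omega>. Fm x0 (\<xi>s (Suc i) \<omega>)) \<in> borel_measurable M" for i
    by (intro measurable_Fm) auto
  show ?thesis unfolding W_def[abs_def] by measurable
qed

lemma psd_Sig0: "psd Sig0"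
  unfolding Sig0_def by (rule covariance_quadratic_form(5)[OF _ F_sq]) measurable

lemma invertible_Sig0: "invertible Sig0"
  unfolding Sig0_def by (rule nonsingular)

lemma AE_convergence:
  "AE \<omega> in M. (\<lambda>n. Sig n \<omega>) \<longlonglongrightarrow> Sig0 \<and> (\<forall>i\<ge>1. \<xi>s i \<omega> \<in> G) \<and>
    (\<exists>\<epsilon>. \<epsilon> \<longlonglongrightarrow> 0 \<and> (\<forall>\<^sub>F n in sequentially. norm (D n \<omega> - (fn n \<omega> x0 - f0 x0)) \<le> \<epsilon> n * norm (fn n \<omega> x0 - f0 x0)))"
  using AE_limits z_solution AE_space
proof eventually_elim
  case (elim \<omega>)
  then have G: "\<forall>i\<ge>1. \<xi>s i \<omega> \<in> G"
    and flim: "(\<lambda>n. fn n \<omega> x0) \<longlonglongrightarrow> f0 x0" and Jlim: "(\<lambda>n. Jn n \<omega> x0) \<longlonglongrightarrow> J0"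
    and \<Lambda>lim: "(\<lambda>n. (\<Sum>i=1..n. \<Lambda> (\<xi>s i \<omega>)) / n) \<longlonglongrightarrow> expectation (\<lambda>\<omega>. \<Lambda> (\<xi> \<omega>))"
    and \<Lambda>2lim: "(\<lambda>n. (\<Sum>i=1..n. (\<Lambda> (\<xi>s i \<omega>))\<^sup>2) / n) \<longlonglongrightarrow> expectation (\<lambda>\<omega>. (\<Lambda> (\<xi> \<omega>))\<^sup>2)"
    and F1: "\<And>i. (\<lambda>n. (\<Sum>k=1..n. Fm x0 (\<xi>s k \<omega>) $ i) / n) \<longlonglongrightarrow> expectation (\<lambda>\<omega>. Fm x0 (\<xi> \<omega>) $ i)"
    and F2: "\<And>i j. (\<lambda>n. (\<Sum>k=1..n. Fm x0 (\<xi>s k \<omega>) $ i * Fm x0 (\<xi>s k \<omega>) $ j) / n)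
          \<longlonglongrightarrow> expectation (\<lambda>\<omega>. Fm x0 (\<xi> \<omega>) $ i * Fm x0 (\<xi> \<omega>) $ j)"
    by blast+
  \<comment> \<open>The averaged Lipschitz constants converge to the expectation, so they are
    eventually below the expectation plus one.\<close>
  let ?l = "expectation (\<lambda>\<omega>. \<Lambda> (\<xi> \<omega>)) + 1"
  interpret normal_map_approximation S z0 x0 K "f0 x0" "(*v) J0" LK LK' "\<lambda>n. fn n \<omega>"
    "\<lambda>n. (*v) (Jn n \<omega> x0)" "\<lambda>n. norm (Jn n \<omega> x0 - J0)" ?l \<delta>
  proof (intro normal_map_approximation.intro critical_cone.intro normal_map_approximation_axioms.intro)
    show "fn n \<omega> differentiable at y" if "y \<in> ball x0 \<delta>" for n y
      using has_derivative_fn[OF G] that \<delta> differentiableI by blast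
    have "\<forall>\<^sub>F n in sequentially. (\<Sum>i=1..n. \<Lambda> (\<xi>s i \<omega>)) / n < ?l"
      using \<Lambda>lim by (rule order_tendstoD) simp
    then show "\<forall>\<^sub>F n in sequentially. \<forall>y\<in>ball x0 \<delta>. \<forall>h.
        norm (frechet_derivative (fn n \<omega>) (at y) h - Jn n \<omega> x0 *v h) \<le> ?l * norm (y - x0) * norm h"
    proof eventually_elim
      case (elim n)
      show ?case
      proof (intro ballI allI)
        fix y h assume y: "y \<in> ball x0 \<delta>"
        then have "frechet_derivative (fn n \<omega>) (at y) = (*v) (Jn n \<omega> y)"
          using \<delta> by (intro frechet_derivative_fn[OF G]) auto
        then have "norm (frechet_derivative (fn n \<omega>) (at y) h - Jn n \<omega> x0 *v h)
            \<le> (\<Sum>i=1..n. \<Lambda> (\<xi>s i \<omega>)) / n * norm (y - x0) * norm h"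
          using Jn_lipschitz[OF G y] by simp
        also have "\<dots> \<le> ?l * norm (y - x0) * norm h"
          using elim by (intro mult_right_mono) auto
        finally show "norm (frechet_derivative (fn n \<omega>) (at y) h - Jn n \<omega> x0 *v h) \<le> ?l * norm (y - x0) * norm h" .
      qed
    qed
    show "linear ((*v) J0)" "linear ((*v) (Jn n \<omega> x0))" for n
      by (rule matrix_vector_mul_linear)+
    show "norm (Jn n \<omega> x0 *v h - J0 *v h) \<le> norm (Jn n \<omega> x0 - J0) * norm h" for n h
      unfolding matrix_vector_mult_diff_rdistrib[symmetric] by (rule norm_matrix_vector_mult_le)
    show "(\<lambda>n. norm (Jn n \<omega> x0 - J0)) \<longlonglongrightarrow> 0"
      using Jlim by (simp add: LIM_zero_iff tendsto_norm_zero_iff)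
    show "polyhedron S" "S \<noteq> {}" by (rule S)+
    show "x0 = closest_point S z0" by (rule z0_projection)
    show "z0 = x0 - f0 x0" by (rule z0)
    show "K = tangent_cone S x0 \<inter> {v. v \<bullet> (z0 - x0) = 0}" by (rule K)
    show "LK h = J0 *v closest_point K h + h - closest_point K h" for h by (rule LK(1))
    show "homeomorphism UNIV UNIV LK LK'" by (rule LK(2))
    show "\<delta> > 0" by (rule \<delta>(1))
    show "(\<lambda>n. fn n \<omega> x0) \<longlonglongrightarrow> f0 x0" by (rule flim)
  qed
  note conv = solutions_converge[OF Z open_U x0 elim(2)]
  have "(\<lambda>n. closest_point S (z n \<omega>)) \<longlonglongrightarrow> closest_point S z0"
    by (rule continuous_on_tendsto_compose[OF continuous_on_projection[of UNIV] conv(1)]) auto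
  then have xlim: "(\<lambda>n. xn n \<omega>) \<longlonglongrightarrow> x0" by (simp add: xn_def z0_projection[symmetric])
  have "\<forall>\<^sub>F n in sequentially. xn n \<omega> \<in> ball x0 \<delta>"
    using xlim \<delta> by (intro topological_tendstoD) auto
  then have pert: "\<forall>\<^sub>F n in sequentially. \<forall>k\<ge>1. norm (Fm (xn n \<omega>) (\<xi>s k \<omega>) - Fm x0 (\<xi>s k \<omega>)) \<le> \<Lambda> (\<xi>s k \<omega>) * norm (xn n \<omega> - x0)"
    by eventually_elim (use G norm_Fm_diff_le in blast)
  have "(\<lambda>n. sample_covariance_matrix n (\<lambda>i. Fm (xn n \<omega>) (\<xi>s i \<omega>))) \<longlonglongrightarrow>
      (\<chi> i j. expectation (\<lambda>\<omega>. Fm x0 (\<xi> \<omega>) $ i * Fm x0 (\<xi> \<omega>) $ j) - expectation (\<lambda>\<omega>. Fm x0 (\<xi> \<omega>) $ i) * expectation (\<lambda>\<omega>. Fm x0 (\<xi> \<omega>) $ j))"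
    using F1 F2 \<Lambda>2lim _ _ _ pert
  proof (rule sample_covariance_tendsto)
    show "(\<lambda>n. norm (xn n \<omega> - x0)) \<longlonglongrightarrow> 0" using xlim by (simp add: LIM_zero_iff tendsto_norm_zero_iff)
  qed (use \<Lambda>_nonneg in auto)
  also have "(\<chi> i j. expectation (\<lambda>\<omega>. Fm x0 (\<xi> \<omega>) $ i * Fm x0 (\<xi> \<omega>) $ j) - expectation (\<lambda>\<omega>. Fm x0 (\<xi> \<omega>) $ i) * expectation (\<lambda>\<omega>. Fm x0 (\<xi> \<omega>) $ j)) = Sig0"
    unfolding Sig0_def by (rule covariance_quadratic_form(3)[symmetric, OF _ F_sq]) measurable
  finally have "(\<lambda>n. Sig n \<omega>) \<longlonglongrightarrow> Sig0"
    using Sig_eq[OF G elim(3)] by simp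
  with conv(2) G show ?case by (simp add: D_def)
qed

lemma AE_eventually_invertible: "AE \<omega> in M. \<forall>\<^sub>F n in sequentially. invertible (Sig n \<omega>)"
  using AE_convergence
proof eventually_elim
  case (elim \<omega>)
  then show ?case
    using topological_tendstoD[of "\<lambda>n. Sig n \<omega>" Sig0 sequentially "{A. invertible A}"] open_invertible invertible_Sig0
    by auto
qed

lemma W_eq:
  assumes "\<forall>i\<ge>1. \<xi>s i \<omega> \<in> G"
  shows "W n \<omega> = - (sqrt (real n) *\<^sub>R (inv_sqrt Sig0 *v (fn n \<omega> x0 - f0 x0)))"
proof (cases "n = 0")
  case False
  have "(\<Sum>i<n. - (inv_sqrt Sig0 *v (Fm x0 (\<xi>s (Suc i) \<omega>) - f0 x0)))
      = - (inv_sqrt Sig0 *v (\<Sum>i<n. Fm x0 (\<xi>s (Suc i) \<omega>) - f0 x0))"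
    by (simp add: sum_negf linear_sum[OF matrix_vector_mul_linear] o_def)
  also have "(\<Sum>i<n. Fm x0 (\<xi>s (Suc i) \<omega>) - f0 x0) = (\<Sum>i=1..n. F x0 (\<xi>s i \<omega>)) - real n *\<^sub>R f0 x0"
  proof -
    have "(\<Sum>i<n. Fm x0 (\<xi>s (Suc i) \<omega>)) = (\<Sum>i=1..n. F x0 (\<xi>s i \<omega>))"
      using assms x0 by (intro sum.reindex_bij_witness[of _ "\<lambda>i. i - 1" Suc]) (auto simp: Fm_def)
    then show ?thesis by (simp add: sum_subtractf scaleR_conv_of_real sum_constant_scaleR)
  qed
  also have "\<dots> = real n *\<^sub>R (fn n \<omega> x0 - f0 x0)"
    using False by (simp add: fn_def scaleR_diff_right)
  finally have "W n \<omega> = - ((1 / sqrt (real n) * real n) *\<^sub>R (inv_sqrt Sig0 *v (fn n \<omega> x0 - f0 x0)))"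
    by (simp add: W_def matrix_vector_mult_scaleR)
  also have "1 / sqrt (real n) * real n = sqrt (real n)"
    using False by (simp add: real_div_sqrt)
  finally show ?thesis .
qed (simp add: W_def)

text \<open>Whitening by \<open>inv_sqrt Sig0\<close> turns the covariance into the identity, so the
  projection of one summand on \<open>u\<close> has variance \<open>(norm u)\<^sup>2\<close>, as the
  vector central limit theorem requires.\<close>

lemma
  fixes g :: "real^'q \<Rightarrow> real"
  shows W_sq_integrable: "integrable M (\<lambda>\<omega>. (norm (W n \<omega>))\<^sup>2)"
    and W_sq_le: "expectation (\<lambda>\<omega>. (norm (W n \<omega>))\<^sup>2) \<le> CARD('q)"
    and W_limit: "continuous_on UNIV g \<Longrightarrow> (\<And>x. \<bar>g x\<bar> \<le> B) \<Longrightarrow>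
      (\<lambda>n. expectation (\<lambda>\<omega>. g (W n \<omega>))) \<longlonglongrightarrow> (\<integral>v. g v \<partial>std_normal_vec)"
proof -
  let ?R = "inv_sqrt Sig0"
  define h where "h s = - (?R *v (Fm x0 s - f0 x0))" for s
  have [measurable]: "h \<in> borel_measurable borel"
  proof -
    have [measurable]: "(\<lambda>s. Fm x0 s) \<in> borel_measurable borel" by (intro measurable_Fm) auto
    show ?thesis unfolding h_def[abs_def] by measurable
  qed
  have uh: "u \<bullet> h s = - ((?R *v u) \<bullet> (Fm x0 s - f0 x0))" for u s
    using inv_sqrt_sym[OF psd_Sig0 invertible_Sig0, of u "Fm x0 s - f0 x0"] by (simp add: h_def)
  have m: "expectation (\<lambda>\<omega>. Fm x0 (\<xi> \<omega>)) = f0 x0" using f0_eq x0 by simp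
  have sq: "integrable M (\<lambda>\<omega>. (norm (h (\<xi> \<omega>)))\<^sup>2)"
  proof (rule Bochner_Integration.integrable_bound)
    show "integrable M (\<lambda>\<omega>. (norm ?R)\<^sup>2 * (2 * (norm (Fm x0 (\<xi> \<omega>)))\<^sup>2 + 2 * (norm (f0 x0))\<^sup>2))"
      using F_sq by simp
    have "(norm (h s))\<^sup>2 \<le> (norm ?R)\<^sup>2 * (2 * (norm (Fm x0 s))\<^sup>2 + 2 * (norm (f0 x0))\<^sup>2)" for s
    proof -
      have "norm (h s) \<le> norm ?R * norm (Fm x0 s - f0 x0)"
        unfolding h_def norm_minus_cancel by (rule norm_matrix_vector_mult_le)
      also have "\<dots> \<le> norm ?R * (norm (Fm x0 s) + norm (f0 x0))"
        by (intro mult_left_mono norm_triangle_ineq4) simp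
      finally have "(norm (h s))\<^sup>2 \<le> (norm ?R * (norm (Fm x0 s) + norm (f0 x0)))\<^sup>2"
        by (intro power_mono) auto
      also have "\<dots> = (norm ?R)\<^sup>2 * (norm (Fm x0 s) + norm (f0 x0))\<^sup>2" by (rule power_mult_distrib)
      also have "\<dots> \<le> (norm ?R)\<^sup>2 * (2 * (norm (Fm x0 s))\<^sup>2 + 2 * (norm (f0 x0))\<^sup>2)"
        using sum_squares_bound[of "norm (Fm x0 s)" "norm (f0 x0)"]
        by (intro mult_left_mono) (auto simp: power2_sum)
      finally show ?thesis .
    qed
    then show "AE \<omega> in M. norm ((norm (h (\<xi> \<omega>)))\<^sup>2) \<le> norm ((norm ?R)\<^sup>2 * (2 * (norm (Fm x0 (\<xi> \<omega>)))\<^sup>2 + 2 * (norm (f0 x0))\<^sup>2))"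
      by simp
  qed simp
  have c3: "integrable M (\<lambda>\<omega>. (norm (h (\<xi>s (Suc 0) \<omega>)))\<^sup>2)"
    using sq by (subst sample_integrable) auto
  have c4: "expectation (\<lambda>\<omega>. u \<bullet> h (\<xi>s (Suc 0) \<omega>)) = 0" for u
  proof -
    have "expectation (\<lambda>\<omega>. u \<bullet> h (\<xi>s (Suc 0) \<omega>)) = expectation (\<lambda>\<omega>. u \<bullet> h (\<xi> \<omega>))"
      by (rule sample_expectation) auto
    also have "\<dots> = - ((?R *v u) \<bullet> expectation (\<lambda>\<omega>. Fm x0 (\<xi> \<omega>) - f0 x0))"
      unfolding uh using F0_integrable by (subst integral_minus, subst integral_inner_right) auto
    also have "expectation (\<lambda>\<omega>. Fm x0 (\<xi> \<omega>) - f0 x0) = 0"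
      using F0_integrable m by (simp add: prob_space)
    finally show ?thesis by simp
  qed
  have c5: "expectation (\<lambda>\<omega>. (u \<bullet> h (\<xi>s (Suc 0) \<omega>))\<^sup>2) = (norm u)\<^sup>2" for u
  proof -
    have "expectation (\<lambda>\<omega>. (u \<bullet> h (\<xi>s (Suc 0) \<omega>))\<^sup>2) = expectation (\<lambda>\<omega>. (u \<bullet> h (\<xi> \<omega>))\<^sup>2)"
      by (rule sample_expectation) auto
    also have "\<dots> = expectation (\<lambda>\<omega>. ((?R *v u) \<bullet> (Fm x0 (\<xi> \<omega>) - expectation (\<lambda>\<omega>. Fm x0 (\<xi> \<omega>))))\<^sup>2)"
      unfolding uh m by simp
    also have "\<dots> = (?R *v u) \<bullet> (Sig0 *v (?R *v u))"
      unfolding Sig0_def by (rule covariance_quadratic_form(4)[symmetric, OF _ F_sq]) measurable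
    also have "\<dots> = u \<bullet> ((?R ** Sig0 ** ?R) *v u)"
      by (simp add: inv_sqrt_sym[OF psd_Sig0 invertible_Sig0] matrix_vector_mul_assoc[symmetric])
    also have "\<dots> = (norm u)\<^sup>2"
      by (simp add: inv_sqrt_sandwich[OF psd_Sig0 invertible_Sig0] power2_norm_eq_inner)
    finally show ?thesis .
  qed
  have c1: "indep_vars (\<lambda>_. borel) (\<lambda>i \<omega>. h (\<xi>s (Suc i) \<omega>)) UNIV"
    by (rule indep_vars_compose2[OF indep_sample_Suc]) simp
  have c2: "distr M borel (\<lambda>\<omega>. h (\<xi>s (Suc i) \<omega>)) = distr M borel (\<lambda>\<omega>. h (\<xi>s (Suc 0) \<omega>))" for i
    using ident[of "Suc i"] ident[of "Suc 0"] distr_distr[of h borel borel "\<xi>s (Suc i)" M]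
      distr_distr[of h borel borel "\<xi>s (Suc 0)" M] by (simp add: comp_def)
  have W: "W = (\<lambda>n \<omega>. (1 / sqrt (real n)) *\<^sub>R (\<Sum>i<n. h (\<xi>s (Suc i) \<omega>)))"
    by (simp add: W_def h_def fun_eq_iff)
  note clt = central_limit_theorem_vec[OF c1 c2 c3 c4 c5]
  show "integrable M (\<lambda>\<omega>. (norm (W n \<omega>))\<^sup>2)"
    unfolding W by (rule clt(1))
  show "expectation (\<lambda>\<omega>. (norm (W n \<omega>))\<^sup>2) \<le> CARD('q)"
    unfolding W by (rule clt(2))
  show "(\<lambda>n. expectation (\<lambda>\<omega>. g (W n \<omega>))) \<longlonglongrightarrow> (\<integral>v. g v \<partial>std_normal_vec)"
    if "continuous_on UNIV g" "\<And>x. \<bar>g x\<bar> \<le> B"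
    unfolding W using that by (rule clt(3))
qed

text \<open>With \<open>d\<close> the fluctuation at \<open>x0\<close>, the difference comes from
  replacing \<open>D n\<close> by \<open>d\<close> and the random whitening by the fixed one; both
  cost a vanishing multiple of \<open>sqrt n * norm d\<close>. Undoing the whitening with
  \<open>psd_sqrt Sig0\<close> bounds this by a multiple of the norm of \<open>W n\<close>.\<close>

lemma AE_V_close_W:
  "AE \<omega> in M. \<exists>\<eta>. \<eta> \<longlonglongrightarrow> 0 \<and> (\<forall>\<^sub>F n in sequentially. norm (V n \<omega> - W n \<omega>) \<le> \<eta> n * norm (W n \<omega>))"
  using AE_convergence
proof eventually_elim
  case (elim \<omega>)
  then obtain \<epsilon> where lim: "(\<lambda>n. Sig n \<omega>) \<longlonglongrightarrow> Sig0" and G: "\<forall>i\<ge>1. \<xi>s i \<omega> \<in> G" and \<epsilon>: "\<epsilon> \<longlonglongrightarrow> 0"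
    "\<forall>\<^sub>F n in sequentially. norm (D n \<omega> - (fn n \<omega> x0 - f0 x0)) \<le> \<epsilon> n * norm (fn n \<omega> x0 - f0 x0)" by blast
  define R where "R n = inv_sqrt (Sig n \<omega>)" for n
  let ?R0 = "inv_sqrt Sig0" and ?Q = "psd_sqrt Sig0"
  have Rlim: "R \<longlonglongrightarrow> ?R0"
    unfolding R_def[abs_def] using lim psd_Sig psd_Sig0 invertible_Sig0 by (intro tendsto_inv_sqrt) auto
  define \<eta> where "\<eta> n = (norm (R n) * \<epsilon> n + norm (R n - ?R0)) * norm ?Q" for n
  have "\<eta> \<longlonglongrightarrow> (norm ?R0 * 0 + norm (?R0 - ?R0)) * norm ?Q"
    unfolding \<eta>_def by (intro tendsto_intros Rlim \<epsilon>)
  then have "\<eta> \<longlonglongrightarrow> 0" by simp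
  moreover have "\<forall>\<^sub>F n in sequentially. norm (V n \<omega> - W n \<omega>) \<le> \<eta> n * norm (W n \<omega>)"
    using \<epsilon>(2)
  proof eventually_elim
    case (elim n)
    define d where "d = fn n \<omega> x0 - f0 x0"
    have Wd: "W n \<omega> = - (sqrt (real n) *\<^sub>R (?R0 *v d))" by (simp add: W_eq[OF G] d_def)
    have "?Q *v W n \<omega> = - (sqrt (real n) *\<^sub>R d)"
    proof -
      have "?Q ** ?R0 = mat 1"
        unfolding inv_sqrt_def using invertible_psd_sqrt[OF psd_Sig0 invertible_Sig0] by (rule matrix_mult_inv)
      then show ?thesis
        by (simp add: Wd matrix_vector_mult_scaleR matrix_vector_mul_assoc linear_neg[OF matrix_vector_mul_linear])
    qed
    then have "sqrt (real n) * norm d = norm (?Q *v W n \<omega>)" by simp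
    also have "\<dots> \<le> norm ?Q * norm (W n \<omega>)" by (rule norm_matrix_vector_mult_le)
    finally have dW: "sqrt (real n) * norm d \<le> norm ?Q * norm (W n \<omega>)" .
    have eps: "norm (D n \<omega> - d) \<le> \<epsilon> n * norm d" using elim by (simp add: d_def)
    have "V n \<omega> - W n \<omega> = - (sqrt (real n) *\<^sub>R (R n *v (D n \<omega> - d) + (R n - ?R0) *v d))"
      by (simp add: V_def R_def Wd matrix_vector_mult_diff_distrib matrix_vector_mult_diff_rdistrib scaleR_diff_right)
    then have "norm (V n \<omega> - W n \<omega>) = sqrt (real n) * norm (R n *v (D n \<omega> - d) + (R n - ?R0) *v d)"
      by simp
    also have "\<dots> \<le> sqrt (real n) * (norm (R n) * (\<epsilon> n * norm d) + norm (R n - ?R0) * norm d)"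
    proof (intro mult_left_mono norm_triangle_mono)
      show "norm (R n *v (D n \<omega> - d)) \<le> norm (R n) * (\<epsilon> n * norm d)"
        using norm_matrix_vector_mult_le eps by (meson mult_left_mono norm_ge_zero order_trans)
    qed (simp_all add: norm_matrix_vector_mult_le)
    also have "\<dots> = (norm (R n) * \<epsilon> n + norm (R n - ?R0)) * (sqrt (real n) * norm d)"
      by (simp add: algebra_simps)
    also have "\<dots> \<le> \<eta> n * norm (W n \<omega>)"
    \<comment> \<open>Nonnegativity of \<open>\<epsilon> n\<close> is not assumed: for nonzero
      \<open>d\<close> the error bound forces it, and for \<open>d = 0\<close> both sides
      vanish.\<close>
    proof (cases "d = 0")
      case True
      then show ?thesis by (simp add: Wd)
    next
      case False
      then have "0 \<le> \<epsilon> n" using order_trans[OF norm_ge_zero eps] by (simp add: zero_le_mult_iff)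
      then show ?thesis unfolding \<eta>_def mult.assoc by (intro mult_left_mono dW) simp
    qed
    finally show ?case .
  qed
  ultimately show ?case by blast
qed

text \<open>The moment conditions of \<open>slutsky\<close> fall on \<open>W\<close> alone;
  \<open>V\<close> contains the inverse of a random matrix and has no controlled moments.\<close>

theorem V_converges: "converges_in_distribution (completion M) V std_normal_vec"
  unfolding converges_in_distribution_def
proof (intro conjI allI impI)
  show "V n \<in> borel_measurable (completion M)" for n by (rule V_measurable)
  interpret c: prob_space "completion M" by (rule prob_space_completion)
  fix g :: "real^'q \<Rightarrow> real" assume g: "continuous_on UNIV g \<and> bounded (range g)"
  then obtain B where B: "\<And>x. \<bar>g x\<bar> \<le> B" by (auto simp: bounded_iff)
  have [measurable]: "g \<in> borel_measurable borel" using g by (auto intro: borel_measurable_continuous_onI)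
  have Wc [measurable]: "W n \<in> borel_measurable (completion M)" for n
    by (rule measurable_completion[OF W_measurable])
  show "(\<lambda>n. \<integral>\<omega>. g (V n \<omega>) \<partial>completion M) \<longlonglongrightarrow> (\<integral>v. g v \<partial>std_normal_vec)"
  proof (rule c.slutsky[where W = W and D = "CARD('q)"])
    show "integrable (completion M) (\<lambda>\<omega>. (norm (W n \<omega>))\<^sup>2)" for n
      using W_sq_integrable by (subst integrable_completion) auto
    show "(\<integral>\<omega>. (norm (W n \<omega>))\<^sup>2 \<partial>completion M) \<le> CARD('q)" for n
      using W_sq_le by (subst integral_completion) auto
    show "AE \<omega> in completion M. \<exists>\<eta>. \<eta> \<longlonglongrightarrow> 0 \<and> (\<forall>\<^sub>F n in sequentially. norm (V n \<omega> - W n \<omega>) \<le> \<eta> n * norm (W n \<omega>))"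
      by (rule AE_completion[OF AE_V_close_W])
    show "(\<lambda>n. \<integral>\<omega>. g (W n \<omega>) \<partial>completion M) \<longlonglongrightarrow> (\<integral>v. g v \<partial>std_normal_vec)"
      using W_limit[of g B] g B by (subst integral_completion) auto
  qed (use g B in auto)
qed

text \<open>Once the sample covariance is invertible, the quadratic form of the region at
  \<open>z0\<close> is the squared norm of \<open>V n\<close>. Almost surely this holds from some
  index on.\<close>

lemma
  assumes "0 \<le> \<alpha>" "\<alpha> \<le> 1"
  defines "E \<equiv> \<lambda>n. {\<omega> \<in> space M. z0 \<in> confidence_region n (fn n \<omega>) S (z n \<omega>) (Sig n \<omega>) \<alpha>}"
  shows confidence_region_measurable: "E n \<in> sets (completion M)"
    and confidence_region_probability: "(\<lambda>n. measure (completion M) (E n)) \<longlonglongrightarrow> 1 - \<alpha>"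
proof -
  interpret c: prob_space "completion M" by (rule prob_space_completion)
  let ?q = "\<lambda>n \<omega>. real n * (D n \<omega> \<bullet> (matrix_inv (Sig n \<omega>) *v D n \<omega>))"
  have E: "E n = {\<omega> \<in> space (completion M). ereal (?q n \<omega>) \<le> chi_square_quantile CARD('q) \<alpha>}" for n
    unfolding E_def confidence_region_def D_def by simp
  have [measurable]: "?q n \<in> borel_measurable (completion M)" for n by measurable
  show meas: "E n \<in> sets (completion M)" for n unfolding E by measurable
  let ?A = "\<lambda>n. {\<omega> \<in> space (completion M). ereal ((norm (V n \<omega>))\<^sup>2) \<le> chi_square_quantile CARD('q) \<alpha>}"
  show "(\<lambda>n. measure (completion M) (E n)) \<longlonglongrightarrow> 1 - \<alpha>"
  proof (rule c.measure_tendsto_if_eventually_iff[where A = ?A])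
    show "?A n \<in> sets (completion M)" for n by measurable
    show "(\<lambda>n. measure (completion M) (?A n)) \<longlonglongrightarrow> 1 - \<alpha>"
      using converges_in_distribution_chi_square_quantile[OF prob_space_completion V_converges assms(1,2)] .
    show "AE \<omega> in completion M. \<forall>\<^sub>F n in sequentially. \<omega> \<in> ?A n \<longleftrightarrow> \<omega> \<in> E n"
      using AE_completion[OF AE_eventually_invertible]
    proof eventually_elim
      case (elim \<omega>)
      then show ?case
      proof eventually_elim
        case (elim n)
        have "(norm (V n \<omega>))\<^sup>2 = real n * (norm (inv_sqrt (Sig n \<omega>) *v D n \<omega>))\<^sup>2"
          by (simp add: V_def power_mult_distrib)
        then have "(norm (V n \<omega>))\<^sup>2 = ?q n \<omega>"
          using inv_sqrt_quadratic_form[OF psd_Sig elim] by simp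
        then show ?case unfolding E by simp
      qed
    qed
  qed (rule meas)
qed

end

section \<open>Extracting a regular sample from the almost sure hypotheses\<close>

lemma (in prob_space) covariance_matrix_cong_AE:
  assumes [measurable]: "Y \<in> borel_measurable M" "Y' \<in> borel_measurable M" and eq: "AE \<omega> in M. Y \<omega> = Y' \<omega>"
  shows "covariance_matrix M Y = covariance_matrix M Y'"
proof -
  have [measurable]: "(\<lambda>\<omega>. Y \<omega> $ i) \<in> borel_measurable M" "(\<lambda>\<omega>. Y' \<omega> $ i) \<in> borel_measurable M" for i
    unfolding cart_eq_inner_axis by measurable
  have mean: "expectation (\<lambda>\<omega>. Y \<omega> $ i) = expectation (\<lambda>\<omega>. Y' \<omega> $ i)" for i
    using eq by (intro integral_cong_AE) auto
  have "expectation (\<lambda>\<omega>. (Y \<omega> $ i - m) * (Y \<omega> $ j - m')) = expectation (\<lambda>\<omega>. (Y' \<omega> $ i - m) * (Y' \<omega> $ j - m'))" for i j m m'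
    using eq by (intro integral_cong_AE) auto
  then show ?thesis unfolding covariance_matrix_def mean by simp
qed

lemma (in prob_space) integrable_norm_sq_cong_AE:
  fixes Y Y' :: "'a \<Rightarrow> 'b::{banach, second_countable_topology}"
  assumes [measurable]: "Y' \<in> borel_measurable M" and eq: "AE \<omega> in M. Y \<omega> = Y' \<omega>"
    and fin: "(\<integral>\<^sup>+ \<omega>. ennreal ((norm (Y \<omega>))\<^sup>2) \<partial>M) < \<infinity>"
  shows "integrable M (\<lambda>\<omega>. (norm (Y' \<omega>))\<^sup>2)"
proof (rule integrableI_bounded)
  have "(\<integral>\<^sup>+ \<omega>. ennreal (norm ((norm (Y' \<omega>))\<^sup>2)) \<partial>M) = (\<integral>\<^sup>+ \<omega>. ennreal ((norm (Y \<omega>))\<^sup>2) \<partial>M)"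
    using eq by (intro nn_integral_cong_AE) auto
  with fin show "(\<integral>\<^sup>+ \<omega>. ennreal (norm ((norm (Y' \<omega>))\<^sup>2)) \<partial>M) < \<infinity>" by simp
qed measurable

text \<open>The random Lipschitz bound \<open>C\<close> is attached to \<open>\<xi>\<close> only; the copies of \<open>\<xi>\<close> need a bound that is a
  function of the sample point, namely the best constant, which is a countable supremum.\<close>

lemma (in prob_space) exists_regular_sample:
  fixes \<xi> :: "'a \<Rightarrow> real^'d" and F :: "real^'q \<Rightarrow> real^'d \<Rightarrow> real^'q"
  assumes \<xi>: "\<xi> \<in> borel_measurable M" "closed \<Xi>" "AE \<omega> in M. \<xi> \<omega> \<in> \<Xi>"
    and iid: "indep_vars (\<lambda>_. borel) \<xi>s {1..}" "\<And>i. i \<ge> 1 \<Longrightarrow> distr M borel (\<xi>s i) = distr M borel \<xi>"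
    and U: "open U" "x0 \<in> U"
    and F: "(\<lambda>p. F (fst p) (snd p)) \<in> borel_measurable (restrict_space borel (U \<times> \<Xi>))"
      "\<And>x. x \<in> U \<Longrightarrow> integrable M (\<lambda>\<omega>. F x (\<xi> \<omega>))"
    and F_sq: "(\<integral>\<^sup>+ \<omega>. ennreal ((norm (F x0 (\<xi> \<omega>)))\<^sup>2) \<partial>M) < \<infinity>"
    and C1: "AE s in distr M borel \<xi>. C1_on U (\<lambda>x. F x s)"
    and J_sq: "(\<integral>\<^sup>+ \<omega>. ennreal ((norm (jacobian (\<lambda>y. F y (\<xi> \<omega>)) (at x0)))\<^sup>2) \<partial>M) < \<infinity>"
    and C: "C \<in> borel_measurable M" "integrable M (\<lambda>\<omega>. (C \<omega>)\<^sup>2)"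
      "AE \<omega> in M. \<forall>x\<in>U. \<forall>x'\<in>U.
         norm (F x (\<xi> \<omega>) - F x' (\<xi> \<omega>))
         + norm (jacobian (\<lambda>y. F y (\<xi> \<omega>)) (at x) - jacobian (\<lambda>y. F y (\<xi> \<omega>)) (at x'))
         \<le> C \<omega> * norm (x - x')"
  shows "\<exists>G \<Lambda> \<delta>. regular_sample U F G M \<xi> \<xi>s x0 \<Lambda> \<delta>"
proof -
  note [measurable] = \<xi>(1) C(1)
  have [measurable]: "\<Xi> \<in> sets borel" using \<xi>(2) by simp
  have "AE s in distr M borel \<xi>. s \<in> \<Xi>" using \<xi>(3) by (subst AE_distr_iff) auto
  with C1 have "AE s in distr M borel \<xi>. s \<in> \<Xi> \<and> C1_on U (\<lambda>x. F x s)" by eventually_elim simp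
  then obtain N where N: "N \<in> null_sets (distr M borel \<xi>)"
    "{s \<in> space (distr M borel \<xi>). \<not> (s \<in> \<Xi> \<and> C1_on U (\<lambda>x. F x s))} \<subseteq> N"
    unfolding eventually_ae_filter by blast
  \<comment> \<open>The exact set of smooth sample points is not known to be Borel, so the
    complement of a Borel null set containing all bad points is used.\<close>
  define G0 where "G0 = - N"
  have G0 [measurable]: "G0 \<in> sets borel" using N(1) by (auto simp: G0_def)
  have G0_sub: "s \<in> \<Xi>" "C1_on U (\<lambda>x. F x s)" if "s \<in> G0" for s
    using N(2) that by (auto simp: G0_def)
  have "AE s in distr M borel \<xi>. s \<in> G0"
    using AE_not_in[OF N(1)] by eventually_elim (simp add: G0_def)
  then have AE_G0: "AE \<omega> in M. \<xi> \<omega> \<in> G0" by (subst (asm) AE_distr_iff) auto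
  have reg: "regular_field U F A" if A: "A \<in> sets borel" "A \<subseteq> G0" for A
  proof
    have UX: "U \<times> \<Xi> \<in> sets borel" "U \<times> A \<in> sets borel"
      using U(1) A(1) by (auto intro!: borel_Times)
    have "(\<lambda>p. if p \<in> U \<times> \<Xi> then F (fst p) (snd p) else 0) \<in> borel_measurable borel"
      using F(1) UX by (subst (asm) measurable_restrict_space_iff[where c = 0]) auto
    then have "(\<lambda>p. indicator (U \<times> A) p *\<^sub>R (if p \<in> U \<times> \<Xi> then F (fst p) (snd p) else 0)) \<in> borel_measurable borel"
      using UX(2) by (intro borel_measurable_scaleR borel_measurable_indicator)
    also have "(\<lambda>p. indicator (U \<times> A) p *\<^sub>R (if p \<in> U \<times> \<Xi> then F (fst p) (snd p) else 0))
        = (\<lambda>p. if fst p \<in> U \<and> snd p \<in> A then F (fst p) (snd p) else 0)"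
      using G0_sub(1) A(2) by (auto simp: fun_eq_iff mem_Times_iff indicator_def)
    finally show "(\<lambda>p. if fst p \<in> U \<and> snd p \<in> A then F (fst p) (snd p) else 0) \<in> borel_measurable borel" .
  qed (use U A G0_sub(2) in auto)
  interpret R0: regular_field U F G0 by (rule reg) auto
  obtain \<delta> where \<delta>: "\<delta> > 0" "ball x0 \<delta> \<subseteq> U" using U by (auto simp: open_contains_ball)
  obtain Q :: "(real^'q) set" where Q: "countable Q" "\<And>X. open X \<Longrightarrow> X \<noteq> {} \<Longrightarrow> \<exists>d\<in>Q. d \<in> X"
    by (rule countable_dense_setE) blast
  \<comment> \<open>The point \<open>x0\<close> is removed so that the Lipschitz quotients below
    have nonzero denominators.\<close>
  define A where "A = (Q \<inter> ball x0 \<delta>) - {x0}"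
  have "countable A" using Q(1) by (auto simp: A_def)
  define \<phi> where "\<phi> y s = norm (R0.Fm y s - R0.Fm x0 s) + norm (R0.Jm y s - R0.Jm x0 s)" for y s
  have [measurable]: "\<phi> y \<in> borel_measurable borel" for y unfolding \<phi>_def[abs_def] by measurable
  have \<phi>_eq: "\<phi> y s = norm (F y s - F x0 s) + norm (jacobian (\<lambda>x. F x s) (at y) - jacobian (\<lambda>x. F x s) (at x0))"
    if "s \<in> G0" "y \<in> U" for y s
    using that U by (simp add: \<phi>_def R0.Fm_def R0.Jm_def)
  \<comment> \<open>Extended values allow the supremum before it is known to be finite; sample
    points with infinite value are then dropped from \<open>G\<close>.\<close>
  define \<Lambda>' where "\<Lambda>' s = (SUP y\<in>A. ennreal (\<phi> y s / norm (y - x0)))" for s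
  have [measurable]: "\<Lambda>' \<in> borel_measurable borel"
    unfolding \<Lambda>'_def[abs_def] by (intro borel_measurable_SUP \<open>countable A\<close>) measurable
  define G where "G = G0 \<inter> {s. \<Lambda>' s < \<infinity>}"
  define \<Lambda> where "\<Lambda> s = enn2real (\<Lambda>' s)" for s
  have G [measurable]: "G \<in> sets borel" unfolding G_def by measurable
  have \<Lambda>_le: "AE \<omega> in M. \<xi> \<omega> \<in> G0 \<and> \<Lambda>' (\<xi> \<omega>) \<le> ennreal (C \<omega>)"
    using AE_G0 C(3)
  proof eventually_elim
    case (elim \<omega>)
    have "ennreal (\<phi> y (\<xi> \<omega>) / norm (y - x0)) \<le> ennreal (C \<omega>)" if "y \<in> A" for y
    proof (rule ennreal_leI)
      have "y \<in> U" "norm (y - x0) > 0" using that \<delta> by (auto simp: A_def)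
      moreover have "\<phi> y (\<xi> \<omega>) \<le> C \<omega> * norm (y - x0)"
        using elim U \<open>y \<in> U\<close> by (simp add: \<phi>_eq)
      ultimately show "\<phi> y (\<xi> \<omega>) / norm (y - x0) \<le> C \<omega>" by (simp add: pos_divide_le_eq)
    qed
    with elim show ?case by (auto simp: \<Lambda>'_def intro: SUP_least)
  qed
  \<comment> \<open>Failure of the bound at \<open>y\<close> is an open condition by continuity of
    \<open>F\<close> and its Jacobian, so it would also occur at a point of the countable dense
    set.\<close>
  have lip: "\<phi> y s \<le> \<Lambda> s * norm (y - x0)" if s: "s \<in> G" and y: "y \<in> ball x0 \<delta>" for y s
  proof (rule ccontr)
    assume neg: "\<not> \<phi> y s \<le> \<Lambda> s * norm (y - x0)"
    have sG: "s \<in> G0" using s by (simp add: G_def)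
    let ?g = "\<lambda>y. norm (F y s - F x0 s) + norm (jacobian (\<lambda>x. F x s) (at y) - jacobian (\<lambda>x. F x s) (at x0)) - \<Lambda> s * norm (y - x0)"
    have "continuous_on U ?g"
      by (intro continuous_intros R0.continuous_on_F R0.continuous_on_jacobian sG)
    then have "open (ball x0 \<delta> \<inter> ?g -` {0<..})"
      using \<delta> by (intro continuous_open_preimage) (auto intro: continuous_on_subset)
    moreover have "y \<in> ball x0 \<delta> \<inter> ?g -` {0<..}"
      using neg y \<delta> \<phi>_eq[OF sG, of y] by auto
    ultimately obtain d where d: "d \<in> Q" "d \<in> ball x0 \<delta>" "?g d > 0" using Q(2) by blast
    have "d \<noteq> x0" using d(3) by auto
    with d have "d \<in> A" by (simp add: A_def)
    then have "ennreal (\<phi> d s / norm (d - x0)) \<le> \<Lambda>' s"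
      unfolding \<Lambda>'_def by (rule SUP_upper)
    also have "\<Lambda>' s = ennreal (\<Lambda> s)" using s by (simp add: G_def \<Lambda>_def)
    finally have "\<phi> d s / norm (d - x0) \<le> \<Lambda> s" by (simp add: \<Lambda>_def)
    then have "\<phi> d s \<le> \<Lambda> s * norm (d - x0)" using \<open>d \<noteq> x0\<close> by (simp add: pos_divide_le_eq)
    then show False using d(2,3) \<delta> \<phi>_eq[OF sG, of d] by auto
  qed
  interpret R: regular_field U F G by (rule reg) (auto simp: G_def)
  have AE_G: "AE \<omega> in M. \<xi> \<omega> \<in> G"
    using \<Lambda>_le by eventually_elim (auto simp: G_def intro: le_less_trans)
  have "regular_sample U F G M \<xi> \<xi>s x0 \<Lambda> \<delta>"
  proof
    show "\<Lambda> \<in> borel_measurable borel" unfolding \<Lambda>_def[abs_def] by measurable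
    show "0 \<le> \<Lambda> s" for s by (simp add: \<Lambda>_def)
    show "integrable M (\<lambda>\<omega>. (\<Lambda> (\<xi> \<omega>))\<^sup>2)"
    proof (rule Bochner_Integration.integrable_bound[OF C(2)])
      show "(\<lambda>\<omega>. (\<Lambda> (\<xi> \<omega>))\<^sup>2) \<in> borel_measurable M" unfolding \<Lambda>_def by measurable
      show "AE \<omega> in M. norm ((\<Lambda> (\<xi> \<omega>))\<^sup>2) \<le> norm ((C \<omega>)\<^sup>2)"
        using \<Lambda>_le
      proof eventually_elim
        case (elim \<omega>)
        then have "\<Lambda>' (\<xi> \<omega>) \<le> ennreal \<bar>C \<omega>\<bar>" by (auto intro: order_trans ennreal_leI)
        then have "\<Lambda> (\<xi> \<omega>) \<le> \<bar>C \<omega>\<bar>" unfolding \<Lambda>_def using enn2real_mono[of _ "ennreal \<bar>C \<omega>\<bar>"] by simp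
        then have "(\<Lambda> (\<xi> \<omega>))\<^sup>2 \<le> \<bar>C \<omega>\<bar>\<^sup>2" by (intro power_mono) (auto simp: \<Lambda>_def)
        then show ?case by simp
      qed
    qed
    show "norm (F y s - F x0 s) + norm (jacobian (\<lambda>x. F x s) (at y) - jacobian (\<lambda>x. F x s) (at x0)) \<le> \<Lambda> s * norm (y - x0)"
      if "s \<in> G" "y \<in> ball x0 \<delta>" for s y
      using lip[OF that] \<phi>_eq[of s y] that \<delta> by (auto simp: G_def)
    show "integrable M (\<lambda>\<omega>. (norm (R.Fm x0 (\<xi> \<omega>)))\<^sup>2)"
      by (rule integrable_norm_sq_cong_AE[OF _ _ F_sq]) (measurable, use AE_G U in \<open>auto simp: R.Fm_def\<close>)
    show "integrable M (\<lambda>\<omega>. (norm (R.Jm x0 (\<xi> \<omega>)))\<^sup>2)"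
      by (rule integrable_norm_sq_cong_AE[OF _ _ J_sq]) (measurable, use AE_G U in \<open>auto simp: R.Jm_def\<close>)
  qed (use \<xi> iid AE_G U \<delta> F(2) in auto)
  then show ?thesis by blast
qed

text \<open>The inclusion says that \<open>- g x\<close> is normal to \<open>S\<close> at
  \<open>x\<close>, which is the variational inequality characterising \<open>x\<close> as the
  projection of \<open>x - g x\<close>.\<close>

lemma closest_point_solution:
  fixes S :: "'a::euclidean_space set"
  assumes "convex S" "closed S" "solves_gen_eq g S x"
  shows "x \<in> S" "closest_point S (x - g x) = x"
proof -
  from assms(3) have N: "- g x \<in> normal_cone S x"
    unfolding solves_gen_eq_def by (auto simp: add_eq_0_iff)
  then show "x \<in> S" by (simp add: normal_cone_def)
  with N assms show "closest_point S (x - g x) = x"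
    by (intro closest_point_eqI) (auto simp: normal_cone_def)
qed

theorem theorem4p1:
  fixes M :: "'w measure"
    and \<xi> :: "'w \<Rightarrow> real^'d"
    and \<xi>s :: "nat \<Rightarrow> 'w \<Rightarrow> real^'d"
    and \<Xi> :: "(real^'d) set"
    and \<O> S X0 Z :: "(real^'q) set"
    and F :: "real^'q \<Rightarrow> real^'d \<Rightarrow> real^'q"
    and f0 :: "real^'q \<Rightarrow> real^'q"
    and fs :: "nat \<Rightarrow> 'w \<Rightarrow> real^'q \<Rightarrow> real^'q"
    and C :: "'w \<Rightarrow> real"
    and x0 z0 :: "real^'q"
    and L LK :: "real^'q \<Rightarrow> real^'q"
    and K :: "(real^'q) set"
    and z x :: "nat \<Rightarrow> 'w \<Rightarrow> real^'q"
    and Sigma0 :: "real^'q^'q"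
    and Sigma :: "nat \<Rightarrow> 'w \<Rightarrow> real^'q^'q"
    and \<alpha> :: real
  assumes M: "prob_space M"
    and \<xi>: "\<xi> \<in> borel_measurable M" "closed \<Xi>" "AE \<omega> in M. \<xi> \<omega> \<in> \<Xi>"
    and iid: "prob_space.indep_vars M (\<lambda>_. borel) \<xi>s {1..}"
      "\<And>i. i \<ge> 1 \<Longrightarrow> distr M borel (\<xi>s i) = distr M borel \<xi>"
    and \<O>: "open \<O>"
    and F: "(\<lambda>p. F (fst p) (snd p)) \<in> borel_measurable (restrict_space borel (\<O> \<times> \<Xi>))"
      "\<And>x. x \<in> \<O> \<Longrightarrow> integrable M (\<lambda>\<omega>. F x (\<xi> \<omega>))"
    and S: "polyhedron S"
    and f0: "f0 = (\<lambda>x. LINT \<omega>|M. F x (\<xi> \<omega>))"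
    and fs: "fs = (\<lambda>n \<omega> x. (1 / real n) *\<^sub>R (\<Sum>i=1..n. F x (\<xi>s i \<omega>)))"
    and a: "\<And>x. x \<in> \<O> \<Longrightarrow> (\<integral>\<^sup>+ \<omega>. ennreal ((norm (F x (\<xi> \<omega>)))\<^sup>2) \<partial>M) < \<infinity>"
    and b: "AE s in distr M borel \<xi>. C1_on \<O> (\<lambda>x. F x s)"
      "\<And>x. x \<in> \<O> \<Longrightarrow>
        (\<integral>\<^sup>+ \<omega>. ennreal ((norm (jacobian (\<lambda>y. F y (\<xi> \<omega>)) (at x)))\<^sup>2) \<partial>M) < \<infinity>"
    and c: "C \<in> borel_measurable M" "integrable M (\<lambda>\<omega>. (C \<omega>)\<^sup>2)"
      "AE \<omega> in M. \<forall>x\<in>\<O>. \<forall>x'\<in>\<O>.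
         norm (F x (\<xi> \<omega>) - F x' (\<xi> \<omega>))
         + norm (jacobian (\<lambda>y. F y (\<xi> \<omega>)) (at x) - jacobian (\<lambda>y. F y (\<xi> \<omega>)) (at x'))
         \<le> C \<omega> * norm (x - x')"
    and x0: "x0 \<in> S \<inter> \<O>" "solves_gen_eq f0 S x0"
    and z0: "z0 = x0 - f0 x0"
    and L: "L = frechet_derivative f0 (at x0)"
    and K: "K = tangent_cone S x0 \<inter> {v. v \<bullet> (z0 - x0) = 0}"
    and LK: "LK = (\<lambda>h. L (closest_point K h) + h - closest_point K h)"
      "\<exists>LK'. homeomorphism UNIV UNIV LK LK'"
    and nbhds: "X0 \<subseteq> \<O>" "x0 \<in> interior X0" "z0 \<in> interior Z"
    and z: "\<And>n. z n \<in> borel_measurable M"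
      "\<And>n \<omega>. \<omega> \<in> space M \<Longrightarrow> closest_point S (z n \<omega>) \<in> \<O>"
    and x: "x = (\<lambda>n \<omega>. closest_point S (z n \<omega>))"
    and solutions: "AE \<omega> in M. \<exists>N. \<forall>n\<ge>N.
         {y \<in> Z. closest_point S y \<in> \<O> \<and> normal_map (fs n \<omega>) S y = 0} = {z n \<omega>} \<and>
         {y \<in> X0. solves_gen_eq (fs n \<omega>) S y} = {x n \<omega>}"
    and Sigma0: "Sigma0 = covariance_matrix M (\<lambda>\<omega>. F x0 (\<xi> \<omega>))" "invertible Sigma0"
    and Sigma: "Sigma = (\<lambda>n \<omega>. sample_covariance_matrix n (\<lambda>i. F (x n \<omega>) (\<xi>s i \<omega>)))"
    and \<alpha>: "0 \<le> \<alpha>" "\<alpha> \<le> 1"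
  shows "(AE \<omega> in M. \<exists>N. \<forall>n\<ge>N. invertible (Sigma n \<omega>)) \<and>
    converges_in_distribution (completion M)
      (\<lambda>n \<omega>. - (sqrt (real n) *\<^sub>R
          (inv_sqrt (Sigma n \<omega>) *v normal_map_deriv (fs n \<omega>) S (z n \<omega>) (z0 - z n \<omega>))))
      std_normal_vec \<and>
    (\<forall>n. {\<omega> \<in> space M. z0 \<in> confidence_region n (fs n \<omega>) S (z n \<omega>) (Sigma n \<omega>) \<alpha>}
          \<in> sets (completion M)) \<and>
    (\<lambda>n. measure (completion M)
          {\<omega> \<in> space M. z0 \<in> confidence_region n (fs n \<omega>) S (z n \<omega>) (Sigma n \<omega>) \<alpha>})
      \<longlonglongrightarrow> 1 - \<alpha>"
proof -
  interpret prob_space M by (rule M)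
  have S': "convex S" "closed S" using S by (simp_all add: polyhedron_imp_convex polyhedron_imp_closed)
  have x0U: "x0 \<in> \<O>" using x0(1) by blast
  have proj: "closest_point S z0 = x0"
    unfolding z0 using closest_point_solution[OF S' x0(2)] by blast
  obtain G \<Lambda> \<delta> where "regular_sample \<O> F G M \<xi> \<xi>s x0 \<Lambda> \<delta>"
    using exists_regular_sample[OF \<xi> iid \<O> x0U F a[OF x0U] b(1) b(2)[OF x0U] c] by blast
  then interpret R: regular_sample \<O> F G M \<xi> \<xi>s x0 \<Lambda> \<delta> .
  have f0_eq: "R.f0 = f0" unfolding f0 R.f0_def[abs_def] ..
  have fs_eq: "R.fn n \<omega> = fs n \<omega>" for n \<omega> unfolding fs R.fn_def[abs_def] ..
  \<comment> \<open>Identifying the derivative of \<open>f0\<close> with the mean Jacobian makes the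
    given map \<open>LK\<close> the one built from \<open>R.J0\<close>.\<close>
  have L_eq: "L = (*v) R.J0" using R.f0_derivative unfolding L f0_eq .
  obtain LK' where LK': "homeomorphism UNIV UNIV LK LK'" using LK(2) by blast
  have Fm_measurable: "(\<lambda>\<omega>. R.Fm x0 (\<xi> \<omega>)) \<in> borel_measurable M" by measurable
  \<comment> \<open>The given covariance is that of \<open>F x0\<close>; its Borel version agrees
    with it almost surely.\<close>
  have cov: "covariance_matrix M (\<lambda>\<omega>. R.Fm x0 (\<xi> \<omega>)) = Sigma0"
    unfolding Sigma0(1) using F(2)[OF x0U] Fm_measurable R.AE_F_eq_Fm[OF x0U]
    by (intro covariance_matrix_cong_AE) auto
  interpret N: saa_solutions \<O> F G M \<xi> \<xi>s x0 \<Lambda> \<delta> S Z K z0 LK LK' z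
  proof
    show "AE \<omega> in M. \<forall>\<^sub>F n in sequentially.
        {y \<in> Z. closest_point S y \<in> \<O> \<and> normal_map (R.fn n \<omega>) S y = 0} = {z n \<omega>}"
      using solutions unfolding fs_eq eventually_sequentially by eventually_elim blast
    show "x0 = closest_point S z0" using proj ..
    show "S \<noteq> {}" using x0(1) by blast
    show "LK h = R.J0 *v closest_point K h + h - closest_point K h" for h
      unfolding LK(1) L_eq ..
    show "invertible (covariance_matrix M (\<lambda>\<omega>. R.Fm x0 (\<xi> \<omega>)))"
      unfolding cov by (rule Sigma0(2))
    show "z0 = x0 - R.f0 x0" unfolding f0_eq by (rule z0)
  qed (fact S K LK' nbhds(3) z)+
  have Sig_eq: "N.Sig n \<omega> = Sigma n \<omega>" for n \<omega>
    unfolding N.Sig_def N.xn_def Sigma x ..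
  have "AE \<omega> in M. \<exists>N. \<forall>n\<ge>N. invertible (Sigma n \<omega>)"
    using N.AE_eventually_invertible unfolding Sig_eq eventually_sequentially .
  moreover have "converges_in_distribution (completion M)
      (\<lambda>n \<omega>. - (sqrt (real n) *\<^sub>R
          (inv_sqrt (Sigma n \<omega>) *v normal_map_deriv (fs n \<omega>) S (z n \<omega>) (z0 - z n \<omega>))))
      std_normal_vec"
    using N.V_converges unfolding N.V_def[abs_def] N.D_def Sig_eq fs_eq .
  moreover note N.confidence_region_measurable[OF \<alpha>, unfolded Sig_eq fs_eq]
    N.confidence_region_probability[OF \<alpha>, unfolded Sig_eq fs_eq]
  ultimately show ?thesis by blast
qed

end
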